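(* Let $\alpha\in[1,2)$ and assume $\beta<\infty$ and $\gamma^{(\alpha)}<\infty$. Let $p=p(\alpha,k)$ be the largest integer with $0\le p\le k$ and $p<(\alpha-1)/(2-\alpha)$, with $p=0$ if no such positive integer exists (so $N_p=\Phi$ when $\alpha\le3/2$). Then $$\|F_{\mathbb{S}}-N_p\|\le c\,(\beta+\gamma^{(\alpha)}),$$ where $c>0$ depends only on $k$ and $\alpha$; it does not depend on $n$, on the distribution of $X$, or on the functions $l,t_j$.
   Context: **Setting.** Let $k\ge1$ and $n\ge1$ be integers. Let $X,X_1,\dots,X_n$ be i.i.d. random variables. Let $l$ be a real Borel function. For $j=1,\dots,k$, let $t_j$ be a real Borel function of $j$ variables that is invariant under permutations of its arguments. Put $L_i=l(X_i)$. For $A=\{i_1,\dots,i_j\}\subset\{1,\dots,n\}$ with $|A|=j$, put $T_A=t_j(X_{i_1},\dots,X_{i_j})$, and write $T_{1\dots j}=T_{\{1,\dots,j\}}$. Define - $\mathbb{L}=\sum_iL_i$, - $\mathbb{T}_j=\sum_{|A|=j}T_A$, - $\mathbb{T}=\mathbb{T}_1+\dots+\mathbb{T}_k$, - $\mathbb{S}=\mathbb{L}+\mathbb{T}$. **Standing assumptions.** - $\mathbb{E}L_1=0$ and $n\,\mathbb{E}L_1^2=1$. - Each $t_j(X_1,\dots,X_j)$ is integrable and degenerate: $\mathbb{E}[t_j(X_1,\dots,X_j)\mid X_2,\dots,X_j]=0$ a.s. For $j=1$ this means $\mathbb{E}t_1(X_1)=0$. **Notation.** - $\beta=n\,\mathbb{E}|L_1|^3$.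 - $\gamma^{(\alpha)}=\sum_{j=1}^k\binom{n}{j}\mathbb{E}|T_{1\dots j}|^\alpha$. - $\kappa_j=\binom{n}{j}\mathbb{E}[L_1\cdots L_j\,\mathbb{T}]$. - $\Phi$ is the standard normal distribution function. - $N_0=\Phi$, and $N_p(x)=\Phi(x)+\sum_{j=1}^p(-1)^{j+1}\kappa_j\Phi^{(j+1)}(x)$. - $F_{\mathbb{S}}(x)=\mathbb{P}(\mathbb{S}\le x)$. - $\|h\|=\sup_x|h(x)|$. *)

theory Defs
  imports "HOL-Probability.Probability"
begin

definition Phi :: "real \<Rightarrow> real" where
  "Phi x = (\<integral>y. indicator {..x} y * std_normal_density y \<partial>lborel)"

definition joint :: "nat \<Rightarrow> real measure \<Rightarrow> (nat \<Rightarrow> real) measure" where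
  "joint m \<mu> = PiM {..<m} (\<lambda>_. \<mu>)"

definition TA :: "(nat \<Rightarrow> (nat \<Rightarrow> real) \<Rightarrow> real) \<Rightarrow> nat set \<Rightarrow> (nat \<Rightarrow> real) \<Rightarrow> real" where
  "TA t A \<omega> = t (card A) (\<lambda>m\<in>{..<card A}. \<omega> (sorted_list_of_set A ! m))"

definition LL :: "nat \<Rightarrow> (real \<Rightarrow> real) \<Rightarrow> (nat \<Rightarrow> real) \<Rightarrow> real" where
  "LL n l \<omega> = (\<Sum>i<n. l (\<omega> i))"

definition TTj :: "nat \<Rightarrow> (nat \<Rightarrow> (nat \<Rightarrow> real) \<Rightarrow> real) \<Rightarrow> nat \<Rightarrow> (nat \<Rightarrow> real) \<Rightarrow> real" where
  "TTj n t j \<omega> = (\<Sum>A\<in>{A. A \<subseteq> {..<n} \<and> card A = j}. TA t A \<omega>)"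

definition TT :: "nat \<Rightarrow> nat \<Rightarrow> (nat \<Rightarrow> (nat \<Rightarrow> real) \<Rightarrow> real) \<Rightarrow> (nat \<Rightarrow> real) \<Rightarrow> real" where
  "TT k n t \<omega> = (\<Sum>j=1..k. TTj n t j \<omega>)"

definition SS :: "nat \<Rightarrow> nat \<Rightarrow> (real \<Rightarrow> real) \<Rightarrow> (nat \<Rightarrow> (nat \<Rightarrow> real) \<Rightarrow> real) \<Rightarrow> (nat \<Rightarrow> real) \<Rightarrow> real" where
  "SS k n l t \<omega> = LL n l \<omega> + TT k n t \<omega>"

definition FS :: "nat \<Rightarrow> nat \<Rightarrow> real measure \<Rightarrow> (real \<Rightarrow> real) \<Rightarrow> (nat \<Rightarrow> (nat \<Rightarrow> real) \<Rightarrow> real) \<Rightarrow> real \<Rightarrow> real" where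
  "FS k n \<mu> l t x = measure (joint n \<mu>) {\<omega> \<in> space (joint n \<mu>). SS k n l t \<omega> \<le> x}"

definition beta :: "nat \<Rightarrow> real measure \<Rightarrow> (real \<Rightarrow> real) \<Rightarrow> real" where
  "beta n \<mu> l = real n * (\<integral>x. \<bar>l x\<bar> ^ 3 \<partial>\<mu>)"

definition gamma :: "real \<Rightarrow> nat \<Rightarrow> nat \<Rightarrow> real measure \<Rightarrow> (nat \<Rightarrow> (nat \<Rightarrow> real) \<Rightarrow> real) \<Rightarrow> real" where
  "gamma \<alpha> k n \<mu> t = (\<Sum>j=1..k. real (n choose j) * (\<integral>x. \<bar>t j x\<bar> powr \<alpha> \<partial>joint j \<mu>))"

definition kappa :: "nat \<Rightarrow> nat \<Rightarrow> real measure \<Rightarrow> (real \<Rightarrow> real) \<Rightarrow> (nat \<Rightarrow> (nat \<Rightarrow> real) \<Rightarrow> real) \<Rightarrow> nat \<Rightarrow> real" where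
  "kappa k n \<mu> l t j = real (n choose j) *
     (\<integral>\<omega>. (\<Prod>i<j. l (\<omega> i)) * TT k n t \<omega> \<partial>joint n \<mu>)"

definition Np :: "nat \<Rightarrow> nat \<Rightarrow> real measure \<Rightarrow> (real \<Rightarrow> real) \<Rightarrow> (nat \<Rightarrow> (nat \<Rightarrow> real) \<Rightarrow> real) \<Rightarrow> nat \<Rightarrow> real \<Rightarrow> real" where
  "Np k n \<mu> l t p x = Phi x +
     (\<Sum>j=1..p. (-1) ^ (j + 1) * kappa k n \<mu> l t j * (deriv ^^ (j + 1)) Phi x)"

definition pidx :: "real \<Rightarrow> nat \<Rightarrow> nat" where
  "pidx \<alpha> k = Max ({0} \<union> {q. q \<le> k \<and> real q < (\<alpha> - 1) / (2 - \<alpha>)})"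

definition symmetric_fun :: "nat \<Rightarrow> ((nat \<Rightarrow> real) \<Rightarrow> real) \<Rightarrow> bool" where
  "symmetric_fun j f \<longleftrightarrow> (\<forall>x \<in> space (PiM {..<j} (\<lambda>_. borel :: real measure)).
      \<forall>\<pi>. \<pi> permutes {..<j} \<longrightarrow> f (\<lambda>m\<in>{..<j}. x (\<pi> m)) = f x)"

(* degeneracy: E[t_j(X_1,...,X_j) | X_2,...,X_j] = 0 a.s.
   (coordinates 0..j-1 stand for X_1..X_j; the conditioning sigma-algebra is generated by
   coordinates 1..j-1) *)
definition degenerate :: "real measure \<Rightarrow> nat \<Rightarrow> ((nat \<Rightarrow> real) \<Rightarrow> real) \<Rightarrow> bool" where
  "degenerate \<mu> j f \<longleftrightarrow>
     (AE x in joint j \<mu>.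
        real_cond_exp (joint j \<mu>)
          (vimage_algebra (space (joint j \<mu>)) (\<lambda>x. restrict x {1..<j}) (PiM {1..<j} (\<lambda>_. \<mu>)))
          f x = 0)"

end

theory Submission
  imports Defs "HOL-Real_Asymp.Real_Asymp" "HOL-Computational_Algebra.Polynomial"
begin

text \<open>By a smoothing inequality it is enough to compare the characteristic functions for
  \<open>0 < \<tau> \<le> 1/\<beta>\<close>. Put \<open>\<phi> \<tau> = E exp(i\<tau>L\<^sub>1)\<close>. The first-order expansion
  \<open>\<phi>^n + i\<tau> E exp(i\<tau>L) T\<close> of \<open>E exp(i\<tau>S)\<close> has an error of order \<open>\<tau>^\<alpha> \<gamma>\<close>, by a von
  Bahr--Esseen bound for degenerate sums. For large \<open>\<tau>\<close> this is improved: set aside \<open>k + 1\<close> blocks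
  of \<open>m\<close> indices, and let \<open>T''\<close> be the part of \<open>T\<close> that involves some block. Expanding only in
  \<open>T''\<close> costs \<open>\<tau>^\<alpha> (m/n) \<gamma>\<close>, while every remaining term is free of the statistic's dependence on
  some block and thus gains the factor \<open>\<phi>^m\<close>. With \<open>m \<approx> n \<tau>^(-(2+\<alpha>)/2)\<close> the total is integrable
  against \<open>d\<tau>/\<tau>\<close> precisely because \<open>\<alpha> < 2\<close>. Finally degeneracy gives
  \<open>E exp(i\<tau>L) T\<close> as a sum over \<open>j\<close> of \<open>\<phi>^(n-j)\<close> times \<open>E[(exp(i\<tau>L\<^sub>1) - 1) \<dots> (exp(i\<tau>L\<^sub>j) - 1) t\<^sub>j(X\<^sub>1, \<dots>, X\<^sub>j)]\<close>,
  and Young's inequality shows that the terms with \<open>j > p\<close> are of order \<open>\<beta> + \<gamma>\<close> and that those with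
  \<open>j \<le> p\<close> may be replaced by the Edgeworth terms.\<close>

section \<open>Elementary inequalities\<close>

text \<open>The number p comes from pairing exponents. Only E|T|^\<alpha> is available, so products
  of linear terms have to be measured in the conjugate exponent \<alpha>' = \<alpha>/(\<alpha> - 1).
  For 3/2 < \<alpha> < 2 it lies between 2 and 3, and interpolation between n E L^2 = 1 and n E|L|^3
  = \<beta> gives n E|L|^\<alpha>' \<le> \<beta>^\<theta> with \<theta> = (2 - \<alpha>)/(\<alpha> -
  1). A term with j linear factors then costs \<gamma> + \<beta>^(j \<theta>), which is of order
  \<beta> + \<gamma> as soon as j \<theta> \<ge> 1; the smaller j are the ones that the Edgeworth
  terms must carry. For 1 < \<alpha> \<le> 3/2 the conjugate exponent is at least 3, the bounded
  factors exp(i\<tau>L) - 1 absorb the excess over 3, and nothing has to be carried. The range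
  \<tau> \<le> 1/\<beta> is one in which |\<phi>| \<le> exp(-\<tau>^2/(3n)); it also forces \<tau>^2
  \<le> n, because \<beta> \<ge> n^(-1/2). The comparison with N_p is made for \<beta> + \<gamma>
  \<le> 1; otherwise the claim only asks for a bound of N_p of order \<beta> + \<gamma>.\<close>

lemma norm_iexp_minus_one_le:
  fixes x s :: real
  assumes "0 \<le> s" "s \<le> 1"
  shows "cmod (iexp x - 1) \<le> 2 * \<bar>x\<bar> powr s"
proof (cases "x = 0")
  case False
  have 1: "cmod (iexp x - 1) \<le> \<bar>x\<bar>"
    using iexp_approx1[of x 0] by simp
  have 2: "cmod (iexp x - 1) \<le> 2"
    using norm_triangle_ineq4[of "iexp x" 1] by simp
  show ?thesis
  proof (cases "\<bar>x\<bar> \<le> 1")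
    case True
    have "\<bar>x\<bar> powr 1 \<le> \<bar>x\<bar> powr s"
      using True False assms by (intro powr_mono') auto
    with 1 False show ?thesis by simp
  next
    case F: False
    have "1 \<le> \<bar>x\<bar> powr s"
      using F assms by (intro ge_one_powr_ge_zero) auto
    with 2 show ?thesis by linarith
  qed
qed auto

text \<open>The quadratic Taylor bound governs |x| \<le> 1 and the linear one |x| > 1, so every
  exponent between 1 and 2 interpolates. It is used with s = \<alpha> for the remainder in T and
  with s = 3/\<alpha>' for a single linear term. The preceding lemma is the analogue for exponents
  between 0 and 1, used with s = \<alpha> - 1.\<close>

lemma norm_iexp_minus_linear_le:
  fixes x s :: real
  assumes "1 \<le> s" "s \<le> 2"
  shows "cmod (iexp x - 1 - \<i> * x) \<le> 2 * \<bar>x\<bar> powr s"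
proof (cases "x = 0")
  case False
  have 1: "cmod (iexp x - 1 - \<i> * x) \<le> \<bar>x\<bar>^2 / 2"
    using iexp_approx1[of x 1] by (simp add: diff_diff_eq numeral_2_eq_2)
  have 2: "cmod (iexp x - 1 - \<i> * x) \<le> 2 * \<bar>x\<bar>"
    using iexp_approx2[of x 1] by (simp add: diff_diff_eq)
  show ?thesis
  proof (cases "\<bar>x\<bar> \<le> 1")
    case True
    have "\<bar>x\<bar> powr 2 \<le> \<bar>x\<bar> powr s"
      using True False assms by (intro powr_mono') auto
    moreover have "\<bar>x\<bar> powr 2 = \<bar>x\<bar>^2"
      using False powr_numeral[of "\<bar>x\<bar>" "num.Bit0 num.One"] by simp
    moreover have "0 \<le> \<bar>x\<bar> powr s" by simp
    ultimately show ?thesis using 1 by linarith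
  next
    case F: False
    have "\<bar>x\<bar> powr 1 \<le> \<bar>x\<bar> powr s"
      using F assms by (intro powr_mono) auto
    with 2 False show ?thesis by simp
  qed
qed auto

lemma norm_iexp_minus_one_le_abs: "cmod (iexp x - 1) \<le> \<bar>x\<bar>"
  using iexp_approx1[of x 0] by simp

lemma norm_iexp_minus_one_le_2: "cmod (iexp x - 1) \<le> 2"
  using norm_triangle_ineq4[of "iexp x" 1] by simp

text \<open>The linear term appears with its exact coefficient, because it is the term that
  degeneracy removes. For |x| \<le> 1 the power (1 + x)^(a - 1) is bounded by its tangent, which
  leaves the error (a - 1) x^2. For |x| > 1 the constant is 6 = 4 + 2: 4 from (2|x|)^a and 2 to make
  up for a negative linear term.\<close>

lemma one_plus_powr_le:
  fixes x a :: real
  assumes a: "1 \<le> a" "a \<le> 2"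
  shows "\<bar>1 + x\<bar> powr a \<le> 1 + a * x + 6 * \<bar>x\<bar> powr a"
proof (cases "\<bar>x\<bar> \<le> 1")
  case True
  show ?thesis
  proof (cases "x = -1")
    case False
    with True have pos: "1 + x > 0" by auto
    have "(1 + x) powr a = (1 + x) powr 1 * (1 + x) powr (a - 1)"
      by (subst powr_add[symmetric]) simp
    also have "\<dots> = (1 + x) * ((1 + x) powr (a - 1) * 1 powr (2 - a))"
      using pos by simp
    also have "\<dots> \<le> (1 + x) * ((a - 1) * (1 + x) + (2 - a) * 1)"
      using pos a by (intro mult_left_mono Youngs_inequality_0) auto
    also have "\<dots> = 1 + a * x + (a - 1) * x^2"
      by (simp add: algebra_simps power2_eq_square)
    also have "(a - 1) * x^2 \<le> 6 * \<bar>x\<bar> powr a"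
    proof (cases "x = 0")
      case False
      have "(a - 1) * x^2 \<le> 1 * \<bar>x\<bar>^2" using a by (intro mult_mono) auto
      also have "\<bar>x\<bar>^2 = \<bar>x\<bar> powr 2"
        using False powr_numeral[of "\<bar>x\<bar>" "num.Bit0 num.One"] by simp
      also have "1 * \<dots> \<le> \<bar>x\<bar> powr a"
        using powr_mono'[of a 2 "\<bar>x\<bar>"] True a False by simp
      also have "\<dots> \<le> 6 * \<bar>x\<bar> powr a" by simp
      finally show ?thesis .
    qed (use a in auto)
    finally show ?thesis using pos by simp
  qed (use a in auto)
next
  case False
  have x1: "\<bar>x\<bar> \<le> \<bar>x\<bar> powr a"
    using powr_mono[of 1 a "\<bar>x\<bar>"] False a by auto
  have "\<bar>1 + x\<bar> powr a \<le> (2 * \<bar>x\<bar>) powr a"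
    using False a by (intro powr_mono2) auto
  also have "\<dots> = 2 powr a * \<bar>x\<bar> powr a"
    by (simp add: powr_mult)
  also have "\<dots> \<le> 2 powr 2 * \<bar>x\<bar> powr a"
    using a by (intro mult_right_mono powr_mono) auto
  finally have "\<bar>1 + x\<bar> powr a \<le> 4 * \<bar>x\<bar> powr a" by simp
  moreover have "a * x \<ge> - (2 * \<bar>x\<bar>)"
  proof -
    have "\<bar>a * x\<bar> \<le> 2 * \<bar>x\<bar>" using a by (simp add: abs_mult mult_right_mono)
    thus ?thesis by linarith
  qed
  ultimately show ?thesis using x1 by linarith
qed

text \<open>Homogeneity reduces this to x = 1. Integrated against a centred y it is the one-step
  estimate behind the von Bahr--Esseen bound.\<close>

lemma add_powr_le:
  fixes x y a :: real
  assumes a: "1 \<le> a" "a \<le> 2"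
  shows "\<bar>x + y\<bar> powr a \<le> \<bar>x\<bar> powr a + a * sgn x * \<bar>x\<bar> powr (a - 1) * y + 6 * \<bar>y\<bar> powr a"
proof (cases "x = 0")
  case False
  have "\<bar>x + y\<bar> powr a = (\<bar>x\<bar> * \<bar>1 + y / x\<bar>) powr a"
  proof -
    have "x + y = x * (1 + y / x)" using False by (simp add: field_simps)
    thus ?thesis by (metis abs_mult)
  qed
  also have "\<dots> = \<bar>x\<bar> powr a * \<bar>1 + y / x\<bar> powr a"
    by (simp add: powr_mult)
  also have "\<dots> \<le> \<bar>x\<bar> powr a * (1 + a * (y / x) + 6 * \<bar>y / x\<bar> powr a)"
    by (intro mult_left_mono one_plus_powr_le a) auto
  also have "\<dots> = \<bar>x\<bar> powr a + a * (\<bar>x\<bar> powr a / x) * y + 6 * (\<bar>x\<bar> powr a * \<bar>y / x\<bar> powr a)"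
    by (simp add: algebra_simps)
  also have "\<bar>x\<bar> powr a * \<bar>y / x\<bar> powr a = \<bar>y\<bar> powr a"
    using False by (subst powr_mult[symmetric]) (simp_all add: abs_divide)
  also have "\<bar>x\<bar> powr a / x = sgn x * \<bar>x\<bar> powr (a - 1)"
    using False by (simp add: powr_diff sgn_if field_simps)
  finally show ?thesis by (simp add: mult.assoc)
qed (use a in auto)

lemma Youngs_inequality_sum:
  fixes x y p q :: real
  assumes "p > 1" "q > 1" "1/p + 1/q = 1" "x \<ge> 0" "y \<ge> 0"
  shows "x * y \<le> x powr p + y powr q"
proof -
  have "x * y \<le> x powr p / p + y powr q / q" using Youngs_inequality assms by blast
  also have "\<dots> \<le> x powr p / 1 + y powr q / 1"
    using assms by (intro add_mono divide_left_mono) auto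
  finally show ?thesis by simp
qed

text \<open>Replacing the smaller of x and y by the larger one takes the place of Young's
  inequality, so that a = 1, which has no finite conjugate exponent, is included.\<close>

lemma mult_powr_le:
  fixes x y a :: real
  assumes "1 \<le> a" "x \<ge> 0" "y \<ge> 0"
  shows "x * y powr (a - 1) \<le> x powr a + y powr a"
proof (cases "x \<le> y")
  case True
  have "x * y powr (a - 1) \<le> y * y powr (a - 1)"
    using True by (intro mult_right_mono) auto
  also have "\<dots> = y powr a"
    using assms by (cases "y = 0") (auto simp: powr_mult_base)
  finally show ?thesis by (simp add: add_increasing)
next
  case False
  have "x * y powr (a - 1) \<le> x * x powr (a - 1)"
    using False assms by (intro mult_left_mono powr_mono2) auto
  also have "\<dots> = x powr a"
    using assms by (cases "x = 0") (auto simp: powr_mult_base)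
  finally show ?thesis by (simp add: add_increasing2)
qed

section \<open>Degenerate sums on product spaces\<close>

locale iid_product = prob_space M for M :: "'a measure"
begin

sublocale pp: product_sigma_finite "\<lambda>_::nat. M"
  by unfold_locales

abbreviation iid :: "nat set \<Rightarrow> (nat \<Rightarrow> 'a) measure" where
  "iid I \<equiv> Pi\<^sub>M I (\<lambda>_. M)"

lemma prob_space_iid: "prob_space (iid I)"
  by (intro prob_space_PiM) unfold_locales

text \<open>Conditional mean zero in Fubini form: coordinate i is overwritten by the integration
  variable. The Bochner integral of a non-integrable function is 0 by convention, so integrability
  is made part of the demand.\<close>

definition degenerate_at :: "nat set \<Rightarrow> nat \<Rightarrow> ((nat \<Rightarrow> 'a) \<Rightarrow> real) \<Rightarrow> bool" where
  "degenerate_at I i f \<longleftrightarrow> (AE w in iid I. has_bochner_integral M (\<lambda>x. f (w(i := x))) 0)"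

lemma measurable_upd:
  assumes "f \<in> borel_measurable (iid (insert i J))" "x \<in> space M"
  shows "(\<lambda>w. f (w(i := x))) \<in> borel_measurable (iid J)"
proof -
  have "(\<lambda>w. w(i := x)) \<in> measurable (iid J) (iid (insert i J))"
    using assms(2) by (intro measurable_fun_upd[where J = J]) auto
  from measurable_compose[OF this assms(1)] show ?thesis .
qed

lemma measurable_upd_coord:
  assumes "f \<in> borel_measurable (iid (insert i J))" "w \<in> space (iid J)"
  shows "(\<lambda>x. f (w(i := x))) \<in> borel_measurable M"
proof -
  have "(\<lambda>x. w(i := x)) \<in> measurable M (iid (insert i J))"
    using assms(2) by (intro measurable_fun_upd[where J = J]) auto
  from measurable_compose[OF this assms(1)] show ?thesis .
qed

text \<open>The exceptional set is enclosed in a measurable null set, and the integral of its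
  indicator vanishes in either order of integration.\<close>

lemma AE_iid_insert:
  assumes J: "finite J" "i \<notin> J" and P: "AE w in iid (insert i J). P w"
  shows "AE x in M. AE w in iid J. P (w(i := x))"
    and "AE w in iid J. AE x in M. P (w(i := x))"
proof -
  from P obtain N where N: "{w \<in> space (iid (insert i J)). \<not> P w} \<subseteq> N"
    "emeasure (iid (insert i J)) N = 0" "N \<in> sets (iid (insert i J))"
    by (rule AE_E)
  have [measurable]: "(indicator N :: _ \<Rightarrow> ennreal) \<in> borel_measurable (iid (insert i J))"
    using N(3) by (rule borel_measurable_indicator)
  have mp: "(\<lambda>(w, x). indicator N (w(i := x)) :: ennreal) \<in> borel_measurable (iid J \<Otimes>\<^sub>M M)"
    using measurable_compose[OF measurable_add_dim[of i J "\<lambda>_. M"], of "indicator N" borel]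
    by (simp add: split_beta')
  have mp': "(\<lambda>(x, w). indicator N (w(i := x)) :: ennreal) \<in> borel_measurable (M \<Otimes>\<^sub>M iid J)"
    using measurable_compose[OF measurable_pair_swap' mp] by (simp add: split_beta')
  interpret PJ: prob_space "iid J" by (rule prob_space_iid)
  have Nint: "(\<integral>\<^sup>+w. indicator N w \<partial>iid (insert i J)) = 0"
    using N by simp
  have upd: "w(i := x) \<in> space (iid (insert i J))" if "w \<in> space (iid J)" "x \<in> space M" for w x
    using that by (auto simp: space_PiM PiE_def extensional_def)
  have imp: "P (w(i := x))" if "w \<in> space (iid J)" "x \<in> space M" "(indicator N (w(i := x)) :: ennreal) = 0" for w x
    using N(1) upd[OF that(1,2)] that(3) by (auto simp: indicator_eq_0_iff)
  have "(\<integral>\<^sup>+x. \<integral>\<^sup>+w. indicator N (w(i := x)) \<partial>iid J \<partial>M) = 0"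
    using Nint pp.product_nn_integral_insert_rev[OF J, of "indicator N"] by simp
  hence "AE x in M. (\<integral>\<^sup>+w. indicator N (w(i := x)) \<partial>iid J) = 0"
    using PJ.borel_measurable_nn_integral[OF mp'] by (subst (asm) nn_integral_0_iff_AE) auto
  thus "AE x in M. AE w in iid J. P (w(i := x))"
    using AE_space
  proof eventually_elim
    case (elim x)
    hence "AE w in iid J. (indicator N (w(i := x)) :: ennreal) = 0"
      by (subst (asm) nn_integral_0_iff_AE) (auto intro!: measurable_upd)
    thus ?case using AE_space by eventually_elim (use elim imp in auto)
  qed
  have "(\<integral>\<^sup>+w. \<integral>\<^sup>+x. indicator N (w(i := x)) \<partial>M \<partial>iid J) = 0"
    using Nint pp.product_nn_integral_insert[OF J, of "indicator N"] by simp
  hence "AE w in iid J. (\<integral>\<^sup>+x. indicator N (w(i := x)) \<partial>M) = 0"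
    using borel_measurable_nn_integral[OF mp] by (subst (asm) nn_integral_0_iff_AE) auto
  thus "AE w in iid J. AE x in M. P (w(i := x))"
    using AE_space
  proof eventually_elim
    case (elim w)
    hence "AE x in M. (indicator N (w(i := x)) :: ennreal) = 0"
      by (subst (asm) nn_integral_0_iff_AE) (auto intro!: measurable_upd_coord)
    thus ?case using AE_space by eventually_elim (use elim imp in auto)
  qed
qed

text \<open>Freezing one coordinate preserves degeneracy in another one, but only for almost every
  frozen value; hence the almost-everywhere statements in the induction below.\<close>

lemma degenerate_at_fun_upd:
  assumes J: "finite J" "i \<notin> J" "r \<noteq> i" and d: "degenerate_at (insert i J) r f"
  shows "AE x in M. degenerate_at J r (\<lambda>w. f (w(i := x)))"
  using AE_iid_insert(1)[OF J(1,2) d[unfolded degenerate_at_def]]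
  unfolding degenerate_at_def
  by eventually_elim (use J in \<open>simp add: fun_upd_twist\<close>)

lemma degenerate_at_inner:
  assumes J: "finite J" "i \<notin> J" and d: "degenerate_at (insert i J) i f"
  shows "AE w in iid J. has_bochner_integral M (\<lambda>x. f (w(i := x))) 0"
  using AE_iid_insert(2)[OF J d[unfolded degenerate_at_def]] by simp

text \<open>The linear term of \<open>add_powr_le\<close> integrates to 0. With nonnegative
  integrals an infinite right-hand side is a trivial case instead of an extra hypothesis.\<close>

lemma nn_integral_add_powr_le:
  fixes c a :: real and u :: "'a \<Rightarrow> real"
  assumes a: "1 \<le> a" "a \<le> 2" and u: "has_bochner_integral M u 0"
  shows "(\<integral>\<^sup>+x. ennreal (\<bar>c + u x\<bar> powr a) \<partial>M)
    \<le> ennreal (\<bar>c\<bar> powr a) + 6 * (\<integral>\<^sup>+x. ennreal (\<bar>u x\<bar> powr a) \<partial>M)"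
proof (cases "(\<integral>\<^sup>+x. ennreal (\<bar>u x\<bar> powr a) \<partial>M) = \<infinity>")
  case True
  thus ?thesis by (simp add: ennreal_mult_eq_top_iff)
next
  case False
  have [measurable]: "u \<in> borel_measurable M" using u by (auto simp: has_bochner_integral_iff)
  have i: "integrable M u" "integral\<^sup>L M u = 0" using u by (auto simp: has_bochner_integral_iff)
  have ia: "integrable M (\<lambda>x. \<bar>u x\<bar> powr a)"
    using False by (intro integrableI_nonneg) (auto simp: top.not_eq_extremum)
  let ?g = "\<lambda>x. \<bar>c\<bar> powr a + a * sgn c * \<bar>c\<bar> powr (a - 1) * u x + 6 * \<bar>u x\<bar> powr a"
  have g0: "0 \<le> ?g x" for x
    using add_powr_le[OF a, of c "u x"] by (smt (verit) powr_ge_zero)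
  have ig: "integrable M ?g" using i(1) ia by auto
  have "(\<integral>\<^sup>+x. ennreal (\<bar>c + u x\<bar> powr a) \<partial>M) \<le> (\<integral>\<^sup>+x. ennreal (?g x) \<partial>M)"
    by (intro nn_integral_mono ennreal_leI add_powr_le a)
  also have "\<dots> = ennreal (\<integral>x. ?g x \<partial>M)"
    using ig g0 by (intro nn_integral_eq_integral) auto
  also have "(\<integral>x. ?g x \<partial>M) = \<bar>c\<bar> powr a + 6 * (\<integral>x. \<bar>u x\<bar> powr a \<partial>M)"
    using i ia by (simp add: prob_space)
  also have "ennreal \<dots> = ennreal (\<bar>c\<bar> powr a) + 6 * ennreal (\<integral>x. \<bar>u x\<bar> powr a \<partial>M)"
    by (simp add: ennreal_mult)
  also have "ennreal (\<integral>x. \<bar>u x\<bar> powr a \<partial>M) = (\<integral>\<^sup>+x. ennreal (\<bar>u x\<bar> powr a) \<partial>M)"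
    using ia by (intro nn_integral_eq_integral[symmetric]) auto
  finally show ?thesis .
qed

text \<open>Induction on the index set: the terms containing the new index have mean zero given the other
  coordinates, which costs a factor \<open>6\<close>; for a fixed value of the new coordinate they form again a
  degenerate sum.\<close>

theorem nn_integral_degenerate_sum_powr_le:
  fixes h :: "nat set \<Rightarrow> (nat \<Rightarrow> 'a) \<Rightarrow> real" and a :: real
  assumes a: "1 \<le> a" "a \<le> 2" and fin: "finite I"
    and meas: "\<And>A. A \<subseteq> I \<Longrightarrow> h A \<in> borel_measurable (iid I)"
    and loc: "\<And>A i w x. A \<subseteq> I \<Longrightarrow> i \<in> I - A \<Longrightarrow> h A (w(i := x)) = h A w"
    and deg: "\<And>A i. A \<subseteq> I \<Longrightarrow> i \<in> A \<Longrightarrow> degenerate_at I i (h A)"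
  shows "(\<integral>\<^sup>+w. ennreal (\<bar>\<Sum>A\<in>Pow I. h A w\<bar> powr a) \<partial>iid I)
    \<le> (\<Sum>A\<in>Pow I. 6 ^ card A * (\<integral>\<^sup>+w. ennreal (\<bar>h A w\<bar> powr a) \<partial>iid I))"
  using fin meas loc deg
proof (induction I arbitrary: h rule: finite_induct)
  case (insert i J)
  note J = insert.hyps
  let ?K = "insert i J"
  have hm[measurable]: "h A \<in> borel_measurable (iid ?K)" if "A \<subseteq> ?K" for A
    by (rule insert.prems(1)[OF that])
  have m1: "(\<lambda>w. \<Sum>A\<in>Pow J. h (insert i A) w) \<in> borel_measurable (iid ?K)"
    by (intro borel_measurable_sum hm) auto
  have m0: "(\<lambda>w. \<Sum>A\<in>Pow J. h A w) \<in> borel_measurable (iid ?K)"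
    by (intro borel_measurable_sum hm) auto
  have fP: "finite (Pow J)" using J by auto
  have split: "(\<Sum>A\<in>Pow ?K. F A) = (\<Sum>A\<in>Pow J. F A) + (\<Sum>A\<in>Pow J. F (insert i A))"
    for F :: "nat set \<Rightarrow> 'c :: comm_monoid_add"
  proof -
    have inj: "inj_on (insert i) (Pow J)" using J(2) by (auto simp: inj_on_def)
    have "Pow J \<inter> insert i ` Pow J = {}" using J(2) by auto
    thus ?thesis
      unfolding Pow_insert using J fP
      by (subst sum.union_disjoint) (simp_all add: sum.reindex[OF inj])
  qed
  \<comment> \<open>\<open>f0\<close> collects the sets without the new index i and does not depend
    on x; \<open>f1\<close> collects those containing i and is centred in x for almost every
    w.\<close>
  define f0 where "f0 = (\<lambda>w x. \<Sum>A\<in>Pow J. h A (w(i := x)))"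
  define f1 where "f1 = (\<lambda>w x. \<Sum>A\<in>Pow J. h (insert i A) (w(i := x)))"
  have good: "AE x in M. (\<forall>A\<in>Pow J. \<forall>r\<in>A. degenerate_at J r (\<lambda>w. h A (w(i := x))) \<and>
      degenerate_at J r (\<lambda>w. h (insert i A) (w(i := x))))"
  proof (rule AE_finite_allI[OF fP])
    fix A assume A: "A \<in> Pow J"
    have *: "AE x in M. degenerate_at J r (\<lambda>w. h A (w(i := x))) \<and>
      degenerate_at J r (\<lambda>w. h (insert i A) (w(i := x)))" if r: "r \<in> A" for r
    proof -
      have "r \<noteq> i" using A r J by auto
      thus ?thesis using A r
        by (intro AE_conjI degenerate_at_fun_upd J insert.prems(3)) auto
    qed
    have "finite A" using A J(1) by (auto intro: finite_subset)
    from AE_finite_allI[OF this *] show "AE x in M. \<forall>r\<in>A. degenerate_at J r (\<lambda>w. h A (w(i := x))) \<and>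
      degenerate_at J r (\<lambda>w. h (insert i A) (w(i := x)))" .
  qed
  have IH: "AE x in M. (\<integral>\<^sup>+w. ennreal (\<bar>f0 w x\<bar> powr a) \<partial>iid J)
      \<le> (\<Sum>A\<in>Pow J. 6 ^ card A * (\<integral>\<^sup>+w. ennreal (\<bar>h A (w(i := x))\<bar> powr a) \<partial>iid J)) \<and>
     (\<integral>\<^sup>+w. ennreal (\<bar>f1 w x\<bar> powr a) \<partial>iid J)
      \<le> (\<Sum>A\<in>Pow J. 6 ^ card A * (\<integral>\<^sup>+w. ennreal (\<bar>h (insert i A) (w(i := x))\<bar> powr a) \<partial>iid J))"
    using good AE_space
  proof eventually_elim
    case (elim x)
    show ?case unfolding f0_def f1_def
    proof (intro conjI insert.IH[of "\<lambda>A w. h A (w(i := x))"] insert.IH[of "\<lambda>A w. h (insert i A) (w(i := x))"])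
      fix A r and w :: "nat \<Rightarrow> 'a" and y assume A: "A \<subseteq> J" "r \<in> J - A"
      hence "r \<noteq> i" using J by auto
      hence *: "w(r := y, i := x) = (w(i := x))(r := y)" by (simp add: fun_upd_twist)
      show "h A (w(r := y, i := x)) = h A (w(i := x))"
        unfolding * by (rule insert.prems(2)) (use A in auto)
      show "h (insert i A) (w(r := y, i := x)) = h (insert i A) (w(i := x))"
        unfolding * by (rule insert.prems(2)) (use A J in auto)
    qed (use elim in \<open>auto intro!: measurable_upd hm\<close>)
  qed
  have inner: "AE w in iid J. has_bochner_integral M (f1 w) 0"
  proof -
    have "AE w in iid J. \<forall>A\<in>Pow J. has_bochner_integral M (\<lambda>x. h (insert i A) (w(i := x))) 0"
      using fP by (intro AE_finite_allI degenerate_at_inner J insert.prems(3)) auto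
    thus ?thesis
    proof eventually_elim
      case (elim w)
      hence "has_bochner_integral M (f1 w) (\<Sum>A\<in>Pow J. 0)"
        unfolding f1_def by (intro has_bochner_integral_sum) auto
      thus ?case by simp
    qed
  qed
  \<comment> \<open>The induction hypothesis holds for almost every x only. As \<open>f0\<close> is
    constant in x, one good value \<open>x0\<close> can stand for all of them.\<close>
  obtain x0 where x0: "x0 \<in> space M"
    "(\<integral>\<^sup>+w. ennreal (\<bar>f0 w x0\<bar> powr a) \<partial>iid J)
      \<le> (\<Sum>A\<in>Pow J. 6 ^ card A * (\<integral>\<^sup>+w. ennreal (\<bar>h A (w(i := x0))\<bar> powr a) \<partial>iid J))"
  proof -
    have "\<exists>x. x \<in> space M \<and> (\<integral>\<^sup>+w. ennreal (\<bar>f0 w x\<bar> powr a) \<partial>iid J)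
      \<le> (\<Sum>A\<in>Pow J. 6 ^ card A * (\<integral>\<^sup>+w. ennreal (\<bar>h A (w(i := x))\<bar> powr a) \<partial>iid J))"
    proof (rule ccontr)
      assume "\<not> ?thesis"
      hence no: "\<And>x. x \<in> space M \<Longrightarrow> \<not> (\<integral>\<^sup>+w. ennreal (\<bar>f0 w x\<bar> powr a) \<partial>iid J)
        \<le> (\<Sum>A\<in>Pow J. 6 ^ card A * (\<integral>\<^sup>+w. ennreal (\<bar>h A (w(i := x))\<bar> powr a) \<partial>iid J))" by blast
      from IH AE_space have "AE x in M. False"
        by eventually_elim (use no in blast)
      thus False by (simp add: AE_False)
    qed
    thus ?thesis using that by blast
  qed
  have hx0: "h A (w(i := x)) = h A (w(i := x0))" if "A \<in> Pow J" for A w x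
  proof -
    have "A \<subseteq> insert i J" "i \<in> insert i J - A" using that J(2) by auto
    note * = insert.prems(2)[OF this]
    show ?thesis by (simp only: *)
  qed
  have f0c: "f0 w x = f0 w x0" for w x unfolding f0_def by (intro sum.cong refl hx0)
  have hA: "(\<integral>\<^sup>+w. ennreal (\<bar>h A (w(i := x0))\<bar> powr a) \<partial>iid J) = (\<integral>\<^sup>+w. ennreal (\<bar>h A w\<bar> powr a) \<partial>iid ?K)"
    if "A \<in> Pow J" for A
  proof -
    have "h A \<in> borel_measurable (iid ?K)" using that by (intro hm) auto
    hence "(\<integral>\<^sup>+w. ennreal (\<bar>h A w\<bar> powr a) \<partial>iid ?K) = (\<integral>\<^sup>+w. \<integral>\<^sup>+x. ennreal (\<bar>h A (w(i := x))\<bar> powr a) \<partial>M \<partial>iid J)"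
      by (subst pp.product_nn_integral_insert[OF J]) auto
    also have "\<dots> = (\<integral>\<^sup>+w. \<integral>\<^sup>+x. ennreal (\<bar>h A (w(i := x0))\<bar> powr a) \<partial>M \<partial>iid J)"
      by (intro nn_integral_cong) (subst hx0[OF that], rule refl)
    finally show ?thesis by (simp add: emeasure_space_1)
  qed
  have "(\<integral>\<^sup>+w. ennreal (\<bar>\<Sum>A\<in>Pow ?K. h A w\<bar> powr a) \<partial>iid ?K)
      = (\<integral>\<^sup>+w. \<integral>\<^sup>+x. ennreal (\<bar>f0 w x + f1 w x\<bar> powr a) \<partial>M \<partial>iid J)"
    unfolding split f0_def f1_def using m0 m1
    by (subst pp.product_nn_integral_insert[OF J]) auto
  also have "\<dots> = (\<integral>\<^sup>+w. \<integral>\<^sup>+x. ennreal (\<bar>f0 w x0 + f1 w x\<bar> powr a) \<partial>M \<partial>iid J)"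
    by (intro nn_integral_cong) (subst f0c, rule refl)
  also have "\<dots> \<le> (\<integral>\<^sup>+w. ennreal (\<bar>f0 w x0\<bar> powr a) + 6 * (\<integral>\<^sup>+x. ennreal (\<bar>f1 w x\<bar> powr a) \<partial>M) \<partial>iid J)"
    by (intro nn_integral_mono_AE eventually_mono[OF inner] nn_integral_add_powr_le a)
  also have "\<dots> = (\<integral>\<^sup>+w. ennreal (\<bar>f0 w x0\<bar> powr a) \<partial>iid J) + 6 * (\<integral>\<^sup>+w. \<integral>\<^sup>+x. ennreal (\<bar>f1 w x\<bar> powr a) \<partial>M \<partial>iid J)"
  proof -
    have [measurable]: "(\<lambda>w. f0 w x0) \<in> borel_measurable (iid J)"
      unfolding f0_def using x0(1) m0 by (rule measurable_upd[rotated])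
    have mp: "(\<lambda>(w, x). ennreal (\<bar>f1 w x\<bar> powr a)) \<in> borel_measurable (iid J \<Otimes>\<^sub>M M)"
    proof -
      have "(\<lambda>p. f1 (fst p) (snd p)) \<in> borel_measurable (iid J \<Otimes>\<^sub>M M)"
        using measurable_compose[OF measurable_add_dim[of i J "\<lambda>_. M"] m1]
        by (simp add: split_beta' f1_def)
      thus ?thesis by (simp add: split_beta')
    qed
    have [measurable]: "(\<lambda>w. \<integral>\<^sup>+x. ennreal (\<bar>f1 w x\<bar> powr a) \<partial>M) \<in> borel_measurable (iid J)"
      using borel_measurable_nn_integral[OF mp] by simp
    show ?thesis by (simp add: nn_integral_add nn_integral_cmult)
  qed
  finally have LE: "(\<integral>\<^sup>+w. ennreal (\<bar>\<Sum>A\<in>Pow ?K. h A w\<bar> powr a) \<partial>iid ?K)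
    \<le> (\<integral>\<^sup>+w. ennreal (\<bar>f0 w x0\<bar> powr a) \<partial>iid J) + 6 * (\<integral>\<^sup>+w. \<integral>\<^sup>+x. ennreal (\<bar>f1 w x\<bar> powr a) \<partial>M \<partial>iid J)" .
  have "(\<integral>\<^sup>+w. \<integral>\<^sup>+x. ennreal (\<bar>f1 w x\<bar> powr a) \<partial>M \<partial>iid J) = (\<integral>\<^sup>+x. \<integral>\<^sup>+w. ennreal (\<bar>f1 w x\<bar> powr a) \<partial>iid J \<partial>M)"
    using m1 pp.product_nn_integral_insert_rev[OF J, of "\<lambda>w. ennreal (\<bar>\<Sum>A\<in>Pow J. h (insert i A) w\<bar> powr a)"]
      pp.product_nn_integral_insert[OF J, of "\<lambda>w. ennreal (\<bar>\<Sum>A\<in>Pow J. h (insert i A) w\<bar> powr a)"]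
    unfolding f1_def by simp
  also have "\<dots> \<le> (\<integral>\<^sup>+x. (\<Sum>A\<in>Pow J. 6 ^ card A * (\<integral>\<^sup>+w. ennreal (\<bar>h (insert i A) (w(i := x))\<bar> powr a) \<partial>iid J)) \<partial>M)"
    by (intro nn_integral_mono_AE eventually_mono[OF IH]) simp
  also have "\<dots> = (\<Sum>A\<in>Pow J. 6 ^ card A * (\<integral>\<^sup>+w. ennreal (\<bar>h (insert i A) w\<bar> powr a) \<partial>iid ?K))"
  proof -
    interpret PJ: prob_space "iid J" by (rule prob_space_iid)
    have meas: "(\<lambda>x. \<integral>\<^sup>+w. ennreal (\<bar>h (insert i A) (w(i := x))\<bar> powr a) \<partial>iid J) \<in> borel_measurable M"
      if "A \<in> Pow J" for A
    proof -
      have "h (insert i A) \<in> borel_measurable (iid ?K)" using that by (intro hm) auto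
      from measurable_compose[OF measurable_add_dim[of i J "\<lambda>_. M"] this]
      have "(\<lambda>(w, x). ennreal (\<bar>h (insert i A) (w(i := x))\<bar> powr a)) \<in> borel_measurable (iid J \<Otimes>\<^sub>M M)"
        by (simp add: split_beta')
      from measurable_compose[OF measurable_pair_swap' this]
      have "(\<lambda>(x, w). ennreal (\<bar>h (insert i A) (w(i := x))\<bar> powr a)) \<in> borel_measurable (M \<Otimes>\<^sub>M iid J)"
        by (simp add: split_beta')
      from PJ.borel_measurable_nn_integral[OF this] show ?thesis by simp
    qed
    have "(\<integral>\<^sup>+w. ennreal (\<bar>h (insert i A) w\<bar> powr a) \<partial>iid ?K) =
       (\<integral>\<^sup>+x. \<integral>\<^sup>+w. ennreal (\<bar>h (insert i A) (w(i := x))\<bar> powr a) \<partial>iid J \<partial>M)" if "A \<in> Pow J" for A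
    proof -
      have "h (insert i A) \<in> borel_measurable (iid ?K)" using that by (intro hm) auto
      thus ?thesis by (subst pp.product_nn_integral_insert_rev[OF J]) auto
    qed
    moreover have "(\<integral>\<^sup>+x. (\<Sum>A\<in>Pow J. 6 ^ card A * (\<integral>\<^sup>+w. ennreal (\<bar>h (insert i A) (w(i := x))\<bar> powr a) \<partial>iid J)) \<partial>M)
      = (\<Sum>A\<in>Pow J. 6 ^ card A * (\<integral>\<^sup>+x. (\<integral>\<^sup>+w. ennreal (\<bar>h (insert i A) (w(i := x))\<bar> powr a) \<partial>iid J) \<partial>M))"
      by (subst nn_integral_sum)
        (auto intro!: borel_measurable_times_ennreal meas sum.cong nn_integral_cmult)
    ultimately show ?thesis by simp
  qed
  finally have LE1: "(\<integral>\<^sup>+w. \<integral>\<^sup>+x. ennreal (\<bar>f1 w x\<bar> powr a) \<partial>M \<partial>iid J) \<le> (\<Sum>A\<in>Pow J. 6 ^ card A * (\<integral>\<^sup>+w. ennreal (\<bar>h (insert i A) w\<bar> powr a) \<partial>iid ?K))" .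
  note x0(2)
  also have "(\<Sum>A\<in>Pow J. 6 ^ card A * (\<integral>\<^sup>+w. ennreal (\<bar>h A (w(i := x0))\<bar> powr a) \<partial>iid J)) =
    (\<Sum>A\<in>Pow J. 6 ^ card A * (\<integral>\<^sup>+w. ennreal (\<bar>h A w\<bar> powr a) \<partial>iid ?K))"
    using hA by simp
  finally have LE0: "(\<integral>\<^sup>+w. ennreal (\<bar>f0 w x0\<bar> powr a) \<partial>iid J) \<le> (\<Sum>A\<in>Pow J. 6 ^ card A * (\<integral>\<^sup>+w. ennreal (\<bar>h A w\<bar> powr a) \<partial>iid ?K))" .
  \<comment> \<open>The factor 6 paid for integrating out i is exactly the increase of 6 ^ card A
    when i is inserted.\<close>
  have E: "6 * (\<Sum>A\<in>Pow J. 6 ^ card A * (\<integral>\<^sup>+w. ennreal (\<bar>h (insert i A) w\<bar> powr a) \<partial>iid ?K)) =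
     (\<Sum>A\<in>Pow J. 6 ^ card (insert i A) * (\<integral>\<^sup>+w. ennreal (\<bar>h (insert i A) w\<bar> powr a) \<partial>iid ?K))"
  proof -
    have "card (insert i A) = Suc (card A)" if "A \<in> Pow J" for A
      using that J by (subst card_insert_disjoint) (auto intro: finite_subset)
    thus ?thesis by (simp add: sum_distrib_left mult.assoc)
  qed
  show ?case unfolding split E[symmetric]
    by (rule order_trans[OF LE[unfolded split] add_mono[OF LE0 mult_left_mono[OF LE1]]]) simp
qed simp

end

section \<open>Fubini identities for single coordinates\<close>

context iid_product
begin

text \<open>One variable is integrated out, yet the remaining integral is again taken over all of I;
  this is correct because Z ignores coordinate i and the measures are probabilities. The step can
  therefore be iterated on a fixed space.\<close>

lemma nn_integral_peel:
  fixes u :: "'a \<Rightarrow> ennreal" and Z :: "(nat \<Rightarrow> 'a) \<Rightarrow> ennreal"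
  assumes I: "finite I" "i \<in> I" and u[measurable]: "u \<in> borel_measurable M"
    and Z[measurable]: "Z \<in> borel_measurable (iid I)"
    and ind: "\<And>w x. Z (w(i := x)) = Z w"
  shows "(\<integral>\<^sup>+w. u (w i) * Z w \<partial>iid I) = (\<integral>\<^sup>+x. u x \<partial>M) * (\<integral>\<^sup>+w. Z w \<partial>iid I)"
proof -
  define J where "J = I - {i}"
  have J: "finite J" "i \<notin> J" "I = insert i J" using I by (auto simp: J_def)
  note Z' = Z[unfolded J(3)]
  obtain x0 where x0: "x0 \<in> space M" using not_empty by blast
  have mZ: "Z \<in> borel_measurable (iid J)"
    using measurable_upd[OF Z' x0] by (simp add: ind)
  have "(\<integral>\<^sup>+w. u (w i) * Z w \<partial>iid I) = (\<integral>\<^sup>+w. \<integral>\<^sup>+x. u x * Z w \<partial>M \<partial>iid J)"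
  proof -
    have "(\<lambda>w. u (w i) * Z w) \<in> borel_measurable (iid (insert i J))"
      using Z' by measurable
    thus ?thesis unfolding J(3) by (subst pp.product_nn_integral_insert[OF J(1,2)]) (auto simp: ind)
  qed
  also have "\<dots> = (\<integral>\<^sup>+x. u x \<partial>M) * (\<integral>\<^sup>+w. Z w \<partial>iid J)"
    using mZ by (simp add: nn_integral_multc nn_integral_cmult)
  also have "(\<integral>\<^sup>+w. Z w \<partial>iid J) = (\<integral>\<^sup>+w. Z w \<partial>iid I)"
    unfolding J(3) using Z' by (subst pp.product_nn_integral_insert[OF J(1,2)]) (auto simp: ind emeasure_space_1)
  finally show ?thesis .
qed

lemma integral_peel:
  fixes u :: "'a \<Rightarrow> 'b::{real_normed_field, banach, second_countable_topology}"
  assumes I: "finite I" "i \<in> I" and u: "integrable M u"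
    and Z: "integrable (iid I) Z"
    and ind: "\<And>w x. Z (w(i := x)) = Z w"
  shows "integrable (iid I) (\<lambda>w. u (w i) * Z w)"
    and "(\<integral>w. u (w i) * Z w \<partial>iid I) = (\<integral>x. u x \<partial>M) * (\<integral>w. Z w \<partial>iid I)"
proof -
  define J where "J = I - {i}"
  have J: "finite J" "i \<notin> J" "I = insert i J" using I by (auto simp: J_def)
  have [measurable]: "u \<in> borel_measurable M" "Z \<in> borel_measurable (iid I)" "i \<in> I" using u Z I by auto
  show int: "integrable (iid I) (\<lambda>w. u (w i) * Z w)"
    unfolding integrable_iff_bounded
  proof
    have "(\<integral>\<^sup>+w. ennreal (norm (u (w i) * Z w)) \<partial>iid I) = (\<integral>\<^sup>+w. ennreal (norm (u (w i))) * ennreal (norm (Z w)) \<partial>iid I)"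
      by (simp add: norm_mult ennreal_mult)
    also have "\<dots> = (\<integral>\<^sup>+x. ennreal (norm (u x)) \<partial>M) * (\<integral>\<^sup>+w. ennreal (norm (Z w)) \<partial>iid I)"
      by (rule nn_integral_peel[OF I]) (auto simp: ind)
    also have "\<dots> < \<infinity>"
      using u Z by (auto simp: integrable_iff_bounded ennreal_mult_less_top)
    finally show "(\<integral>\<^sup>+w. ennreal (norm (u (w i) * Z w)) \<partial>iid I) < \<infinity>" .
  qed measurable
  obtain x0 where x0: "x0 \<in> space M" using not_empty by blast
  have "(\<integral>w. u (w i) * Z w \<partial>iid I) = (\<integral>w. (\<integral>x. u x * Z w \<partial>M) \<partial>iid J)"
    using int unfolding J(3) by (subst pp.product_integral_insert[OF J(1,2)]) (auto simp: ind)
  also have "\<dots> = (\<integral>x. u x \<partial>M) * (\<integral>w. Z w \<partial>iid J)"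
    by simp
  also have "(\<integral>w. Z w \<partial>iid J) = (\<integral>w. Z w \<partial>iid I)"
    using Z unfolding J(3) by (subst pp.product_integral_insert[OF J(1,2)]) (auto simp: ind prob_space)
  finally show "(\<integral>w. u (w i) * Z w \<partial>iid I) = (\<integral>x. u x \<partial>M) * (\<integral>w. Z w \<partial>iid I)" .
qed

lemma integral_peel_prod:
  fixes u :: "'a \<Rightarrow> 'b::{real_normed_field, banach, second_countable_topology}"
  assumes I: "finite I" "Q \<subseteq> I" and u: "integrable M u"
    and Z: "integrable (iid I) Z"
    and ind: "\<And>i w x. i \<in> Q \<Longrightarrow> Z (w(i := x)) = Z w"
  shows "integrable (iid I) (\<lambda>w. (\<Prod>i\<in>Q. u (w i)) * Z w) \<and>
    (\<integral>w. (\<Prod>i\<in>Q. u (w i)) * Z w \<partial>iid I) = (\<integral>x. u x \<partial>M) ^ card Q * (\<integral>w. Z w \<partial>iid I)"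
proof -
  have "finite Q" using I by (auto intro: finite_subset)
  thus ?thesis using I(2) ind
  proof (induction Q rule: finite_induct)
    case (insert i Q)
    have IH: "integrable (iid I) (\<lambda>w. (\<Prod>i\<in>Q. u (w i)) * Z w)"
      "(\<integral>w. (\<Prod>i\<in>Q. u (w i)) * Z w \<partial>iid I) = (\<integral>x. u x \<partial>M) ^ card Q * (\<integral>w. Z w \<partial>iid I)"
      using insert by auto
    have ind': "(\<Prod>j\<in>Q. u ((w(i := x)) j)) * Z (w(i := x)) = (\<Prod>j\<in>Q. u (w j)) * Z w" for w x
    proof -
      have "(\<Prod>j\<in>Q. u ((w(i := x)) j)) = (\<Prod>j\<in>Q. u (w j))"
        using insert.hyps by (intro prod.cong) auto
      thus ?thesis by (simp only: insert.prems(2)[of i w x, OF insertI1])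
    qed
    from integral_peel[OF I(1) _ u IH(1), of i] ind' insert show ?case
      by (simp add: IH(2) mult.assoc)
  qed (use Z in simp)
qed

text \<open>With coordinate i as the inner variable, Z is a constant factor and the inner integral
  of f vanishes.\<close>

lemma integral_degenerate_eq_0:
  fixes Z :: "(nat \<Rightarrow> 'a) \<Rightarrow> 'b::{real_normed_field, banach, second_countable_topology}"
  assumes I: "finite I" "i \<in> I" and f: "degenerate_at I i f"
    and int: "integrable (iid I) (\<lambda>w. Z w * of_real (f w))"
    and ind: "\<And>w x. Z (w(i := x)) = Z w"
  shows "(\<integral>w. Z w * of_real (f w) \<partial>iid I) = 0"
proof -
  define J where "J = I - {i}"
  have J: "finite J" "i \<notin> J" "I = insert i J" using I by (auto simp: J_def)
  have "(\<integral>w. Z w * of_real (f w) \<partial>iid I) = (\<integral>w. (\<integral>x. Z w * of_real (f (w(i := x))) \<partial>M) \<partial>iid J)"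
    using int unfolding J(3) by (subst pp.product_integral_insert[OF J(1,2)]) (auto simp: ind)
  also have "\<dots> = 0"
  proof (rule integral_eq_zero_AE)
    from degenerate_at_inner[OF J(1,2) f[unfolded J(3)]]
    show "AE w in iid J. (\<integral>x. Z w * of_real (f (w(i := x))) \<partial>M) = 0"
    proof eventually_elim
      case (elim w)
      have "has_bochner_integral M (\<lambda>x. of_real (f (w(i := x))) :: 'b) (of_real 0)"
        by (rule has_bochner_integral_of_real[OF elim])
      hence "(\<integral>x. of_real (f (w(i := x))) \<partial>M) = (0 :: 'b)"
        by (simp add: has_bochner_integral_iff)
      thus ?case by simp
    qed
  qed
  finally show ?thesis .
qed

lemma distr_iid_reindex:
  assumes "inj_on e J" "e \<in> J \<rightarrow> I"
  shows "distr (iid I) (iid J) (\<lambda>w. \<lambda>n\<in>J. w (e n)) = iid J"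
  by (rule distr_PiM_reindex[OF _ assms]) unfold_locales

lemma measurable_reindex:
  assumes "e \<in> J \<rightarrow> I"
  shows "(\<lambda>w. \<lambda>n\<in>J. w (e n)) \<in> measurable (iid I) (iid J)"
  using assms by (intro measurable_restrict measurable_component_singleton) auto

end

section \<open>Esseen's smoothing inequality\<close>

lemma integral_swap_bounded:
  fixes H :: "'a \<Rightarrow> 'b \<Rightarrow> real"
  assumes N: "sigma_finite_measure N1" "sigma_finite_measure N2"
    and H[measurable]: "case_prod H \<in> borel_measurable (N1 \<Otimes>\<^sub>M N2)"
    and g: "integrable N1 g1" "integrable N2 g2"
    and le: "\<And>x y. \<bar>H x y\<bar> \<le> \<bar>g1 x\<bar> * \<bar>g2 y\<bar>"
  shows "(\<integral>x. (\<integral>y. H x y \<partial>N2) \<partial>N1) = (\<integral>y. (\<integral>x. H x y \<partial>N1) \<partial>N2)"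
proof -
  interpret pair_sigma_finite N1 N2 using N by (simp add: pair_sigma_finite_def)
  have [measurable]: "g1 \<in> borel_measurable N1" "g2 \<in> borel_measurable N2" using g by auto
  have "integrable (N1 \<Otimes>\<^sub>M N2) (\<lambda>p. \<bar>g1 (fst p)\<bar> * \<bar>g2 (snd p)\<bar>)"
    using g by (intro Fubini_integrable) (auto simp: abs_mult)
  hence "integrable (N1 \<Otimes>\<^sub>M N2) (case_prod H)"
    by (rule Bochner_Integration.integrable_bound) (use le in \<open>auto simp: abs_mult\<close>)
  from Fubini_integral[OF this] show ?thesis ..
qed

text \<open>The kernel is deliberately not normalized; only the positivity of its integral matters.\<close>

definition fejer :: "real \<Rightarrow> real" where
  "fejer y = (if y = 0 then 1 else 2 * (1 - cos y) / y^2)"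

text \<open>Integration by parts: the kernel is the cosine transform of the triangle 2(1 - s) on
  [0, 1], whose area is the value 1 prescribed at y = 0.\<close>

lemma fejer_eq_integral:
  "fejer y = (\<integral>s. indicator {0..1} s * (2 * (1 - s) * cos (s * y)) \<partial>lborel)"
proof (cases "y = 0")
  case True
  have "(\<integral>s. indicator {0..1} s *\<^sub>R (2 * (1 - s)) \<partial>lborel) = (2 * 1 - 1^2) - (2 * 0 - 0^2 :: real)"
    by (rule integral_FTC_Icc)
      (auto intro!: derivative_eq_intros continuous_intros simp: has_real_derivative_iff_has_vector_derivative[symmetric])
  with True show ?thesis by (simp add: fejer_def)
next
  case False
  let ?F = "\<lambda>s. 2 * ((1 - s) * (sin (s * y) / y) - cos (s * y) / y^2)"
  have "(\<integral>s. indicator {0..1} s *\<^sub>R (2 * (1 - s) * cos (s * y)) \<partial>lborel) = ?F 1 - ?F 0"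
  proof (rule integral_FTC_Icc)
    fix s :: real
    have "(?F has_real_derivative 2 * (1 - s) * cos (s * y)) (at s within {0..1})"
      using False by (auto intro!: derivative_eq_intros simp: field_simps power2_eq_square)
    thus "(?F has_vector_derivative 2 * (1 - s) * cos (s * y)) (at s within {0..1})"
      by (simp add: has_real_derivative_iff_has_vector_derivative)
  qed (auto intro!: continuous_intros)
  with False show ?thesis by (simp add: fejer_def field_simps)
qed

lemma fejer_nonneg: "0 \<le> fejer y"
  by (simp add: fejer_def)

lemma fejer_le: "fejer y \<le> 8 * inverse (1 + y^2)"
proof (cases "y = 0")
  case False
  have 1: "fejer y \<le> 1"
  proof -
    have "1 - cos y \<le> y^2 / 2"
    proof -
      have "(sin (y/2))^2 \<le> (y/2)^2"
        using abs_sin_x_le_abs_x[of "y/2"] by (simp only: abs_le_square_iff)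
      thus ?thesis using cos_double_sin[of "y/2"] by (simp add: power_divide)
    qed
    thus ?thesis using False by (simp add: fejer_def field_simps)
  qed
  have 2: "fejer y * y^2 \<le> 4"
    using False cos_ge_minus_one[of y] unfolding fejer_def by (simp, linarith)
  have "fejer y * (1 + y^2) \<le> 8"
    using 1 2 by (simp add: algebra_simps)
  thus ?thesis by (simp add: divide_simps mult.commute add_pos_nonneg)
qed (simp add: fejer_def)

lemma fejer_measurable[measurable]: "fejer \<in> borel_measurable borel"
  unfolding fejer_def by measurable

lemma integrable_fejer: "integrable lborel fejer"
proof (rule Bochner_Integration.integrable_bound)
  show "integrable lborel (\<lambda>y. 8 * inverse (1 + y^2) :: real)"
    using integrable_inverse_1_plus_square by (simp add: set_integrable_def)
qed (use fejer_le fejer_nonneg in \<open>auto intro!: order_trans[OF fejer_le]\<close>)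

lemma integral_fejer_pos: "0 < (\<integral>y. fejer y \<partial>lborel)"
proof -
  have "(\<integral>y. fejer y \<partial>lborel) \<noteq> 0"
  proof
    assume "(\<integral>y. fejer y \<partial>lborel) = 0"
    hence "AE y in lborel. fejer y = 0"
      using integral_nonneg_eq_0_iff_AE[OF integrable_fejer] fejer_nonneg by auto
    hence "AE y in lborel. y \<notin> {0<..<1::real}"
    proof eventually_elim
      case (elim y)
      show ?case
      proof
        assume y: "y \<in> {0<..<1}"
        hence "cos y < cos 0" using pi_gt3 by (intro cos_monotone_0_pi) auto
        with elim y show False by (simp add: fejer_def)
      qed
    qed
    hence "emeasure lborel {0<..<1::real} = 0"
      by (subst (asm) AE_iff_measurable[where N = "{0<..<1}"]) auto
    thus False by simp
  qed
  thus ?thesis using integral_nonneg_AE[of fejer lborel] fejer_nonneg by (simp add: less_le)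
qed

lemma fejer_tail:
  assumes "\<epsilon> > 0"
  obtains R where "R > 0" "\<And>r. r \<ge> R \<Longrightarrow> (\<integral>y. indicator {y. \<bar>y\<bar> > r} y * fejer y \<partial>lborel) \<le> \<epsilon>"
proof -
  let ?T = "\<lambda>r. \<integral>y. indicator {y. \<bar>y\<bar> > r} y * fejer y \<partial>lborel"
  have "(\<lambda>n. ?T (real n)) \<longlonglongrightarrow> (\<integral>y. 0 \<partial>(lborel :: real measure))"
  proof (rule integral_dominated_convergence[where w = fejer])
    show "AE y in lborel. (\<lambda>n. indicator {y. \<bar>y\<bar> > real n} y * fejer y) \<longlonglongrightarrow> 0"
    proof (rule AE_I2)
      fix y :: real
      obtain N where "\<bar>y\<bar> \<le> real N" using real_arch_simple by blast
      hence "indicator {y. \<bar>y\<bar> > real n} y * fejer y = 0" if "n \<ge> N" for n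
        using that by (auto simp: indicator_def)
      thus "(\<lambda>n. indicator {y. \<bar>y\<bar> > real n} y * fejer y) \<longlonglongrightarrow> 0"
        by (intro tendsto_eventually eventually_sequentiallyI[of N])
    qed
  qed (use integrable_fejer fejer_nonneg in \<open>auto simp: indicator_def\<close>)
  hence "eventually (\<lambda>n. ?T (real n) < \<epsilon>) sequentially"
    using assms by (intro order_tendstoD(2)[where a = \<epsilon>]) auto
  then obtain N where N: "?T (real N) < \<epsilon>"
    by (auto simp: eventually_sequentially)
  have int: "integrable lborel (\<lambda>y. indicator {y. \<bar>y\<bar> > r} y * fejer y)" for r
    by (rule Bochner_Integration.integrable_bound[OF integrable_fejer]) (auto simp: indicator_def)
  have "?T r \<le> \<epsilon>" if "r \<ge> real N + 1" for r
  proof -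
    have "?T r \<le> ?T (real N)"
      by (intro integral_mono int) (use that fejer_nonneg in \<open>auto simp: indicator_def\<close>)
    with N show ?thesis by linarith
  qed
  thus ?thesis using that[of "real N + 1"] by simp
qed

text \<open>Oscillation makes the bound independent of the length of [a, b], which permits a to tend
  to -infinity in the smoothing inequality; the factor 1/\<theta> cancels the t in the hypothesis t
  * B t made there.\<close>

lemma norm_integral_iexp_le:
  fixes a b \<theta> :: real
  assumes "a \<le> b" "\<theta> > 0"
  shows "cmod (\<integral>x. indicator {a..b} x *\<^sub>R iexp (- \<theta> * x) \<partial>lborel) \<le> 2 / \<theta>"
proof -
  let ?F = "\<lambda>x. iexp (- \<theta> * x) * (\<i> / \<theta>)"
  have "(\<integral>x. indicator {a..b} x *\<^sub>R iexp (- \<theta> * x) \<partial>lborel) = ?F b - ?F a"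
  proof (rule integral_FTC_Icc[OF assms(1)])
    fix x :: real
    show "(?F has_vector_derivative iexp (- \<theta> * x)) (at x within {a..b})"
      unfolding of_real_mult of_real_minus
      by (rule has_vector_derivative_real_field)
        (use assms in \<open>auto intro!: derivative_eq_intros simp: field_simps\<close>)
  qed (auto intro!: continuous_intros)
  also have "cmod \<dots> \<le> cmod (?F b) + cmod (?F a)" by (rule norm_triangle_ineq4)
  also have "\<dots> = 2 / \<theta>"
    using assms norm_exp_i_times[of "- \<theta> * b"] norm_exp_i_times[of "- \<theta> * a"]
    by (simp add: norm_mult norm_divide)
  finally show ?thesis .
qed

text \<open>A Parseval identity: the kernel \<open>fejer\<close> has a compactly supported Fourier transform, so smoothing
  with it involves only the frequencies in \<open>[-U, U]\<close>.\<close>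

lemma fejer_convolution_eq:
  fixes w :: "real \<Rightarrow> real" and a b U :: real
  assumes N: "sigma_finite_measure N" "sets N = sets borel" and w: "integrable N w" and U: "U > 0"
  shows "(\<integral>y. fejer (U * y) * (\<integral>z. w z * indicator {a - y<..b - y} z \<partial>N) \<partial>lborel) =
    (\<integral>s. indicator {0..1} s * (2 * (1 - s)) *
       (\<integral>x. indicator {a..b} x * Re (iexp (- (s * U) * x) * (\<integral>z. w z *\<^sub>R iexp (s * U * z) \<partial>N)) \<partial>lborel) \<partial>lborel)"
proof -
  note N(2)[measurable_cong]
  have [measurable]: "w \<in> borel_measurable borel"
    using w N(2) by (metis borel_measurable_integrable measurable_cong_sets)
  have sf: "sigma_finite_measure (lborel :: real measure)" by (rule sigma_finite_lborel)
  have iU: "integrable lborel (\<lambda>y. fejer (U * y))"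
    using lborel_integrable_real_affine[OF integrable_fejer, of U 0] U by simp
  have iI: "integrable lborel (indicator {a..b} :: real \<Rightarrow> real)"
    by (simp add: integrable_indicator_iff emeasure_lborel_Icc_eq)
  have ik: "integrable lborel (\<lambda>s::real. 2 * indicator {0..1} s :: real)"
    by (simp add: integrable_indicator_iff emeasure_lborel_Icc_eq)
  have ind: "indicator {a - y<..b - y} z = (indicator {a<..b} (y + z) :: real)" for y z :: real
    by (auto simp: indicator_def)
  have "(\<integral>y. fejer (U * y) * (\<integral>z. w z * indicator {a - y<..b - y} z \<partial>N) \<partial>lborel) =
    (\<integral>y. (\<integral>z. fejer (U * y) * (w z * indicator {a<..b} (y + z)) \<partial>N) \<partial>lborel)"
    by (simp add: ind)
  also have "\<dots> = (\<integral>z. (\<integral>y. fejer (U * y) * (w z * indicator {a<..b} (y + z)) \<partial>lborel) \<partial>N)"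
    by (rule integral_swap_bounded[OF sf N(1) _ iU w])
      (auto simp: abs_mult indicator_def)
  also have "\<dots> = (\<integral>z. (\<integral>x. w z * indicator {a..b} x * fejer (U * (x - z)) \<partial>lborel) \<partial>N)"
  proof (rule Bochner_Integration.integral_cong[OF refl])
    fix z
    have "(\<integral>y. fejer (U * y) * (w z * indicator {a<..b} (y + z)) \<partial>lborel) =
       (\<integral>x. fejer (U * (x - z)) * (w z * indicator {a<..b} x) \<partial>lborel)"
      by (subst lborel_integral_real_affine[where c = 1 and t = "-z"]) (auto simp: algebra_simps)
    \<comment> \<open>The half-open interval comes from increments of a distribution function, which
      may jump. After the substitution it is integrated against Lebesgue measure, where the endpoint
      a is a null set.\<close>
    also have "\<dots> = (\<integral>x. w z * indicator {a..b} x * fejer (U * (x - z)) \<partial>lborel)"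
    proof (rule integral_cong_AE)
      show "AE x in lborel. fejer (U * (x - z)) * (w z * indicator {a<..b} x) = w z * indicator {a..b} x * fejer (U * (x - z))"
        using AE_lborel_singleton[of a] by eventually_elim (auto simp: indicator_def)
    qed measurable
    finally show "(\<integral>y. fejer (U * y) * (w z * indicator {a<..b} (y + z)) \<partial>lborel) = (\<integral>x. w z * indicator {a..b} x * fejer (U * (x - z)) \<partial>lborel)" .
  qed
  also have "\<dots> = (\<integral>x. (\<integral>z. w z * indicator {a..b} x * fejer (U * (x - z)) \<partial>N) \<partial>lborel)"
  proof (rule integral_swap_bounded[OF N(1) sf _ w, where ?g2.0 = "\<lambda>x. 8 * indicator {a..b} x"])
    fix z x
    have "fejer (U * (x - z)) \<le> 8"
      by (rule order_trans[OF fejer_le]) (auto simp: divide_simps add_pos_nonneg)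
    thus "\<bar>w z * indicator {a..b} x * fejer (U * (x - z))\<bar> \<le> \<bar>w z\<bar> * \<bar>8 * indicator {a..b} x\<bar>"
      using fejer_nonneg[of "U * (x - z)"] by (auto simp: abs_mult indicator_def intro: mult_left_mono)
  qed (use iI in auto)
  also have "\<dots> = (\<integral>x. indicator {a..b} x * (\<integral>z. w z * fejer (U * (x - z)) \<partial>N) \<partial>lborel)"
    by (intro Bochner_Integration.integral_cong refl) (auto simp: indicator_def)
  also have "\<dots> = (\<integral>x. (\<integral>s. indicator {a..b} x * (indicator {0..1} s * (2 * (1 - s)) *
       Re (iexp (- (s * U) * x) * (\<integral>z. w z *\<^sub>R iexp (s * U * z) \<partial>N))) \<partial>lborel) \<partial>lborel)"
  proof (rule Bochner_Integration.integral_cong[OF refl])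
    fix x
    \<comment> \<open>Inserting the cosine representation of the kernel and exchanging the integrals
      produces the Fourier transform of the weighted measure at the frequencies s U with 0 \<le> s
      \<le> 1.\<close>
    have "(\<integral>z. w z * fejer (U * (x - z)) \<partial>N) =
      (\<integral>z. (\<integral>s. w z * (indicator {0..1} s * (2 * (1 - s) * cos (s * (U * (x - z))))) \<partial>lborel) \<partial>N)"
      by (simp add: fejer_eq_integral)
    also have "\<dots> = (\<integral>s. (\<integral>z. w z * (indicator {0..1} s * (2 * (1 - s) * cos (s * (U * (x - z))))) \<partial>N) \<partial>lborel)"
    proof (rule integral_swap_bounded[OF N(1) sf _ w ik])
      fix z s
      have "\<bar>(1 - s) * cos (s * (U * (x - z)))\<bar> \<le> 1 * 1" if "s \<in> {0..1}"
        unfolding abs_mult using that by (intro mult_mono) auto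
      thus "\<bar>w z * (indicator {0..1} s * (2 * (1 - s) * cos (s * (U * (x - z)))))\<bar> \<le> \<bar>w z\<bar> * \<bar>2 * indicator {0..1} s\<bar>"
        by (auto simp: abs_mult indicator_def mult.assoc simp del: right_diff_distrib_numeral intro!: mult_left_le)
    qed measurable
    also have "\<dots> = (\<integral>s. indicator {0..1} s * (2 * (1 - s)) *
       Re (iexp (- (s * U) * x) * (\<integral>z. w z *\<^sub>R iexp (s * U * z) \<partial>N)) \<partial>lborel)"
    proof (rule Bochner_Integration.integral_cong[OF refl])
      fix s
      have int: "integrable N (\<lambda>z. w z *\<^sub>R iexp (s * U * z))"
        by (rule Bochner_Integration.integrable_bound[OF w]) auto
      have "Re (iexp (- (s * U) * x) * (\<integral>z. w z *\<^sub>R iexp (s * U * z) \<partial>N)) =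
        Re (\<integral>z. iexp (- (s * U) * x) * (w z *\<^sub>R iexp (s * U * z)) \<partial>N)"
        by (simp only: integral_mult_right_zero)
      also have "\<dots> = (\<integral>z. Re (iexp (- (s * U) * x) * (w z *\<^sub>R iexp (s * U * z))) \<partial>N)"
        using int by (intro integral_Re[symmetric] integrable_mult_right)
      also have "\<dots> = (\<integral>z. w z * cos (s * (U * (x - z))) \<partial>N)"
      proof (rule Bochner_Integration.integral_cong[OF refl])
        fix z
        have "iexp (- (s * U) * x) * (w z *\<^sub>R iexp (s * U * z)) = w z *\<^sub>R iexp (- (s * (U * (x - z))))"
          by (simp add: mult_exp_exp algebra_simps)
        moreover have "Re (w z *\<^sub>R iexp (- (s * (U * (x - z))))) = w z * cos (- (s * (U * (x - z))))"
          by (simp only: cis_conv_exp[symmetric] scaleR_complex.simps cis.simps)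
        ultimately show "Re (iexp (- (s * U) * x) * (w z *\<^sub>R iexp (s * U * z))) = w z * cos (s * (U * (x - z)))"
          by (simp only: cos_minus)
      qed
      finally have eq: "Re (iexp (- (s * U) * x) * (\<integral>z. w z *\<^sub>R iexp (s * U * z) \<partial>N)) = (\<integral>z. w z * cos (s * (U * (x - z))) \<partial>N)" .
      have *: "w z * (i * (k * c)) = (i * k) * (w z * c)" for z i k c by simp
      show "(\<integral>z. w z * (indicator {0..1} s * (2 * (1 - s) * cos (s * (U * (x - z))))) \<partial>N) =
        indicator {0..1} s * (2 * (1 - s)) * Re (iexp (- (s * U) * x) * (\<integral>z. w z *\<^sub>R iexp (s * U * z) \<partial>N))"
        unfolding eq * by (rule integral_mult_right_zero)
    qed
    finally show "indicator {a..b} x * (\<integral>z. w z * fejer (U * (x - z)) \<partial>N) =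
      (\<integral>s. indicator {a..b} x * (indicator {0..1} s * (2 * (1 - s)) *
       Re (iexp (- (s * U) * x) * (\<integral>z. w z *\<^sub>R iexp (s * U * z) \<partial>N))) \<partial>lborel)"
      by simp
  qed
  also have "\<dots> = (\<integral>s. (\<integral>x. indicator {a..b} x * (indicator {0..1} s * (2 * (1 - s)) *
       Re (iexp (- (s * U) * x) * (\<integral>z. w z *\<^sub>R iexp (s * U * z) \<partial>N))) \<partial>lborel) \<partial>lborel)"
  proof (rule integral_swap_bounded[OF sf sf _ iI, where ?g2.0 = "\<lambda>s::real. (\<integral>z. \<bar>w z\<bar> \<partial>N) * (2 * indicator {0..1} s)"])
    show "integrable lborel (\<lambda>s::real. (\<integral>z. \<bar>w z\<bar> \<partial>N) * (2 * indicator {0..1} s))"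
      by (rule integrable_mult_right[OF ik])
    interpret N: sigma_finite_measure N by (rule N)
    show "(\<lambda>(x, s). indicator {a..b} x * (indicator {0..1} s * (2 * (1 - s)) *
       Re (iexp (- (s * U) * x) * (\<integral>z. w z *\<^sub>R iexp (s * U * z) \<partial>N)))) \<in> borel_measurable (lborel \<Otimes>\<^sub>M lborel)"
      by measurable
    fix x s
    have "\<bar>Re (iexp (- (s * U) * x) * (\<integral>z. w z *\<^sub>R iexp (s * U * z) \<partial>N))\<bar> \<le>
      cmod (iexp (- (s * U) * x) * (\<integral>z. w z *\<^sub>R iexp (s * U * z) \<partial>N))" by (rule abs_Re_le_cmod)
    also have "\<dots> \<le> (\<integral>z. norm (w z *\<^sub>R iexp (s * U * z)) \<partial>N)"
      unfolding norm_mult norm_exp_i_times by (simp del: norm_scaleR)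
    also have "\<dots> = (\<integral>z. \<bar>w z\<bar> \<partial>N)"
      by (simp del: of_real_mult)
    finally have *: "\<bar>Re (iexp (- (s * U) * x) * (\<integral>z. w z *\<^sub>R iexp (s * U * z) \<partial>N))\<bar> \<le> (\<integral>z. \<bar>w z\<bar> \<partial>N)" .
    show "\<bar>indicator {a..b} x * (indicator {0..1} s * (2 * (1 - s)) *
       Re (iexp (- (s * U) * x) * (\<integral>z. w z *\<^sub>R iexp (s * U * z) \<partial>N)))\<bar>
      \<le> \<bar>indicator {a..b} x\<bar> * \<bar>(\<integral>z. \<bar>w z\<bar> \<partial>N) * (2 * indicator {0..1} s)\<bar>"
      unfolding abs_mult
    proof (intro mult_left_mono)
      have "\<bar>indicator {0..1} s\<bar> * (\<bar>2\<bar> * \<bar>1 - s\<bar>) \<le> 2 * indicator {0..1} s"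
        by (auto simp: indicator_def)
      hence "\<bar>indicator {0..1} s\<bar> * (\<bar>2\<bar> * \<bar>1 - s\<bar>) * \<bar>Re (iexp (- (s * U) * x) * (\<integral>z. w z *\<^sub>R iexp (s * U * z) \<partial>N))\<bar> \<le>
        (2 * indicator {0..1} s) * (\<integral>z. \<bar>w z\<bar> \<partial>N)"
        by (rule mult_mono[OF _ *]) auto
      thus "\<bar>indicator {0..1} s\<bar> * (\<bar>2\<bar> * \<bar>1 - s\<bar>) * \<bar>Re (iexp (- (s * U) * x) * (\<integral>z. w z *\<^sub>R iexp (s * U * z) \<partial>N))\<bar> \<le>
        \<bar>\<integral>z. \<bar>w z\<bar> \<partial>N\<bar> * (\<bar>2\<bar> * \<bar>indicator {0..1} s\<bar>)"
        by (simp add: mult.commute mult.left_commute)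
    qed auto
  qed
  also have "\<dots> = (\<integral>s. indicator {0..1} s * (2 * (1 - s)) *
       (\<integral>x. indicator {a..b} x * Re (iexp (- (s * U) * x) * (\<integral>z. w z *\<^sub>R iexp (s * U * z) \<partial>N)) \<partial>lborel) \<partial>lborel)"
  proof (rule Bochner_Integration.integral_cong[OF refl])
    fix s
    have *: "indicator {a..b} x * (indicator {0..1} s * (2 * (1 - s)) * q) = (indicator {0..1} s * (2 * (1 - s))) * (indicator {a..b} x * q)"
      for x q :: real by simp
    show "(\<integral>x. indicator {a..b} x * (indicator {0..1} s * (2 * (1 - s)) *
       Re (iexp (- (s * U) * x) * (\<integral>z. w z *\<^sub>R iexp (s * U * z) \<partial>N))) \<partial>lborel) =
       indicator {0..1} s * (2 * (1 - s)) *
       (\<integral>x. indicator {a..b} x * Re (iexp (- (s * U) * x) * (\<integral>z. w z *\<^sub>R iexp (s * U * z) \<partial>N)) \<partial>lborel)"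
      unfolding * by (rule integral_mult_right_zero)
  qed
  finally show ?thesis .
qed

text \<open>Near a point where \<open>\<bar>F - G\<bar>\<close> almost attains its supremum \<open>\<eta>\<close>, it stays above \<open>\<eta>/2\<close> on an
  interval of length proportional to \<open>\<eta>/K\<close>, since \<open>F\<close> is monotone and \<open>G\<close> is Lipschitz. Hence either
  \<open>\<eta>\<close> is of order \<open>K/U\<close> or the smoothed difference is comparable with \<open>\<eta>\<close>.\<close>

theorem esseen_smoothing:
  obtains C :: real where "C > 0"
    "\<And>M G D B U K x. real_distribution M \<Longrightarrow>
      (\<And>x. (G has_real_derivative D x) (at x)) \<Longrightarrow> continuous_on UNIV D \<Longrightarrow>
      integrable lborel D \<Longrightarrow> (G \<longlongrightarrow> 0) at_bot \<Longrightarrow> (\<exists>b. \<forall>x. \<bar>G x\<bar> \<le> b) \<Longrightarrow>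
      0 < K \<Longrightarrow> (\<And>x. \<bar>D x\<bar> \<le> K) \<Longrightarrow> 0 < U \<Longrightarrow> integrable lborel B \<Longrightarrow> (\<And>t. 0 \<le> B t) \<Longrightarrow>
      (\<And>t. 0 < t \<Longrightarrow> t \<le> U \<Longrightarrow> cmod (char M t - (\<integral>x. D x *\<^sub>R iexp (t * x) \<partial>lborel)) \<le> t * B t) \<Longrightarrow>
      \<bar>cdf M x - G x\<bar> \<le> C * ((\<integral>t. B t \<partial>lborel) + K / U)"
proof -
  define c0 where "c0 = (\<integral>y. fejer y \<partial>lborel)"
  have c0: "c0 > 0" unfolding c0_def by (rule integral_fejer_pos)
  \<comment> \<open>In the final estimate the tail is weighted by 3/2 \<eta> against a gain of
    \<eta>/2 times the full mass; a sixth of the mass makes the loss half of the gain.\<close>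
  obtain R where R: "R > 0" "\<And>r. r \<ge> R \<Longrightarrow> (\<integral>y. indicator {y. \<bar>y\<bar> > r} y * fejer y \<partial>lborel) \<le> c0 / 6"
    using fejer_tail[of "c0 / 6"] c0 by auto
  \<comment> \<open>5 R serves the case in which the kernel at scale 1/U is too wide for the
    interval found below, 16 / c0 the case in which the smoothed difference controls \<eta>.\<close>
  define C where "C = 5 * R + 16 / c0"
  have C: "C > 0" unfolding C_def using R(1) c0 by (intro add_pos_pos) auto
  have "\<bar>cdf M x - G x\<bar> \<le> C * ((\<integral>t. B t \<partial>lborel) + K / U)"
    if M: "real_distribution M" and G: "\<And>x. (G has_real_derivative D x) (at x)" and contD: "continuous_on UNIV D"
    and D: "integrable lborel D" and G0: "(G \<longlongrightarrow> 0) at_bot" and Gb: "\<exists>b. \<forall>x. \<bar>G x\<bar> \<le> b"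
    and K: "0 < K" "\<And>x. \<bar>D x\<bar> \<le> K" and U: "0 < U" and B: "integrable lborel B" "\<And>t. 0 \<le> B t"
    and diff: "\<And>t. 0 < t \<Longrightarrow> t \<le> U \<Longrightarrow> cmod (char M t - (\<integral>x. D x *\<^sub>R iexp (t * x) \<partial>lborel)) \<le> t * B t"
  for M G D B U K x
  proof -
    interpret M: real_distribution M by (rule M)
    define \<Delta> where "\<Delta> = (\<lambda>x. cdf M x - G x)"
    define I where "I = (\<integral>t. B t \<partial>lborel)"
    have I0: "I \<ge> 0" unfolding I_def using B(2) by simp
    have [measurable]: "B \<in> borel_measurable borel" using B(1) by auto
    have [measurable]: "D \<in> borel_measurable borel" using D by auto
    have contG: "continuous_on UNIV G"
      using G by (intro DERIV_continuous_on[of _ G D]) (auto intro: has_field_derivative_at_within)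
    have [measurable]: "G \<in> borel_measurable borel" by (intro borel_measurable_continuous_onI contG)
    have [measurable]: "cdf M \<in> borel_measurable borel"
      by (intro borel_measurable_mono monoI M.cdf_nondecreasing)
    have [measurable]: "\<Delta> \<in> borel_measurable borel" unfolding \<Delta>_def by measurable
    obtain b0 where b0: "\<And>x. \<bar>G x\<bar> \<le> b0" using Gb by auto
    have \<Delta>b: "\<bar>\<Delta> x\<bar> \<le> 1 + b0" for x
      unfolding \<Delta>_def using b0[of x] M.cdf_bounded_prob[of x] M.cdf_nonneg[of x] by linarith
    have iV: "integrable lborel (\<lambda>y. fejer (U * y))"
      using lborel_integrable_real_affine[OF integrable_fejer, of U 0] U by simp
    have V0: "0 \<le> fejer (U * y)" for y by (rule fejer_nonneg)
    have intV: "integrable lborel (\<lambda>y. fejer (U * y) * \<Delta> (x - y))" for x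
    proof (rule Bochner_Integration.integrable_bound)
      show "integrable lborel (\<lambda>y. fejer (U * y) * (1 + b0))" using iV by simp
      show "AE y in lborel. norm (fejer (U * y) * \<Delta> (x - y)) \<le> norm (fejer (U * y) * (1 + b0))"
        using \<Delta>b V0 by (intro AE_I2) (auto simp: abs_mult intro!: mult_left_mono order_trans[OF \<Delta>b])
    qed measurable
    have G_diff: "G b - G a = (\<integral>z. D z * indicator {a<..b} z \<partial>lborel)" if "a \<le> b" for a b
    proof -
      have "G b - G a = (\<integral>z. indicator {a..b} z *\<^sub>R D z \<partial>lborel)"
        using G contD that by (intro integral_FTC_Icc[symmetric])
          (auto simp flip: has_real_derivative_iff_has_vector_derivative
            intro: has_field_derivative_at_within continuous_on_subset)
      also have "\<dots> = (\<integral>z. D z * indicator {a<..b} z \<partial>lborel)"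
      proof (rule integral_cong_AE)
        show "AE z in lborel. indicator {a..b} z *\<^sub>R D z = D z * indicator {a<..b} z"
          using AE_lborel_singleton[of a] by eventually_elim (auto simp: indicator_def)
      qed measurable
      finally show ?thesis .
    qed
    have F_diff: "cdf M b - cdf M a = (\<integral>z. 1 * indicator {a<..b} z \<partial>M)" if "a \<le> b" for a b
      using that M.cdf_diff_eq[of a b] by (cases "a = b") auto
    \<comment> \<open>Only increments of \<Delta> have a Fourier representation by
      \<open>fejer_convolution_eq\<close>. The bound does not depend on b - a. Its 4 is the product
      of the maximum 2 of the triangle weight and the 2 of \<open>norm_integral_iexp_le\<close>; the
      substitution t = U s gives 1/U.\<close>
    have incr: "\<bar>\<integral>y. fejer (U * y) * (\<Delta> (b - y) - \<Delta> (a - y)) \<partial>lborel\<bar> \<le> 4 / U * I" if ab: "a \<le> b" for a b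
    proof -
      define \<phi> where "\<phi> = (\<lambda>s. \<integral>z. 1 *\<^sub>R iexp (s * U * z) \<partial>M)"
      define \<psi> where "\<psi> = (\<lambda>s. \<integral>z. D z *\<^sub>R iexp (s * U * z) \<partial>lborel)"
      define JM where "JM = (\<lambda>s. \<integral>x. indicator {a..b} x * Re (iexp (- (s * U) * x) * \<phi> s) \<partial>lborel)"
      define JD where "JD = (\<lambda>s. \<integral>x. indicator {a..b} x * Re (iexp (- (s * U) * x) * \<psi> s) \<partial>lborel)"
      have ii: "integrable lborel (\<lambda>x. indicator {a..b} x * Re (iexp (- (s * U) * x) * q))" for s q
      proof (rule Bochner_Integration.integrable_bound)
        show "integrable lborel (\<lambda>x. indicator {a..b} x * cmod q)"
          by (simp add: integrable_indicator_iff emeasure_lborel_Icc_eq)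
        show "AE x in lborel. norm (indicator {a..b} x * Re (iexp (- (s * U) * x) * q)) \<le> norm (indicator {a..b} x * cmod q)"
        proof (rule AE_I2)
          fix x :: real
          have "\<bar>Re (iexp (- (s * U) * x) * q)\<bar> \<le> cmod q"
            using abs_Re_le_cmod[of "iexp (- (s * U) * x) * q"] unfolding norm_mult norm_exp_i_times by simp
          thus "norm (indicator {a..b} x * Re (iexp (- (s * U) * x) * q)) \<le> norm (indicator {a..b} x * cmod q)"
            by (auto simp: indicator_def simp del: of_real_minus of_real_mult)
        qed
      qed measurable
      have J_le: "\<bar>JM s - JD s\<bar> \<le> 2 * B (s * U)" if s: "0 < s" "s \<le> 1" for s
      proof -
        have "JM s - JD s = (\<integral>x. indicator {a..b} x * Re (iexp (- (s * U) * x) * \<phi> s) - indicator {a..b} x * Re (iexp (- (s * U) * x) * \<psi> s) \<partial>lborel)"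
          unfolding JM_def JD_def by (rule Bochner_Integration.integral_diff[symmetric]) (rule ii)+
        also have "\<dots> = (\<integral>x. Re ((indicator {a..b} x *\<^sub>R iexp (- (s * U) * x)) * (\<phi> s - \<psi> s)) \<partial>lborel)"
          by (intro Bochner_Integration.integral_cong refl) (simp add: algebra_simps)
        also have "\<dots> = Re ((\<integral>x. indicator {a..b} x *\<^sub>R iexp (- (s * U) * x) \<partial>lborel) * (\<phi> s - \<psi> s))"
        proof -
          have "integrable lborel (\<lambda>x. indicator {a..b} x *\<^sub>R iexp (- (s * U) * x))"
            by (rule borel_integrable_atLeastAtMost'[unfolded set_integrable_def]) (intro continuous_intros)
          hence "(\<integral>x. Re ((indicator {a..b} x *\<^sub>R iexp (- (s * U) * x)) * (\<phi> s - \<psi> s)) \<partial>lborel) =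
            Re (\<integral>x. (indicator {a..b} x *\<^sub>R iexp (- (s * U) * x)) * (\<phi> s - \<psi> s) \<partial>lborel)"
            by (intro integral_Re integrable_mult_left)
          thus ?thesis by (simp only: integral_mult_left_zero)
        qed
        finally have "\<bar>JM s - JD s\<bar> \<le> cmod ((\<integral>x. indicator {a..b} x *\<^sub>R iexp (- (s * U) * x) \<partial>lborel) * (\<phi> s - \<psi> s))"
          using abs_Re_le_cmod by presburger
        also have "\<dots> = cmod (\<integral>x. indicator {a..b} x *\<^sub>R iexp (- (s * U) * x) \<partial>lborel) * cmod (\<phi> s - \<psi> s)"
          by (rule norm_mult)
        also have "\<dots> \<le> 2 / (s * U) * (s * U * B (s * U))"
        proof (intro mult_mono norm_integral_iexp_le ab)
          show "cmod (\<phi> s - \<psi> s) \<le> s * U * B (s * U)"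
            using diff[of "s * U"] s U unfolding \<phi>_def \<psi>_def char_def by (simp add: mult_left_le_one_le)
        qed (use s U in auto)
        also have "\<dots> = 2 * B (s * U)" using s U by simp
        finally show ?thesis .
      qed
      let ?PM = "\<lambda>y. \<integral>z. (1::real) * indicator {a - y<..b - y} z \<partial>M"
      let ?PD = "\<lambda>y. \<integral>z. D z * indicator {a - y<..b - y} z \<partial>lborel"
      have iPD: "integrable lborel (\<lambda>y. fejer (U * y) * ?PD y)"
      proof (rule Bochner_Integration.integrable_bound)
        show "integrable lborel (\<lambda>y. fejer (U * y) * (2 * b0))" using iV by simp
        show "AE y in lborel. norm (fejer (U * y) * ?PD y) \<le> norm (fejer (U * y) * (2 * b0))"
        proof (rule AE_I2)
          fix y
          have "?PD y = G (b - y) - G (a - y)" using ab by (intro G_diff[symmetric]) auto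
          hence "\<bar>?PD y\<bar> \<le> 2 * b0" using b0[of "b - y"] b0[of "a - y"] by linarith
          thus "norm (fejer (U * y) * ?PD y) \<le> norm (fejer (U * y) * (2 * b0))"
            using V0 by (auto simp: abs_mult intro!: mult_left_mono)
        qed
        have "?PD y = G (b - y) - G (a - y)" for y using ab by (intro G_diff[symmetric]) auto
        thus "(\<lambda>y. fejer (U * y) * ?PD y) \<in> borel_measurable lborel" by simp
      qed
      have iPM: "integrable lborel (\<lambda>y. fejer (U * y) * ?PM y)"
      proof (rule Bochner_Integration.integrable_bound)
        show "integrable lborel (\<lambda>y. fejer (U * y))" using iV by simp
        have eq: "?PM y = cdf M (b - y) - cdf M (a - y)" for y using ab by (intro F_diff[symmetric]) auto
        show "AE y in lborel. norm (fejer (U * y) * ?PM y) \<le> norm (fejer (U * y))"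
        proof (rule AE_I2)
          fix y
          have "\<bar>?PM y\<bar> \<le> 1"
            unfolding eq using M.cdf_bounded_prob[of "b - y"] M.cdf_nonneg[of "b - y"]
              M.cdf_bounded_prob[of "a - y"] M.cdf_nonneg[of "a - y"] by linarith
          thus "norm (fejer (U * y) * ?PM y) \<le> norm (fejer (U * y))"
            using V0 by (auto simp: abs_mult intro!: mult_left_le)
        qed
        show "(\<lambda>y. fejer (U * y) * ?PM y) \<in> borel_measurable lborel" unfolding eq by measurable
      qed
      have "(\<integral>y. fejer (U * y) * (\<Delta> (b - y) - \<Delta> (a - y)) \<partial>lborel) =
        (\<integral>y. fejer (U * y) * ?PM y - fejer (U * y) * ?PD y \<partial>lborel)"
      proof (rule Bochner_Integration.integral_cong[OF refl])
        fix y
        have "\<Delta> (b - y) - \<Delta> (a - y) = ?PM y - ?PD y"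
          unfolding \<Delta>_def using F_diff[of "a - y" "b - y"] G_diff[of "a - y" "b - y"] ab by simp
        thus "fejer (U * y) * (\<Delta> (b - y) - \<Delta> (a - y)) = fejer (U * y) * ?PM y - fejer (U * y) * ?PD y"
          by (simp only: right_diff_distrib)
      qed
      also have "\<dots> = (\<integral>y. fejer (U * y) * ?PM y \<partial>lborel) - (\<integral>y. fejer (U * y) * ?PD y \<partial>lborel)"
        using iPM iPD by (rule Bochner_Integration.integral_diff)
      also have "(\<integral>y. fejer (U * y) * ?PM y \<partial>lborel) = (\<integral>s. indicator {0..1} s * (2 * (1 - s)) * JM s \<partial>lborel)"
        unfolding JM_def \<phi>_def
        by (rule fejer_convolution_eq) (auto simp: U intro: M.sigma_finite_measure_axioms)
      also have "(\<integral>y. fejer (U * y) * ?PD y \<partial>lborel) = (\<integral>s. indicator {0..1} s * (2 * (1 - s)) * JD s \<partial>lborel)"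
        unfolding JD_def \<psi>_def
        by (rule fejer_convolution_eq) (auto simp: U D intro: sigma_finite_lborel)
      finally have eq: "(\<integral>y. fejer (U * y) * (\<Delta> (b - y) - \<Delta> (a - y)) \<partial>lborel) =
        (\<integral>s. indicator {0..1} s * (2 * (1 - s)) * JM s \<partial>lborel) - (\<integral>s. indicator {0..1} s * (2 * (1 - s)) * JD s \<partial>lborel)" .
      have iJ: "integrable lborel (\<lambda>s. indicator {0..1} s * (2 * (1 - s)) * J s)"
        if [measurable]: "J \<in> borel_measurable borel" and Jb: "\<And>s. \<bar>J s\<bar> \<le> c" for J :: "real \<Rightarrow> real" and c
      proof (rule Bochner_Integration.integrable_bound)
        show "integrable lborel (\<lambda>s::real. indicator {0..1} s * (2 * c))"
          by (simp add: integrable_indicator_iff emeasure_lborel_Icc_eq)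
        have c: "c \<ge> 0" using Jb[of 0] by linarith
        show "AE s in lborel. norm (indicator {0..1} s * (2 * (1 - s)) * J s) \<le> norm (indicator {0..1} s * (2 * c))"
        proof (rule AE_I2)
          fix s :: real
          have "\<bar>1 - s\<bar> * \<bar>J s\<bar> \<le> 1 * c" if "s \<in> {0..1}"
            using that by (intro mult_mono Jb) auto
          thus "norm (indicator {0..1} s * (2 * (1 - s)) * J s) \<le> norm (indicator {0..1} s * (2 * c))"
            using c by (auto simp: indicator_def abs_mult mult.assoc mult.commute[of "\<bar>J s\<bar>"] simp del: right_diff_distrib_numeral)
        qed
      qed measurable
      have Jbound: "\<bar>\<integral>x. indicator {a..b} x * Re (iexp (- (s * U) * x) * q) \<partial>lborel\<bar> \<le> (b - a) * r"
        if "cmod q \<le> r" for q r s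
      proof -
        have "\<bar>\<integral>x. indicator {a..b} x * Re (iexp (- (s * U) * x) * q) \<partial>lborel\<bar> \<le> (\<integral>x. indicator {a..b} x * r \<partial>lborel)"
        proof (rule order_trans[OF integral_abs_bound integral_mono])
          show "integrable lborel (\<lambda>x. \<bar>indicator {a..b} x * Re (iexp (- (s * U) * x) * q)\<bar>)"
            using ii by (rule integrable_abs)
          show "integrable lborel (\<lambda>x. indicator {a..b} x * r)"
            by (simp add: integrable_indicator_iff emeasure_lborel_Icc_eq)
          fix x
          have "\<bar>Re (iexp (- (s * U) * x) * q)\<bar> \<le> cmod q"
            using abs_Re_le_cmod[of "iexp (- (s * U) * x) * q"] unfolding norm_mult norm_exp_i_times by simp
          thus "\<bar>indicator {a..b} x * Re (iexp (- (s * U) * x) * q)\<bar> \<le> indicator {a..b} x * r"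
            using that by (auto simp: indicator_def simp del: of_real_minus of_real_mult)
        qed
        thus ?thesis using ab by simp
      qed
      have iJM: "integrable lborel (\<lambda>s. indicator {0..1} s * (2 * (1 - s)) * JM s)"
      proof (rule iJ)
        show "JM \<in> borel_measurable borel"
          unfolding JM_def \<phi>_def by measurable
        have "cmod (\<phi> s) \<le> 1" for s
          using M.cmod_char_le_1[of "s * U"] unfolding \<phi>_def char_def by simp
        thus "\<bar>JM s\<bar> \<le> (b - a) * 1" for s unfolding JM_def by (rule Jbound)
      qed
      have iJD: "integrable lborel (\<lambda>s. indicator {0..1} s * (2 * (1 - s)) * JD s)"
      proof (rule iJ)
        show "JD \<in> borel_measurable borel"
          unfolding JD_def \<psi>_def by measurable
        have "cmod (\<psi> s) \<le> (\<integral>z. \<bar>D z\<bar> \<partial>lborel)" for s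
        proof -
          have "cmod (\<psi> s) \<le> (\<integral>z. norm (D z *\<^sub>R iexp (s * U * z)) \<partial>lborel)"
            unfolding \<psi>_def by (rule integral_norm_bound)
          thus ?thesis by (simp del: of_real_mult)
        qed
        thus "\<bar>JD s\<bar> \<le> (b - a) * (\<integral>z. \<bar>D z\<bar> \<partial>lborel)" for s unfolding JD_def by (rule Jbound)
      qed
      have "\<bar>(\<integral>s. indicator {0..1} s * (2 * (1 - s)) * JM s \<partial>lborel) - (\<integral>s. indicator {0..1} s * (2 * (1 - s)) * JD s \<partial>lborel)\<bar>
        = \<bar>\<integral>s. indicator {0..1} s * (2 * (1 - s)) * JM s - indicator {0..1} s * (2 * (1 - s)) * JD s \<partial>lborel\<bar>"
        using iJM iJD by (subst Bochner_Integration.integral_diff) auto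
      also have "\<dots> \<le> (\<integral>s. 4 * B (U * s) \<partial>lborel)"
      proof (rule order_trans[OF integral_abs_bound integral_mono_AE])
        show "integrable lborel (\<lambda>s. \<bar>indicator {0..1} s * (2 * (1 - s)) * JM s - indicator {0..1} s * (2 * (1 - s)) * JD s\<bar>)"
          using iJM iJD by (intro integrable_abs Bochner_Integration.integrable_diff)
        show "integrable lborel (\<lambda>s. 4 * B (U * s))"
          using lborel_integrable_real_affine[OF B(1), of U 0] U by simp
        show "AE s in lborel. \<bar>indicator {0..1} s * (2 * (1 - s)) * JM s - indicator {0..1} s * (2 * (1 - s)) * JD s\<bar> \<le> 4 * B (U * s)"
          using AE_lborel_singleton[of 0]
        proof eventually_elim
          case (elim s)
          show ?case
          proof (cases "s \<in> {0..1}")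
            case True
            with elim have s: "0 < s" "s \<le> 1" by auto
            have "\<bar>indicator {0..1} s * (2 * (1 - s)) * JM s - indicator {0..1} s * (2 * (1 - s)) * JD s\<bar> = 2 * (1 - s) * \<bar>JM s - JD s\<bar>"
              using True by (simp add: indicator_def abs_mult flip: right_diff_distrib)
            also have "\<dots> \<le> 2 * (2 * B (s * U))"
              using s J_le[OF s] by (intro mult_mono) auto
            finally show ?thesis by (simp add: mult.commute)
          qed (use B(2)[of "U * s"] in simp)
        qed
      qed
      also have "\<dots> = 4 / U * I"
        unfolding I_def using lborel_integral_real_affine[of U B 0] U by (simp add: field_simps)
      finally show ?thesis unfolding eq .
    qed
    have \<Delta>bot: "(\<Delta> \<longlongrightarrow> 0) at_bot"
      unfolding \<Delta>_def using tendsto_diff[OF M.cdf_lim_at_bot G0] by simp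
    \<comment> \<open>Letting a tend to -infinity, where \<Delta> vanishes, carries the bound over
      from increments to \<Delta> itself.\<close>
    have smooth: "\<bar>\<integral>y. fejer (U * y) * \<Delta> (b - y) \<partial>lborel\<bar> \<le> 4 / U * I" for b
    proof -
      let ?q = "\<lambda>x. \<integral>y. fejer (U * y) * \<Delta> (x - y) \<partial>lborel"
      have "(\<lambda>n. ?q (- real n)) \<longlonglongrightarrow> (\<integral>y. 0 \<partial>(lborel :: real measure))"
      proof (rule integral_dominated_convergence[where w = "\<lambda>y. fejer (U * y) * (1 + b0)"])
        show "AE y in lborel. (\<lambda>n. fejer (U * y) * \<Delta> (- real n - y)) \<longlonglongrightarrow> 0"
        proof (rule AE_I2)
          fix y
          have "filterlim (\<lambda>n. - real n - y) at_bot sequentially"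
            by real_asymp
          from filterlim_compose[OF \<Delta>bot this]
          show "(\<lambda>n. fejer (U * y) * \<Delta> (- real n - y)) \<longlonglongrightarrow> 0"
            by (rule tendsto_mult_right_zero)
        qed
        show "AE y in lborel. norm (fejer (U * y) * \<Delta> (- real n - y)) \<le> fejer (U * y) * (1 + b0)" for n
          using V0 by (intro AE_I2) (auto simp: abs_mult intro!: mult_left_mono \<Delta>b)
      qed (use iV in auto)
      hence lim: "(\<lambda>n. ?q (- real n)) \<longlonglongrightarrow> 0" by simp
      have "(\<lambda>n. \<bar>?q b - ?q (- real n)\<bar>) \<longlonglongrightarrow> \<bar>?q b - 0\<bar>"
        by (intro tendsto_intros lim)
      moreover have "eventually (\<lambda>n. \<bar>?q b - ?q (- real n)\<bar> \<le> 4 / U * I) sequentially"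
      proof -
        obtain N where N: "- b \<le> real N" using real_arch_simple by blast
        have "\<bar>?q b - ?q (- real n)\<bar> \<le> 4 / U * I" if "n \<ge> N" for n
        proof -
          have "- real n \<le> b" using N that by (simp add: minus_le_iff order_trans)
          from incr[OF this] show ?thesis
            using intV by (simp add: right_diff_distrib)
        qed
        thus ?thesis by (intro eventually_sequentiallyI[of N])
      qed
      ultimately have "\<bar>?q b - 0\<bar> \<le> 4 / U * I"
        by (intro tendsto_upperbound[where F = sequentially]) auto
      thus ?thesis by simp
    qed
    define \<eta> where "\<eta> = (SUP x. \<bar>\<Delta> x\<bar>)"
    have bdd: "bdd_above (range (\<lambda>x. \<bar>\<Delta> x\<bar>))" using \<Delta>b by (intro bdd_aboveI[of _ "1 + b0"]) auto
    have \<eta>: "\<bar>\<Delta> x\<bar> \<le> \<eta>" for x unfolding \<eta>_def by (rule cSUP_upper[OF _ bdd]) auto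
    have main: "\<eta> \<le> C * (I + K / U)"
    proof (cases "\<eta> \<le> 0")
      case True
      moreover have "0 \<le> C * (I + K / U)" using C I0 K U by simp
      ultimately show ?thesis by linarith
    next
      case False
      hence \<eta>0: "\<eta> > 0" by simp
      \<comment> \<open>Over a distance 2 \<delta> the Lipschitz part changes by at most 2/5 \<eta>,
        and 9/10 - 2/5 = 1/2.\<close>
      define \<delta> where "\<delta> = \<eta> / (5 * K)"
      have \<delta>: "\<delta> > 0" using \<eta>0 K by (simp add: \<delta>_def)
      have "9/10 * \<eta> < (SUP x. \<bar>\<Delta> x\<bar>)" using \<eta>0 unfolding \<eta>_def[symmetric] by simp
      hence "\<exists>x\<in>UNIV. 9/10 * \<eta> < \<bar>\<Delta> x\<bar>"
        by (rule less_cSUP_iff[OF UNIV_not_empty bdd, THEN iffD1])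
      then obtain x0 where x0: "9/10 * \<eta> < \<bar>\<Delta> x0\<bar>" by blast
      show ?thesis
      proof (cases "U * \<delta> < R")
        case True
        hence "\<eta> < 5 * K * R / U" using U K by (simp add: \<delta>_def field_simps)
        also have "\<dots> = 5 * R * (K / U)" by simp
        also have "\<dots> \<le> C * (I + K / U)"
          using R c0 I0 K U by (intro mult_mono) (auto simp: C_def)
        finally show ?thesis by simp
      next
        case False
        hence UR: "U * \<delta> \<ge> R" by simp
        have lip: "\<bar>G y - G x\<bar> \<le> K * (y - x)" if "x \<le> y" for x y
        proof -
          have "\<exists>z. G y - G x = (y - x) * D z" if "x < y"
            using MVT2[OF that, of G D] G by blast
          hence "\<exists>z. G y - G x = (y - x) * D z" using that by (cases "x = y") auto
          then obtain z where "G y - G x = (y - x) * D z" by blast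
          thus ?thesis using K(2)[of z] that by (auto simp: abs_mult mult.commute intro!: mult_right_mono)
        qed
        have lipD: "\<Delta> x - K * (y - x) \<le> \<Delta> y" if "x \<le> y" for x y
          using lip[OF that] M.cdf_nondecreasing[OF that] unfolding \<Delta>_def by linarith
        have K\<delta>: "K * (2 * \<delta>) = 2/5 * \<eta>" using K by (simp add: \<delta>_def)
        have Kle: "K * d \<le> 2/5 * \<eta>" if "d \<le> 2 * \<delta>" for d
          using mult_left_mono[OF that, of K] K K\<delta> by simp
        \<comment> \<open>Monotonicity of F controls \<Delta> from below to the right of
          \<open>x0\<close> and from above to its left, so the interval of radius \<delta> is
          centred at \<open>x0\<close> + \<delta> for a positive value and at \<open>x0\<close> -
          \<delta> otherwise.\<close>
        obtain \<sigma> c :: real where \<sigma>: "\<sigma> = 1 \<or> \<sigma> = -1"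
          and big: "\<And>y. \<bar>y\<bar> \<le> \<delta> \<Longrightarrow> \<eta> / 2 \<le> \<sigma> * \<Delta> (c - y)"
        proof (cases "\<Delta> x0 > 0")
          case True
          have "\<eta> / 2 \<le> 1 * \<Delta> (x0 + \<delta> - y)" if "\<bar>y\<bar> \<le> \<delta>" for y
            using lipD[of x0 "x0 + \<delta> - y"] Kle[of "\<delta> - y"] x0 True that by (auto simp: abs_le_iff)
          thus ?thesis using that[of 1 "x0 + \<delta>"] by blast
        next
          case False
          have "\<eta> / 2 \<le> (-1) * \<Delta> (x0 - \<delta> - y)" if "\<bar>y\<bar> \<le> \<delta>" for y
            using lipD[of "x0 - \<delta> - y" x0] Kle[of "\<delta> + y"] x0 False that by (auto simp: abs_le_iff)
          thus ?thesis using that[of "-1" "x0 - \<delta>"] by blast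
        qed
        let ?T = "\<integral>y. indicator {y. \<bar>y\<bar> > \<delta>} y * fejer (U * y) \<partial>lborel"
        have iT: "integrable lborel (\<lambda>y. indicator {y. \<bar>y\<bar> > \<delta>} y * fejer (U * y))"
          by (rule Bochner_Integration.integrable_bound[OF iV]) (auto simp: indicator_def)
        have iVv: "(\<integral>y. fejer (U * y) \<partial>lborel) = c0 / U"
          unfolding c0_def using lborel_integral_real_affine[of U fejer 0] U by (simp add: field_simps)
        have "(\<integral>y. indicator {y. \<bar>y\<bar> > U * \<delta>} y * fejer y \<partial>lborel) = U * ?T"
          using lborel_integral_real_affine[of U "\<lambda>y. indicator {y. \<bar>y\<bar> > U * \<delta>} y * fejer y" 0] U
          by (simp add: indicator_def abs_mult)
        with R(2)[OF UR] U have T: "?T \<le> c0 / U / 6" by (simp add: field_simps)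
        \<comment> \<open>The lower bounds \<eta>/2 for |y| \<le> \<delta> and -\<eta> elsewhere are
          combined into \<eta>/2 minus 3/2 \<eta> times the indicator of the tail.\<close>
        have "\<eta> / 2 * (c0 / U) - 3/2 * \<eta> * ?T = (\<integral>y. \<eta> / 2 * fejer (U * y) - 3/2 * \<eta> * (indicator {y. \<bar>y\<bar> > \<delta>} y * fejer (U * y)) \<partial>lborel)"
          using iV iT iVv by (subst Bochner_Integration.integral_diff) auto
        also have "\<dots> \<le> (\<integral>y. \<sigma> * (fejer (U * y) * \<Delta> (c - y)) \<partial>lborel)"
        proof (rule integral_mono)
          fix y
          have "\<eta> / 2 - 3/2 * \<eta> * indicator {y. \<bar>y\<bar> > \<delta>} y \<le> \<sigma> * \<Delta> (c - y)"
          proof (cases "\<bar>y\<bar> \<le> \<delta>")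
            case False
            thus ?thesis using \<eta>[of "c - y"] \<sigma> by (auto simp: indicator_def abs_le_iff)
          qed (use big in \<open>auto simp: indicator_def\<close>)
          from mult_right_mono[OF this V0[of y]]
          show "\<eta> / 2 * fejer (U * y) - 3/2 * \<eta> * (indicator {y. \<bar>y\<bar> > \<delta>} y * fejer (U * y)) \<le> \<sigma> * (fejer (U * y) * \<Delta> (c - y))"
            by (simp add: algebra_simps)
        qed (use iV iT intV in auto)
        also have "\<dots> \<le> \<bar>\<integral>y. fejer (U * y) * \<Delta> (c - y) \<partial>lborel\<bar>"
          using \<sigma> by auto
        also have "\<dots> \<le> 4 / U * I" by (rule smooth)
        finally have "\<eta> / 2 * (c0 / U) - 3/2 * \<eta> * ?T \<le> 4 / U * I" .
        moreover have "3/2 * \<eta> * ?T \<le> 3/2 * \<eta> * (c0 / U / 6)"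
          using \<eta>0 T by (intro mult_left_mono) auto
        ultimately have "\<eta> * (c0 / U) / 4 \<le> 4 / U * I" by (simp add: field_simps)
        hence "\<eta> \<le> 16 / c0 * I" using c0 U by (simp add: field_simps)
        also have "\<dots> \<le> C * (I + K / U)"
          using R c0 I0 K U by (intro mult_mono) (auto simp: C_def)
        finally show ?thesis .
      qed
    qed
    show ?thesis using order_trans[OF \<eta>[of x] main] by (simp add: \<Delta>_def I_def)
  qed
  note bound = this
  show thesis by (rule that[OF C]) (rule bound)
qed

section \<open>Derivatives of the normal distribution function\<close>

lemma set_integral_std_normal_eq_integral:
  "(\<integral>y. indicator {a..b} y * std_normal_density y \<partial>lborel) = integral {a..b} std_normal_density"
proof -
  have "set_integrable lborel {a..b} std_normal_density"
    by (intro borel_integrable_atLeastAtMost') (auto simp: normal_density_def intro!: continuous_intros)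
  from set_borel_integral_eq_integral(2)[OF this] show ?thesis
    by (simp add: set_lebesgue_integral_def)
qed

lemma Phi_diff:
  assumes "a \<le> b"
  shows "Phi b = Phi a + integral {a..b} std_normal_density"
proof -
  have int: "integrable lborel (\<lambda>y. indicator A y * std_normal_density y)" if "A \<in> sets borel" for A
    using integrable_real_mult_indicator[of A lborel std_normal_density] that
    by (simp add: mult.commute)
  have "Phi b = (\<integral>y. indicator {..a} y * std_normal_density y + indicator {a..b} y * std_normal_density y \<partial>lborel)"
    unfolding Phi_def
  proof (rule integral_cong_AE)
    show "AE y in lborel. indicator {..b} y * std_normal_density y =
      indicator {..a} y * std_normal_density y + indicator {a..b} y * std_normal_density y"
      using AE_lborel_singleton[of a] by eventually_elim (use assms in \<open>auto simp: indicator_def\<close>)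
  qed measurable
  also have "\<dots> = Phi a + integral {a..b} std_normal_density"
    using int by (subst Bochner_Integration.integral_add) (auto simp: Phi_def set_integral_std_normal_eq_integral)
  finally show ?thesis .
qed

text \<open>Cutting at x - 1 makes \<open>Phi\<close> near x a constant plus an integral over a
  compact interval, to which the fundamental theorem of calculus applies.\<close>

lemma Phi_has_real_derivative: "(Phi has_real_derivative std_normal_density x) (at x)"
proof -
  let ?I = "\<lambda>u. Phi (x - 1) + integral {x - 1..u} std_normal_density"
  have "((\<lambda>u. integral {x - 1..u} std_normal_density) has_real_derivative std_normal_density x) (at x within {x - 1..x + 1})"
    by (rule integral_has_real_derivative) (auto simp: normal_density_def intro!: continuous_intros)
  hence "((\<lambda>u. integral {x - 1..u} std_normal_density) has_real_derivative std_normal_density x) (at x)"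
    by (subst (asm) at_within_Icc_at) auto
  hence "(?I has_real_derivative std_normal_density x) (at x)"
    by (auto intro!: derivative_eq_intros)
  moreover have "eventually (\<lambda>u. ?I u = Phi u) (nhds x)"
    by (rule eventually_mono[OF eventually_nhds_in_open[of "{x - 1<..}"]]) (auto intro: Phi_diff[symmetric])
  ultimately show ?thesis
    by (subst (asm) DERIV_cong_ev[OF refl _ refl]) auto
qed

lemma Phi_bounds: "0 \<le> Phi x" "Phi x \<le> 1"
proof -
  show "0 \<le> Phi x" unfolding Phi_def by (intro Bochner_Integration.integral_nonneg) auto
  have "Phi x \<le> (\<integral>y. std_normal_density y \<partial>lborel)"
    unfolding Phi_def
    by (rule integral_mono_AE') (auto simp: indicator_def)
  thus "Phi x \<le> 1" by simp
qed

lemma Phi_at_bot: "(Phi \<longlongrightarrow> 0) at_bot"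
proof -
  interpret N: real_distribution std_normal_distribution by (rule real_dist_normal_dist)
  have "cdf std_normal_distribution x = Phi x" for x
  proof -
    have "cdf std_normal_distribution x = (\<integral>y. indicator {..x} y \<partial>std_normal_distribution)"
      by (simp add: cdf_def)
    also have "\<dots> = Phi x"
      unfolding Phi_def by (subst integral_density) (auto simp: mult.commute)
    finally show ?thesis .
  qed
  hence "cdf std_normal_distribution = Phi" by (rule ext)
  with N.cdf_lim_at_bot show ?thesis by simp
qed

text \<open>Up to the sign (-1)^j these are the probabilists' Hermite polynomials; the recursion is
  the product rule for a polynomial times exp(-x^2/2), so that \<open>dnormal j\<close> is the j-th
  derivative of the normal density.\<close>

fun herm :: "nat \<Rightarrow> real poly" where
  "herm 0 = 1"
| "herm (Suc j) = pderiv (herm j) - [:0, 1:] * herm j"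

definition dnormal :: "nat \<Rightarrow> real \<Rightarrow> real" where
  "dnormal j x = poly (herm j) x * std_normal_density x"

lemma std_normal_density_has_derivative:
  "(std_normal_density has_real_derivative (- x * std_normal_density x)) (at x)"
  unfolding normal_density_def by (auto intro!: derivative_eq_intros simp: field_simps)

lemma dnormal_0: "dnormal 0 = std_normal_density"
  by (simp add: dnormal_def fun_eq_iff)

lemma dnormal_has_derivative: "(dnormal j has_real_derivative dnormal (Suc j) x) (at x)"
  unfolding dnormal_def[abs_def]
  by (auto intro!: derivative_eq_intros std_normal_density_has_derivative poly_DERIV simp: algebra_simps)

lemma continuous_dnormal: "continuous_on A (dnormal j)"
  using dnormal_has_derivative
  by (intro DERIV_continuous_on[of _ _ "dnormal (Suc j)"]) (auto intro: has_field_derivative_at_within)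

lemma dnormal_measurable[measurable]: "dnormal j \<in> borel_measurable borel"
  by (intro borel_measurable_continuous_onI continuous_dnormal)

lemma deriv_Phi: "(deriv ^^ (j + 1)) Phi = dnormal j"
proof (induction j)
  case 0
  have "deriv Phi x = dnormal 0 x" for x
    using DERIV_imp_deriv[OF Phi_has_real_derivative] by (simp add: dnormal_0)
  thus ?case by (simp add: fun_eq_iff)
next
  case (Suc j)
  have "(deriv ^^ (Suc j + 1)) Phi = deriv ((deriv ^^ (j + 1)) Phi)" by simp
  also have "\<dots> = deriv (dnormal j)" by (simp only: Suc.IH)
  also have "\<dots> = dnormal (Suc j)"
    by (rule ext) (rule DERIV_imp_deriv[OF dnormal_has_derivative])
  finally show ?case .
qed

text \<open>The power x ^ r makes the induction on q possible, since passing from q to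
  \<open>pCons a q\<close> shifts r by one. Taken with r = 1 the bound also yields the decay C/|x|
  of \<open>dnormal j\<close>.\<close>

lemma poly_normal_bounded: "\<exists>C. \<forall>x::real. \<bar>x ^ r * poly q x * std_normal_density x\<bar> \<le> C"
proof (induction q arbitrary: r)
  case 0
  show ?case by (intro exI[of _ 0]) simp
next
  case (pCons a q)
  obtain C where C: "\<And>x::real. \<bar>x ^ Suc r * poly q x * std_normal_density x\<bar> \<le> C"
    using pCons.IH[of "Suc r"] by blast
  have 1: "\<bar>x ^ r * a * std_normal_density x\<bar> \<le> fact r * exp 1 * \<bar>a\<bar>" for x
  proof -
    have "\<bar>x\<bar> ^ r / fact r \<le> exp \<bar>x\<bar>"
    proof -
      have "(\<Sum>n\<in>{r}. \<bar>x\<bar> ^ n /\<^sub>R fact n) \<le> exp \<bar>x\<bar>"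
        unfolding exp_def by (rule sum_le_suminf) (use summable_exp[of "\<bar>x\<bar>"] in \<open>auto simp: divide_inverse mult.commute\<close>)
      thus ?thesis by (simp add: field_simps)
    qed
    hence p: "\<bar>x\<bar> ^ r \<le> fact r * exp \<bar>x\<bar>" by (simp add: field_simps)
    have "\<bar>x\<bar> - x\<^sup>2 / 2 \<le> 1"
    proof -
      have "0 \<le> (\<bar>x\<bar> - 1)^2" by simp
      thus ?thesis by (simp add: power2_diff)
    qed
    hence e: "exp \<bar>x\<bar> * exp (- x\<^sup>2 / 2) \<le> exp 1" by (simp flip: exp_add)
    have n: "std_normal_density x \<le> exp (- x\<^sup>2 / 2)"
    proof -
      have "1 / sqrt (2 * pi) \<le> 1" using pi_gt3 by (simp add: divide_simps real_le_rsqrt)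
      thus ?thesis by (simp add: normal_density_def mult_left_le_one_le divide_le_eq)
    qed
    have "\<bar>x\<bar> ^ r * std_normal_density x \<le> (fact r * exp \<bar>x\<bar>) * exp (- x\<^sup>2 / 2)"
      by (intro mult_mono p n) auto
    also have "\<dots> \<le> fact r * exp 1" using e by (simp add: mult.assoc mult_left_mono)
    finally have "\<bar>x\<bar> ^ r * std_normal_density x * \<bar>a\<bar> \<le> fact r * exp 1 * \<bar>a\<bar>"
      by (intro mult_right_mono) auto
    thus ?thesis by (simp add: abs_mult power_abs mult.commute mult.left_commute)
  qed
  show ?case
  proof (intro exI[of _ "fact r * exp 1 * \<bar>a\<bar> + C"] allI)
    fix x :: real
    have "x ^ r * poly (pCons a q) x * std_normal_density x =
      x ^ r * a * std_normal_density x + x ^ Suc r * poly q x * std_normal_density x"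
      by (simp add: algebra_simps)
    thus "\<bar>x ^ r * poly (pCons a q) x * std_normal_density x\<bar> \<le> fact r * exp 1 * \<bar>a\<bar> + C"
      using 1[of x] C[of x] by linarith
  qed
qed

lemma dnormal_bounded: "\<exists>C. \<forall>x. \<bar>dnormal j x\<bar> \<le> C"
  using poly_normal_bounded[of 0 "herm j"] by (simp add: dnormal_def)

lemma dnormal_tendsto_0: "(dnormal j \<longlongrightarrow> 0) at_infinity"
proof -
  obtain C where C: "\<And>x::real. \<bar>x ^ 1 * poly (herm j) x * std_normal_density x\<bar> \<le> C"
    using poly_normal_bounded[of 1 "herm j"] by blast
  have le: "\<bar>dnormal j x\<bar> \<le> C / \<bar>x\<bar>" if "x \<noteq> 0" for x
    using C[of x] that by (simp add: dnormal_def abs_mult field_simps)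
  have "((\<lambda>x::real. C / \<bar>x\<bar>) \<longlongrightarrow> 0) at_infinity"
  proof (intro tendsto_divide_0[OF tendsto_const] filterlim_at_top_imp_at_infinity)
    have "norm = (abs :: real \<Rightarrow> real)" by (rule ext) simp
    with filterlim_norm_at_top[where 'a = real] show "filterlim (abs :: real \<Rightarrow> real) at_top at_infinity"
      by simp
  qed
  thus ?thesis
    by (rule Lim_null_comparison[rotated])
      (use le in \<open>auto intro!: eventually_mono[OF eventually_not_equal_at_infinity[of 0]]\<close>)
qed

lemma dnormal_integrable: "integrable lborel (dnormal j)"
proof -
  have "integrable lborel (\<lambda>x. x ^ r * poly q x * std_normal_density x)" for r and q :: "real poly"
  proof (induction q arbitrary: r)
    case (pCons a q)
    have "integrable lborel (\<lambda>x. a * (std_normal_density x * x ^ r) + x ^ Suc r * poly q x * std_normal_density x)"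
      by (intro Bochner_Integration.integrable_add integrable_mult_right integrable_std_normal_moment pCons.IH)
    thus ?case by (simp add: algebra_simps)
  qed simp
  from this[of 0] show ?thesis by (simp add: dnormal_def[abs_def])
qed

text \<open>Integration by parts, carried out on the whole line: the derivative of
  \<open>dnormal j\<close> times the exponential integrates to 0 because the product vanishes at
  both ends.\<close>

lemma dnormal_fourier:
  "(\<integral>x. dnormal j x *\<^sub>R iexp (t * x) \<partial>lborel) = (- \<i> * t) ^ j * exp (- t\<^sup>2 / 2)"
proof (induction j)
  case 0
  have "char std_normal_distribution t = (\<integral>x. std_normal_density x *\<^sub>R iexp (t * x) \<partial>lborel)"
    unfolding char_def by (subst integral_density) auto
  thus ?case by (simp add: dnormal_0 char_std_normal_distribution)
next
  case (Suc j)
  let ?F = "\<lambda>x. dnormal j x *\<^sub>R iexp (t * x)"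
  let ?f = "\<lambda>x. dnormal (Suc j) x *\<^sub>R iexp (t * x) + (\<i> * t) * (dnormal j x *\<^sub>R iexp (t * x))"
  have int: "integrable lborel (\<lambda>x. dnormal j x *\<^sub>R iexp (t * x))" for j
    by (rule Bochner_Integration.integrable_bound[OF dnormal_integrable[of j]]) auto
  have F0: "(?F \<longlongrightarrow> 0) at_infinity"
    by (rule Lim_null_comparison[OF _ tendsto_norm_zero[OF dnormal_tendsto_0[of j]]]) auto
  have "(LBINT x=-\<infinity>..\<infinity>. ?f x) = 0 - 0"
  proof (rule interval_integral_FTC_integrable)
    fix x :: real
    have "((\<lambda>x. iexp (t * x)) has_vector_derivative (\<i> * t) * iexp (t * x)) (at x)"
      unfolding of_real_mult
      by (rule has_vector_derivative_real_field) (auto intro!: derivative_eq_intros)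
    from has_vector_derivative_scaleR[OF dnormal_has_derivative[of j x] this]
    show "(?F has_vector_derivative ?f x) (at x)" by (simp add: algebra_simps)
    show "isCont ?f x"
      using continuous_dnormal[of UNIV] by (auto intro!: continuous_intros simp: continuous_on_eq_continuous_at)
    show "((?F \<circ> real_of_ereal) \<longlongrightarrow> 0) (at_right (- \<infinity>))"
      unfolding comp_def[symmetric] ereal_tendsto_simps
      by (rule filterlim_mono[OF F0]) (auto simp: at_bot_le_at_infinity)
    show "((?F \<circ> real_of_ereal) \<longlongrightarrow> 0) (at_left \<infinity>)"
      unfolding ereal_tendsto_simps
      by (rule filterlim_mono[OF F0]) (auto simp: at_top_le_at_infinity)
    have "integrable lborel ?f"
      by (intro Bochner_Integration.integrable_add integrable_mult_right int)
    thus "set_integrable lborel (einterval (-\<infinity>) \<infinity>) ?f"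
      unfolding set_integrable_def einterval_eq indicator_UNIV scaleR_one .
  qed simp
  hence "(\<integral>x. ?f x \<partial>lborel) = 0"
    by (simp add: interval_lebesgue_integral_def set_lebesgue_integral_def)
  hence "(\<integral>x. dnormal (Suc j) x *\<^sub>R iexp (t * x) \<partial>lborel) + (\<i> * t) * (\<integral>x. dnormal j x *\<^sub>R iexp (t * x) \<partial>lborel) = 0"
  proof -
    have "(\<integral>x. ?f x \<partial>lborel) = (\<integral>x. dnormal (Suc j) x *\<^sub>R iexp (t * x) \<partial>lborel) + (\<integral>x. (\<i> * t) * (dnormal j x *\<^sub>R iexp (t * x)) \<partial>lborel)"
      by (intro Bochner_Integration.integral_add integrable_mult_right int)
    also have "(\<integral>x. (\<i> * t) * (dnormal j x *\<^sub>R iexp (t * x)) \<partial>lborel) = (\<i> * t) * (\<integral>x. dnormal j x *\<^sub>R iexp (t * x) \<partial>lborel)"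
      by (rule integral_mult_right_zero)
    finally show ?thesis using \<open>(\<integral>x. ?f x \<partial>lborel) = 0\<close> by simp
  qed
  with Suc show ?case by (simp add: algebra_simps eq_neg_iff_add_eq_0)
qed

section \<open>The derivative of N_p: its Fourier transform and bounds uniform in the
  coefficients\<close>

definition edgeworth_density :: "(nat \<Rightarrow> real) \<Rightarrow> nat \<Rightarrow> real \<Rightarrow> real" where
  "edgeworth_density \<kappa> p x = dnormal 0 x + (\<Sum>j=1..p. (-1) ^ (j + 1) * \<kappa> j * dnormal (j + 1) x)"

text \<open>The alternating signs in N_p cancel those of the powers of -it in
  \<open>dnormal_fourier\<close>, leaving powers of it with the plain coefficients \<kappa>.\<close>

lemma edgeworth_density_fourier:
  "(\<integral>x. edgeworth_density \<kappa> p x *\<^sub>R iexp (t * x) \<partial>lborel) =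
    complex_of_real (exp (- t\<^sup>2 / 2)) * (1 + (\<Sum>j=1..p. \<kappa> j * (\<i> * t) ^ (j + 1)))"
proof -
  have int: "integrable lborel (\<lambda>x. dnormal j x *\<^sub>R iexp (t * x))" for j
    by (rule Bochner_Integration.integrable_bound[OF dnormal_integrable[of j]]) auto
  have "(\<integral>x. edgeworth_density \<kappa> p x *\<^sub>R iexp (t * x) \<partial>lborel) =
    (\<integral>x. dnormal 0 x *\<^sub>R iexp (t * x) + (\<Sum>j=1..p. ((-1) ^ (j + 1) * \<kappa> j) *\<^sub>R (dnormal (j + 1) x *\<^sub>R iexp (t * x))) \<partial>lborel)"
    by (simp add: edgeworth_density_def scaleR_add_left scaleR_sum_left)
  also have "\<dots> = (- \<i> * t) ^ 0 * exp (- t\<^sup>2 / 2) + (\<Sum>j=1..p. ((-1) ^ (j + 1) * \<kappa> j) *\<^sub>R ((- \<i> * t) ^ (j + 1) * exp (- t\<^sup>2 / 2)))"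
  proof -
    let ?g = "\<lambda>j x. ((-1) ^ (j + 1) * \<kappa> j) *\<^sub>R (dnormal (j + 1) x *\<^sub>R iexp (t * x))"
    have ig: "integrable lborel (?g j)" for j by (intro integrable_scaleR_right int)
    have "(\<integral>x. dnormal 0 x *\<^sub>R iexp (t * x) + (\<Sum>j=1..p. ?g j x) \<partial>lborel) =
      (\<integral>x. dnormal 0 x *\<^sub>R iexp (t * x) \<partial>lborel) + (\<integral>x. (\<Sum>j=1..p. ?g j x) \<partial>lborel)"
      by (intro Bochner_Integration.integral_add int Bochner_Integration.integrable_sum ig)
    also have "(\<integral>x. (\<Sum>j=1..p. ?g j x) \<partial>lborel) = (\<Sum>j=1..p. \<integral>x. ?g j x \<partial>lborel)"
      by (intro Bochner_Integration.integral_sum ig)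
    finally show ?thesis by (simp only: integral_scaleR_right dnormal_fourier)
  qed
  also have "(\<Sum>j=1..p. ((-1) ^ (j + 1) * \<kappa> j) *\<^sub>R ((- \<i> * t) ^ (j + 1) * exp (- t\<^sup>2 / 2))) =
    (\<Sum>j=1..p. exp (- t\<^sup>2 / 2) * (\<kappa> j * (\<i> * t) ^ (j + 1)))"
  proof (rule sum.cong[OF refl])
    fix j
    have "(- \<i> * t) ^ (j + 1) = (-1) ^ (j + 1) * (\<i> * t) ^ (j + 1)"
      by (simp flip: power_mult_distrib)
    hence "((-1) ^ (j + 1) * \<kappa> j) *\<^sub>R ((- \<i> * t) ^ (j + 1) * exp (- t\<^sup>2 / 2)) =
      ((-1) ^ (j + 1) * (-1) ^ (j + 1)) * (complex_of_real (exp (- t\<^sup>2 / 2)) * (\<kappa> j * (\<i> * t) ^ (j + 1)))"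
      by (simp only: scaleR_conv_of_real of_real_mult of_real_power of_real_minus of_real_1 ac_simps)
    also have "(-1::complex) ^ (j + 1) * (-1) ^ (j + 1) = 1"
      by (simp flip: power_mult_distrib)
    finally show "((-1) ^ (j + 1) * \<kappa> j) *\<^sub>R ((- \<i> * t) ^ (j + 1) * exp (- t\<^sup>2 / 2)) =
      complex_of_real (exp (- t\<^sup>2 / 2)) * (\<kappa> j * (\<i> * t) ^ (j + 1))"
      by (simp only: mult_1_left)
  qed
  finally show ?thesis by (simp add: distrib_left sum_distrib_left)
qed

text \<open>The constant is chosen before \<kappa>: the coefficients depend on n and on the
  distribution, whereas the Lipschitz constant in the smoothing inequality must not.\<close>

lemma edgeworth_density_bounded:
  "\<exists>c>0. \<forall>\<kappa>. \<forall>x. \<bar>edgeworth_density \<kappa> p x\<bar> \<le> c * (1 + (\<Sum>j=1..p. \<bar>\<kappa> j\<bar>))"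
proof -
  have "\<forall>j. \<exists>C. \<forall>x. \<bar>dnormal j x\<bar> \<le> C" using dnormal_bounded by blast
  then obtain C where C: "\<And>j x. \<bar>dnormal j x\<bar> \<le> C j" by metis
  have C0: "0 \<le> C j" for j using C[of j 0] by linarith
  define c where "c = 1 + (\<Sum>j\<le>p+1. C j)"
  have Cc: "C j \<le> c" if "j \<le> p + 1" for j
  proof -
    have "C j \<le> (\<Sum>j\<le>p+1. C j)" using that C0 by (intro member_le_sum) auto
    thus ?thesis by (simp add: c_def)
  qed
  have "c > 0" unfolding c_def using C0 by (intro add_pos_nonneg sum_nonneg) auto
  moreover have "\<bar>edgeworth_density \<kappa> p x\<bar> \<le> c * (1 + (\<Sum>j=1..p. \<bar>\<kappa> j\<bar>))" for \<kappa> x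
  proof -
    have "\<bar>edgeworth_density \<kappa> p x\<bar> \<le> \<bar>dnormal 0 x\<bar> + (\<Sum>j=1..p. \<bar>(-1) ^ (j + 1) * \<kappa> j * dnormal (j + 1) x\<bar>)"
      unfolding edgeworth_density_def by (rule order_trans[OF abs_triangle_ineq add_left_mono[OF sum_abs]])
    also have "\<dots> \<le> c + (\<Sum>j=1..p. \<bar>\<kappa> j\<bar> * c)"
      by (intro add_mono sum_mono)
        (auto simp: abs_mult power_abs intro!: mult_left_mono order_trans[OF C Cc])
    finally show ?thesis by (simp add: algebra_simps sum_distrib_left)
  qed
  ultimately show ?thesis by blast
qed

text \<open>The counterpart for N_p itself; it settles the case \<beta> + \<gamma> > 1 and gives the
  boundedness required by the smoothing inequality.\<close>

lemma edgeworth_bounded: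
  "\<exists>c>0. \<forall>\<kappa>. \<forall>x. \<bar>Phi x + (\<Sum>j=1..p. (-1) ^ (j + 1) * \<kappa> j * dnormal j x)\<bar> \<le> c * (1 + (\<Sum>j=1..p. \<bar>\<kappa> j\<bar>))"
proof -
  have "\<forall>j. \<exists>C. \<forall>x. \<bar>dnormal j x\<bar> \<le> C" using dnormal_bounded by blast
  then obtain C where C: "\<And>j x. \<bar>dnormal j x\<bar> \<le> C j" by metis
  have C0: "0 \<le> C j" for j using C[of j 0] by linarith
  define c where "c = 1 + (\<Sum>j\<le>p. C j)"
  have Cc: "C j \<le> c" if "j \<le> p" for j
  proof -
    have "C j \<le> (\<Sum>j\<le>p. C j)" using that C0 by (intro member_le_sum) auto
    thus ?thesis by (simp add: c_def)
  qed
  have c1: "c \<ge> 1" unfolding c_def using C0 by (simp add: sum_nonneg)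
  moreover have "\<bar>Phi x + (\<Sum>j=1..p. (-1) ^ (j + 1) * \<kappa> j * dnormal j x)\<bar> \<le> c * (1 + (\<Sum>j=1..p. \<bar>\<kappa> j\<bar>))" for \<kappa> x
  proof -
    have "\<bar>Phi x + (\<Sum>j=1..p. (-1) ^ (j + 1) * \<kappa> j * dnormal j x)\<bar> \<le> \<bar>Phi x\<bar> + (\<Sum>j=1..p. \<bar>(-1) ^ (j + 1) * \<kappa> j * dnormal j x\<bar>)"
      by (rule order_trans[OF abs_triangle_ineq add_left_mono[OF sum_abs]])
    also have "\<dots> \<le> c + (\<Sum>j=1..p. \<bar>\<kappa> j\<bar> * c)"
      using c1 Phi_bounds[of x] by (intro add_mono sum_mono)
        (auto simp: abs_mult power_abs intro!: mult_left_mono order_trans[OF C Cc])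
    finally show ?thesis by (simp add: algebra_simps sum_distrib_left)
  qed
  ultimately show ?thesis by (intro exI[of _ c]) auto
qed

section \<open>U-statistics\<close>

text \<open>The inner integral u over coordinate 0 is a function of the conditioning coordinates.
  Its integral over every measurable set B of them equals that of the conditional expectation over
  the cylinder above B, hence is 0, and so u vanishes almost everywhere.\<close>

lemma (in iid_product) degenerate_AE_coordinate_0:
  fixes f :: "(nat \<Rightarrow> 'a) \<Rightarrow> real"
  assumes j: "1 \<le> j" and f: "integrable (iid {..<j}) f"
    and deg: "AE x in iid {..<j}. real_cond_exp (iid {..<j})
          (vimage_algebra (space (iid {..<j})) (\<lambda>x. restrict x {1..<j}) (iid {1..<j})) f x = 0"
  shows "AE w in iid {..<j}. has_bochner_integral M (\<lambda>x. f (w(0 := x))) 0"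
proof -
  let ?J = "{1..<j}" and ?N = "iid {1..<j}" and ?P = "iid {..<j}"
  let ?F = "vimage_algebra (space ?P) (\<lambda>x. restrict x ?J) ?N"
  have J: "finite ?J" "0 \<notin> ?J" "{..<j} = insert 0 ?J" using j by auto
  have [measurable]: "f \<in> borel_measurable ?P" using f by auto
  have fm: "f \<in> borel_measurable (iid (insert 0 ?J))" unfolding J(3)[symmetric] by measurable
  have rm: "(\<lambda>x. restrict x ?J) \<in> measurable ?P ?N"
    by (intro measurable_restrict_subset) auto
  interpret N: prob_space ?N by (rule prob_space_iid)
  interpret P: prob_space ?P by (rule prob_space_iid)
  have sub: "subalgebra ?P ?F"
    unfolding subalgebra_def
    using rm by (auto simp: sets_vimage_algebra2 measurable_def space_PiM)
  interpret sigma_finite_subalgebra ?P ?F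
    by (rule finite_measure_subalgebra_is_sigma_finite[OF _])
      (use sub in \<open>auto simp: finite_measure_subalgebra_def finite_measure_subalgebra_axioms_def intro: P.finite_measure_axioms\<close>)
  define u where "u = (\<lambda>w. \<integral>x. f (w(0 := x)) \<partial>M)"
  have mp: "(\<lambda>(w, x). f (w(0 := x))) \<in> borel_measurable (?N \<Otimes>\<^sub>M M)"
    using measurable_compose[OF measurable_add_dim[of 0 ?J "\<lambda>_. M"] fm]
    by (simp add: split_beta')
  have [measurable]: "u \<in> borel_measurable ?N"
    unfolding u_def using borel_measurable_lebesgue_integral[OF mp] by simp
  have fin: "AE w in ?N. integrable M (\<lambda>x. f (w(0 := x)))"
  proof -
    have "(\<integral>\<^sup>+w. ennreal (norm (f w)) \<partial>?P) = (\<integral>\<^sup>+w. \<integral>\<^sup>+x. ennreal (norm (f (w(0 := x)))) \<partial>M \<partial>?N)"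
      unfolding J(3) using fm by (subst pp.product_nn_integral_insert[OF J(1,2)]) auto
    moreover have "(\<integral>\<^sup>+w. ennreal (norm (f w)) \<partial>?P) < \<infinity>" using f by (simp add: integrable_iff_bounded)
    ultimately have "(\<integral>\<^sup>+w. \<integral>\<^sup>+x. ennreal (norm (f (w(0 := x)))) \<partial>M \<partial>?N) \<noteq> \<infinity>" by simp
    moreover have "(\<lambda>w. \<integral>\<^sup>+x. ennreal (norm (f (w(0 := x)))) \<partial>M) \<in> borel_measurable ?N"
      using mp by (intro borel_measurable_nn_integral) (auto simp: split_beta')
    ultimately have "AE w in ?N. (\<integral>\<^sup>+x. ennreal (norm (f (w(0 := x)))) \<partial>M) \<noteq> \<infinity>"
      by (intro nn_integral_PInf_AE) auto
    thus ?thesis using AE_space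
    proof eventually_elim
      case (elim w)
      thus ?case
        using measurable_upd_coord[OF fm, of w] by (auto simp: integrable_iff_bounded less_top)
    qed
  qed
  have intB: "integrable ?N (\<lambda>w. indicator B w * u w) \<and> (\<integral>w. indicator B w * u w \<partial>?N) = 0" if B: "B \<in> sets ?N" for B
  proof -
    \<comment> \<open>The cylinder over B belongs to the conditioning \<sigma>-algebra, so on it f
      may be replaced by its conditional expectation.\<close>
    define B' where "B' = (\<lambda>x. restrict x ?J) -` B \<inter> space ?P"
    have B'F: "B' \<in> sets ?F" unfolding B'_def using B by (rule in_vimage_algebra)
    have B'P: "B' \<in> sets ?P" using sub B'F by (auto simp: subalgebra_def)
    have ind: "indicator B' (w(0 := x)) = (indicator B w :: real)" if "w \<in> space ?N" "x \<in> space M" for w x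
    proof -
      have "restrict (w(0 := x)) ?J = w"
        using that(1) by (auto simp: space_PiM PiE_def extensional_def restrict_def)
      moreover have "w(0 := x) \<in> space ?P"
        using that unfolding J(3) by (auto simp: space_PiM PiE_def extensional_def)
      ultimately show ?thesis by (simp add: B'_def indicator_def)
    qed
    have iB: "integrable ?P (\<lambda>x. indicator B' x * f x)"
      using integrable_mult_indicator[OF B'P f] by simp
    have "(\<integral>x. indicator B' x * f x \<partial>?P) = (\<integral>x. indicator B' x * real_cond_exp ?P ?F f x \<partial>?P)"
      using real_cond_exp_intA[OF f B'F] by (simp add: set_lebesgue_integral_def)
    also have "\<dots> = 0"
      using deg by (intro integral_eq_zero_AE) (auto elim: eventually_mono)
    finally have 0: "(\<integral>x. indicator B' x * f x \<partial>?P) = 0" .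
    have eq: "(\<integral>x. indicator B' (w(0 := x)) * f (w(0 := x)) \<partial>M) = indicator B w * u w" if "w \<in> space ?N" for w
    proof -
      have "(\<integral>x. indicator B' (w(0 := x)) * f (w(0 := x)) \<partial>M) = (\<integral>x. indicator B w * f (w(0 := x)) \<partial>M)"
        by (intro Bochner_Integration.integral_cong refl) (simp only: ind[OF that])
      thus ?thesis by (simp add: u_def)
    qed
    have "(\<integral>x. indicator B' x * f x \<partial>?P) = (\<integral>w. (\<integral>x. indicator B' (w(0 := x)) * f (w(0 := x)) \<partial>M) \<partial>?N)"
      using iB unfolding J(3) by (subst pp.product_integral_insert[OF J(1,2)]) auto
    also have "\<dots> = (\<integral>w. indicator B w * u w \<partial>?N)"
      by (intro Bochner_Integration.integral_cong refl eq)
    finally have "(\<integral>w. indicator B w * u w \<partial>?N) = 0" using 0 by simp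
    moreover have "integrable ?N (\<lambda>w. indicator B w * u w)"
    proof (rule integrableI_bounded)
      show "(\<lambda>w. indicator B w * u w) \<in> borel_measurable ?N" using B by measurable
      have "(\<integral>\<^sup>+w. ennreal (norm (indicator B w * u w)) \<partial>?N) \<le> (\<integral>\<^sup>+w. \<integral>\<^sup>+x. ennreal (norm (f (w(0 := x)))) \<partial>M \<partial>?N)"
      proof (rule nn_integral_mono_AE, use fin in eventually_elim)
        case (elim w)
        have "norm (indicator B w * u w) \<le> (\<integral>x. norm (f (w(0 := x))) \<partial>M)"
          unfolding u_def by (rule order_trans[OF _ integral_norm_bound]) (auto simp: indicator_def)
        also have "ennreal \<dots> = (\<integral>\<^sup>+x. ennreal (norm (f (w(0 := x)))) \<partial>M)"
          using elim by (intro nn_integral_eq_integral[symmetric]) auto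
        finally show ?case by (simp add: ennreal_leI)
      qed
      also have "\<dots> = (\<integral>\<^sup>+w. ennreal (norm (f w)) \<partial>?P)"
        unfolding J(3) using fm by (subst pp.product_nn_integral_insert[OF J(1,2)]) auto
      also have "\<dots> < \<infinity>" using f by (simp add: integrable_iff_bounded)
      finally show "(\<integral>\<^sup>+w. ennreal (norm (indicator B w * u w)) \<partial>?N) < \<infinity>" .
    qed
    ultimately show ?thesis by simp
  qed
  have u0: "AE w in ?N. u w = 0"
  proof -
    \<comment> \<open>Testing on the sets where u is positive and where it is negative leaves only u
      = 0 almost everywhere.\<close>
    let ?B = "{w \<in> space ?N. u w > 0}" and ?C = "{w \<in> space ?N. u w < 0}"
    have "?B \<in> sets ?N" "?C \<in> sets ?N" by measurable
    from this[THEN intB] have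
      1: "integrable ?N (\<lambda>w. indicator ?B w * u w)" "(\<integral>w. indicator ?B w * u w \<partial>?N) = 0" and
      2: "integrable ?N (\<lambda>w. indicator ?C w * u w)" "(\<integral>w. indicator ?C w * u w \<partial>?N) = 0" by auto
    have "AE w in ?N. indicator ?B w * u w = 0"
      using 1(2) by (subst (asm) integral_nonneg_eq_0_iff_AE[OF 1(1)]) (auto simp: indicator_def)
    moreover have "AE w in ?N. - (indicator ?C w * u w) = 0"
    proof -
      have "(\<integral>w. - (indicator ?C w * u w) \<partial>?N) = 0" using 2 by simp
      thus ?thesis
        using 2(1) by (subst (asm) integral_nonneg_eq_0_iff_AE) (auto simp: indicator_def)
    qed
    ultimately show ?thesis using AE_space
      by eventually_elim (auto simp: indicator_def split: if_splits)
  qed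
  \<comment> \<open>The statement returns to all j coordinates by pulling back along the
    restriction; coordinate 0 is overwritten by x anyway.\<close>
  have "AE w in distr ?P ?N (\<lambda>w. \<lambda>n\<in>?J. w n). has_bochner_integral M (\<lambda>x. f (w(0 := x))) 0"
  proof -
    have d: "distr ?P ?N (\<lambda>w. \<lambda>n\<in>?J. w n) = ?N" by (rule distr_iid_reindex) auto
    show ?thesis unfolding d
      using u0 fin by eventually_elim (simp add: has_bochner_integral_iff u_def)
  qed
  hence "AE w in ?P. has_bochner_integral M (\<lambda>x. f ((\<lambda>n\<in>?J. w n)(0 := x))) 0"
    by (rule AE_distrD[rotated]) (rule rm)
  thus ?thesis using AE_space
  proof eventually_elim
    case (elim w)
    have "(\<lambda>n\<in>?J. w n)(0 := x) = w(0 := x)" for x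
      using elim(2) by (fastforce simp: space_PiM PiE_def extensional_def restrict_def fun_eq_iff)
    with elim(1) show ?case by (simp del: fun_upd_apply)
  qed
qed

lemma TA_fun_upd: "finite A \<Longrightarrow> i \<notin> A \<Longrightarrow> TA t A (w(i := x)) = TA t A w"
  unfolding TA_def
  by (rule arg_cong[where f = "t (card A)"], rule restrict_ext)
    (metis fun_upd_other lessThan_iff nth_mem set_sorted_list_of_set sorted_list_of_set.length_sorted_key_list_of_set)

text \<open>Symmetry frees T_A from the sorted enumeration. This is essential for
  \<open>TA_degenerate\<close>, where an arbitrary index of A has to be moved to position 0, the
  only position of which the degeneracy hypothesis speaks.\<close>

lemma TA_eq_enum:
  assumes A: "finite A" "card A = j" and sym: "symmetric_fun j (t j)" and e: "bij_betw e {..<j} A"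
  shows "TA t A w = t j (\<lambda>m\<in>{..<j}. w (e m))"
proof -
  let ?s = "\<lambda>m. sorted_list_of_set A ! m"
  have s: "bij_betw ?s {..<j} A"
    using A by (intro bij_betw_nth) auto
  \<comment> \<open>The permutation linking the two enumerations, extended by the identity as
    \<open>permutes\<close> demands.\<close>
  define \<pi> where "\<pi> = (\<lambda>m. if m \<in> {..<j} then inv_into {..<j} ?s (e m) else m)"
  have "bij_betw (inv_into {..<j} ?s \<circ> e) {..<j} {..<j}"
    using e bij_betw_inv_into[OF s] by (rule bij_betw_trans)
  hence "bij_betw \<pi> {..<j} {..<j}"
    by (rule bij_betw_cong[THEN iffD1, rotated]) (auto simp: \<pi>_def)
  hence \<pi>: "\<pi> permutes {..<j}"
    by (rule bij_imp_permutes) (simp add: \<pi>_def)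
  let ?x = "\<lambda>m\<in>{..<j}. w (?s m)"
  have "?x \<in> space (PiM {..<j} (\<lambda>_. borel :: real measure))" by (simp add: space_PiM)
  hence "t j (\<lambda>m\<in>{..<j}. ?x (\<pi> m)) = t j ?x"
    using sym \<pi> unfolding symmetric_fun_def by blast
  moreover have "(\<lambda>m\<in>{..<j}. ?x (\<pi> m)) = (\<lambda>m\<in>{..<j}. w (e m))"
  proof (rule restrict_ext)
    fix m assume m: "m \<in> {..<j}"
    have "e m \<in> A" using e m by (auto simp: bij_betw_def)
    hence "?s (\<pi> m) = e m"
      using m bij_betw_inv_into_right[OF s, of "e m"] by (simp add: \<pi>_def)
    moreover have "\<pi> m \<in> {..<j}" using permutes_in_image[OF \<pi>] m by blast
    ultimately show "?x (\<pi> m) = w (e m)" by simp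
  qed
  ultimately show ?thesis using A by (simp add: TA_def)
qed

section \<open>The statistic of the theorem, moments of its partial sums\<close>

locale ustat = iid_product M for M :: "real measure" +
  fixes n k :: nat and l :: "real \<Rightarrow> real" and t :: "nat \<Rightarrow> (nat \<Rightarrow> real) \<Rightarrow> real" and \<alpha> :: real
  assumes n1: "n \<ge> 1" and \<alpha>: "1 \<le> \<alpha>" "\<alpha> < 2"
    and sM: "sets M = sets borel" and l_meas: "l \<in> borel_measurable borel"
    and l_int: "integrable M l" and l_mean: "(\<integral>x. l x \<partial>M) = 0"
    and l2_int: "integrable M (\<lambda>x. (l x)\<^sup>2)" and l2: "real n * (\<integral>x. (l x)\<^sup>2 \<partial>M) = 1"
    and t_all: "\<forall>j\<in>{1..k}. t j \<in> borel_measurable (PiM {..<j} (\<lambda>_. borel)) \<and> symmetric_fun j (t j) \<and>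
        integrable (joint j M) (t j) \<and> degenerate M j (t j)"
    and l3_int: "integrable M (\<lambda>x. \<bar>l x\<bar> ^ 3)"
    and ta_int: "\<forall>j\<in>{1..k}. j \<le> n \<longrightarrow> integrable (joint j M) (\<lambda>x. \<bar>t j x\<bar> powr \<alpha>)"
begin

lemma lM[measurable]: "l \<in> borel_measurable M"
  using l_meas sM by (simp cong: measurable_cong_sets)

lemma joint_eq: "joint j M = iid {..<j}"
  by (simp add: joint_def)

abbreviation "I \<equiv> {..<n}"
abbreviation "P \<equiv> iid {..<n}"

sublocale P: prob_space P by (rule prob_space_iid)

definition \<A> :: "nat set set" where
  "\<A> = {A. A \<subseteq> I \<and> card A \<in> {1..k}}"

lemma finite_\<A>: "finite \<A>"
  by (rule finite_subset[of _ "Pow I"]) (auto simp: \<A>_def)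

lemma \<A>D: "A \<in> \<A> \<Longrightarrow> A \<subseteq> I" "A \<in> \<A> \<Longrightarrow> finite A" "A \<in> \<A> \<Longrightarrow> card A \<in> {1..k}" "A \<in> \<A> \<Longrightarrow> card A \<le> n"
  using card_mono[of I A] by (auto simp: \<A>_def intro: finite_subset[of _ I])

lemma t_meas[measurable]: "j \<in> {1..k} \<Longrightarrow> t j \<in> borel_measurable (iid {..<j})"
  using t_all sM by (auto cong: measurable_cong_sets sets_PiM_cong)

lemma sum_\<A>: "(\<Sum>A\<in>{A\<in>\<A>. Q A}. f A) = (\<Sum>j=1..k. \<Sum>A\<in>{A. A \<subseteq> I \<and> card A = j \<and> Q A}. f A)"
  for f :: "nat set \<Rightarrow> 'b :: comm_monoid_add"
proof -
  have "(\<Sum>A\<in>{A\<in>\<A>. Q A}. f A) = (\<Sum>j\<in>{1..k}. \<Sum>A\<in>{A \<in> {A\<in>\<A>. Q A}. card A = j}. f A)"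
    using finite_\<A> by (intro sum.group[symmetric]) (auto simp: \<A>_def)
  also have "\<dots> = (\<Sum>j=1..k. \<Sum>A\<in>{A. A \<subseteq> I \<and> card A = j \<and> Q A}. f A)"
    by (intro sum.cong refl) (auto simp: \<A>_def)
  finally show ?thesis .
qed

lemma TT_eq: "TT k n t w = (\<Sum>A\<in>\<A>. TA t A w)"
  using sum_\<A>[where Q = "\<lambda>_. True" and f = "\<lambda>A. TA t A w"] by (simp add: TT_def TTj_def)

lemma enum_exists:
  assumes "A \<in> \<A>"
  obtains e where "bij_betw e {..<card A} A" "e \<in> {..<card A} \<rightarrow> I"
    "\<And>w. TA t A w = t (card A) (\<lambda>m\<in>{..<card A}. w (e m))"
proof -
  obtain e where e: "bij_betw e {..<card A} A"
    using \<A>D(2)[OF assms] ex_bij_betw_nat_finite[of A] by (auto simp: atLeast0LessThan)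
  have "e \<in> {..<card A} \<rightarrow> I" using e \<A>D(1)[OF assms] by (auto simp: bij_betw_def)
  moreover have "TA t A w = t (card A) (\<lambda>m\<in>{..<card A}. w (e m))" for w
    using assms t_all e by (intro TA_eq_enum) (auto simp: \<A>_def intro: finite_subset)
  ultimately show ?thesis using e that by blast
qed

lemma TA_meas[measurable]:
  assumes "A \<in> \<A>"
  shows "TA t A \<in> borel_measurable P"
proof -
  obtain e where e: "e \<in> {..<card A} \<rightarrow> I" "\<And>w. TA t A w = t (card A) (\<lambda>m\<in>{..<card A}. w (e m))"
    using enum_exists[OF assms] by metis
  have "(\<lambda>w. t (card A) (\<lambda>m\<in>{..<card A}. w (e m))) \<in> borel_measurable P"
    by (rule measurable_compose[OF measurable_reindex[OF e(1)] t_meas]) (use assms in \<open>simp add: \<A>_def\<close>)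
  thus ?thesis using e(2) by (simp add: fun_eq_iff[symmetric] cong: measurable_cong)
qed

text \<open>The coordinates in A are distributed as the first card A ones, so the expectation
  depends on card A only. The generality in u and F lets one transport cover integrability and
  moments of T_A as well as both coefficients \<open>ahat\<close> and \<open>bhat\<close>.\<close>

lemma integral_prod_TA:
  fixes u :: "real \<Rightarrow> 'b::{real_normed_field, banach, second_countable_topology}" and F :: "real \<Rightarrow> 'b"
  assumes A: "A \<in> \<A>" and [measurable]: "u \<in> borel_measurable M" "F \<in> borel_measurable borel"
  shows "integrable P (\<lambda>w. (\<Prod>i\<in>A. u (w i)) * F (TA t A w)) \<longleftrightarrow>
      integrable (iid {..<card A}) (\<lambda>x. (\<Prod>i<card A. u (x i)) * F (t (card A) x))"
    and "(\<integral>w. (\<Prod>i\<in>A. u (w i)) * F (TA t A w) \<partial>P) =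
      (\<integral>x. (\<Prod>i<card A. u (x i)) * F (t (card A) x) \<partial>iid {..<card A})"
proof -
  obtain e where e: "bij_betw e {..<card A} A" "e \<in> {..<card A} \<rightarrow> I"
    "\<And>w. TA t A w = t (card A) (\<lambda>m\<in>{..<card A}. w (e m))"
    using enum_exists[OF A] by metis
  let ?r = "\<lambda>w. \<lambda>m\<in>{..<card A}. w (e m)"
  let ?H = "\<lambda>x. (\<Prod>i<card A. u (x i)) * F (t (card A) x)"
  have [measurable]: "t (card A) \<in> borel_measurable (iid {..<card A})"
    using A by (intro t_meas) (simp add: \<A>_def)
  have H[measurable]: "?H \<in> borel_measurable (iid {..<card A})" by measurable
  have r: "?r \<in> measurable P (iid {..<card A})" by (rule measurable_reindex[OF e(2)])
  have d: "distr P (iid {..<card A}) ?r = iid {..<card A}"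
    by (rule distr_iid_reindex[OF _ e(2)]) (use e(1) in \<open>simp add: bij_betw_def\<close>)
  have eq: "(\<Prod>i\<in>A. u (w i)) * F (TA t A w) = ?H (?r w)" for w
  proof -
    have "(\<Prod>i\<in>A. u (w i)) = (\<Prod>m<card A. u (w (e m)))"
      by (rule prod.reindex_bij_betw[OF e(1), symmetric])
    thus ?thesis using e(3) by simp
  qed
  show "integrable P (\<lambda>w. (\<Prod>i\<in>A. u (w i)) * F (TA t A w)) \<longleftrightarrow> integrable (iid {..<card A}) ?H"
    unfolding eq using integrable_distr_eq[OF r H] d by simp
  show "(\<integral>w. (\<Prod>i\<in>A. u (w i)) * F (TA t A w) \<partial>P) = (\<integral>x. ?H x \<partial>iid {..<card A})"
    unfolding eq using integral_distr[OF r H] d by simp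
qed

lemma t_props:
  assumes "j \<in> {1..k}"
  shows "symmetric_fun j (t j)" "integrable (iid {..<j}) (t j)" "degenerate M j (t j)"
  using bspec[OF t_all assms] by (simp_all add: joint_eq)

lemma TA_integrable:
  assumes A: "A \<in> \<A>"
  shows "integrable P (TA t A)"
proof -
  have "integrable P (\<lambda>w. (\<Prod>i\<in>A. 1) * TA t A w)"
    by (rule integral_prod_TA(1)[OF A, of "\<lambda>_. 1" "\<lambda>x. x", THEN iffD2])
      (simp_all add: t_props(2)[OF \<A>D(3)[OF A]])
  thus ?thesis by (simp only: prod.neutral_const mult_1_left)
qed

lemma TA_degenerate:
  assumes A: "A \<in> \<A>" and i: "i \<in> A"
  shows "degenerate_at I i (TA t A)"
proof -
  let ?j = "card A"
  obtain e0 where e0: "bij_betw e0 {..<?j} A" "e0 \<in> {..<?j} \<rightarrow> I"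
    "\<And>w. TA t A w = t ?j (\<lambda>m\<in>{..<?j}. w (e0 m))"
    using enum_exists[OF A] by metis
  have "i \<in> e0 ` {..<?j}" using e0(1) i by (simp add: bij_betw_def)
  then obtain m0 where m0: "m0 < ?j" "e0 m0 = i" by blast
  \<comment> \<open>The transposition brings i to position 0 of the enumeration.\<close>
  define e where "e = e0 \<circ> Transposition.transpose 0 m0"
  have "0 < ?j" using m0 by simp
  have e: "bij_betw e {..<?j} A"
    unfolding e_def using m0(1) \<open>0 < ?j\<close>
    by (intro bij_betw_trans[OF _ e0(1)] permutes_imp_bij permutes_swap_id) auto
  have e_0: "e 0 = i" using m0 by (simp add: e_def)
  have eI: "e \<in> {..<?j} \<rightarrow> I" using e \<A>D(1)[OF A] by (auto simp: bij_betw_def)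
  have tj: "symmetric_fun ?j (t ?j)" "integrable (iid {..<?j}) (t ?j)" "degenerate M ?j (t ?j)"
    by (rule t_props[OF \<A>D(3)[OF A]])+
  have eq: "TA t A w = t ?j (\<lambda>m\<in>{..<?j}. w (e m))" for w
    using \<A>D(2)[OF A] tj(1) e by (intro TA_eq_enum) auto
  have upd: "(\<lambda>m\<in>{..<?j}. (w(i := x)) (e m)) = (\<lambda>m\<in>{..<?j}. w (e m))(0 := x)" for w x
  proof
    fix m
    have "e m = i \<longleftrightarrow> m = 0" if "m < ?j"
      using that e e_0 \<open>0 < ?j\<close> by (auto simp: bij_betw_def inj_on_def)
    thus "(\<lambda>m\<in>{..<?j}. (w(i := x)) (e m)) m = ((\<lambda>m\<in>{..<?j}. w (e m))(0 := x)) m"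
      using \<open>0 < ?j\<close> by auto
  qed
  have "AE w in iid {..<?j}. has_bochner_integral M (\<lambda>x. t ?j (w(0 := x))) 0"
    using \<open>0 < ?j\<close> tj(3) unfolding degenerate_def joint_eq
    by (intro degenerate_AE_coordinate_0 tj(2)) simp_all
  moreover have d: "distr P (iid {..<?j}) (\<lambda>w. \<lambda>m\<in>{..<?j}. w (e m)) = iid {..<?j}"
    by (rule distr_iid_reindex[OF _ eI]) (use e in \<open>simp add: bij_betw_def\<close>)
  ultimately have "AE w in distr P (iid {..<?j}) (\<lambda>w. \<lambda>m\<in>{..<?j}. w (e m)). has_bochner_integral M (\<lambda>x. t ?j (w(0 := x))) 0"
    by (simp only: d)
  hence "AE w in P. has_bochner_integral M (\<lambda>x. t ?j ((\<lambda>m\<in>{..<?j}. w (e m))(0 := x))) 0"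
    by (rule AE_distrD[OF measurable_reindex[OF eI]])
  thus ?thesis unfolding degenerate_at_def eq upd .
qed

definition mom :: "nat \<Rightarrow> real" where
  "mom j = (\<integral>x. \<bar>t j x\<bar> powr \<alpha> \<partial>iid {..<j})"

lemma mom_nonneg: "0 \<le> mom j" by (simp add: mom_def)

abbreviation "\<gamma> \<equiv> gamma \<alpha> k n M t"
abbreviation "\<beta> \<equiv> beta n M l"

lemma \<gamma>_eq: "\<gamma> = (\<Sum>j=1..k. real (n choose j) * mom j)"
  by (simp add: gamma_def mom_def joint_eq)

lemma \<gamma>_nonneg: "0 \<le> \<gamma>" unfolding \<gamma>_eq by (intro sum_nonneg mult_nonneg_nonneg mom_nonneg) auto

lemma mom_le_\<gamma>: "j \<in> {1..k} \<Longrightarrow> real (n choose j) * mom j \<le> \<gamma>"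
  unfolding \<gamma>_eq by (rule member_le_sum) (auto intro: mult_nonneg_nonneg mom_nonneg)

lemma sum_mom_\<A>: "(\<Sum>A\<in>\<A>. mom (card A)) = \<gamma>"
proof -
  have "(\<Sum>A\<in>\<A>. mom (card A)) = (\<Sum>j=1..k. \<Sum>A\<in>{A. A \<subseteq> I \<and> card A = j}. mom (card A))"
    using sum_\<A>[where Q = "\<lambda>_. True" and f = "\<lambda>A. mom (card A)"] by simp
  also have "\<dots> = (\<Sum>j=1..k. real (n choose j) * mom j)"
    using n_subsets[of I] by (intro sum.cong refl) simp
  finally show ?thesis by (simp add: \<gamma>_eq)
qed

text \<open>A given index lies in the fraction j/n \<le> k/n of all j-sets, and a union bound over Q
  finishes. This is the source of the factor m/n for the part of T that meets the blocks.\<close>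

lemma sum_mom_hit:
  assumes Q: "Q \<subseteq> I"
  shows "(\<Sum>A\<in>{A\<in>\<A>. A \<inter> Q \<noteq> {}}. mom (card A)) \<le> real (card Q) * (real k / real n) * \<gamma>"
proof -
  have fQ: "finite Q" using Q by (rule finite_subset) auto
  have one: "(\<Sum>A\<in>{A\<in>\<A>. i \<in> A}. mom (card A)) \<le> real k / real n * \<gamma>" if i: "i \<in> I" for i
  proof -
    have cnt: "real (card {A. A \<subseteq> I \<and> card A = j \<and> i \<in> A}) \<le> real k / real n * real (n choose j)" if j: "j \<in> {1..k}" for j
    proof -
      have "{A. A \<subseteq> I \<and> card A = j \<and> i \<in> A} \<subseteq> insert i ` {B. B \<subseteq> I - {i} \<and> card B = j - 1}"
      proof
        fix A assume "A \<in> {A. A \<subseteq> I \<and> card A = j \<and> i \<in> A}"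
        thus "A \<in> insert i ` {B. B \<subseteq> I - {i} \<and> card B = j - 1}"
          by (intro image_eqI[of _ _ "A - {i}"]) auto
      qed
      hence "card {A. A \<subseteq> I \<and> card A = j \<and> i \<in> A} \<le> card (insert i ` {B. B \<subseteq> I - {i} \<and> card B = j - 1})"
        by (intro card_mono finite_imageI) auto
      also have "\<dots> \<le> card {B. B \<subseteq> I - {i} \<and> card B = j - 1}" by (intro card_image_le) auto
      also have "\<dots> = (n - 1) choose (j - 1)" using i by (subst n_subsets) auto
      finally have "real n * real (card {A. A \<subseteq> I \<and> card A = j \<and> i \<in> A}) \<le> real (n * ((n - 1) choose (j - 1)))"
        by (simp add: mult_left_mono)
      also have "n * ((n - 1) choose (j - 1)) = j * (n choose j)"
        using j n1 times_binomial_minus1_eq[of j n] by simp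
      also have "real (j * (n choose j)) \<le> real k * real (n choose j)"
        using j by (simp add: mult_right_mono)
      finally show ?thesis using n1 by (simp add: field_simps)
    qed
    have "(\<Sum>A\<in>{A\<in>\<A>. i \<in> A}. mom (card A)) = (\<Sum>j=1..k. \<Sum>A\<in>{A. A \<subseteq> I \<and> card A = j \<and> i \<in> A}. mom (card A))"
      by (rule sum_\<A>)
    also have "\<dots> = (\<Sum>j=1..k. real (card {A. A \<subseteq> I \<and> card A = j \<and> i \<in> A}) * mom j)"
      by (intro sum.cong refl) simp
    also have "\<dots> \<le> (\<Sum>j=1..k. real k / real n * real (n choose j) * mom j)"
      by (intro sum_mono mult_right_mono cnt mom_nonneg) auto
    also have "\<dots> = real k / real n * \<gamma>" by (simp add: \<gamma>_eq sum_distrib_left mult.assoc)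
    finally show ?thesis .
  qed
  have "(\<Sum>A\<in>{A\<in>\<A>. A \<inter> Q \<noteq> {}}. mom (card A)) \<le>
    (\<Sum>A\<in>{A\<in>\<A>. A \<inter> Q \<noteq> {}}. \<Sum>i\<in>Q. if i \<in> A then mom (card A) else 0)"
  proof (rule sum_mono)
    fix A assume "A \<in> {A\<in>\<A>. A \<inter> Q \<noteq> {}}"
    then obtain i where "i \<in> Q" "i \<in> A" by auto
    thus "mom (card A) \<le> (\<Sum>i\<in>Q. if i \<in> A then mom (card A) else 0)"
      using member_le_sum[of i Q "\<lambda>i. if i \<in> A then mom (card A) else 0"] fQ mom_nonneg by simp
  qed
  also have "\<dots> \<le> (\<Sum>A\<in>\<A>. \<Sum>i\<in>Q. if i \<in> A then mom (card A) else 0)"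
    using finite_\<A> by (intro sum_mono2) (auto intro!: sum_nonneg mom_nonneg)
  also have "\<dots> = (\<Sum>i\<in>Q. \<Sum>A\<in>{A\<in>\<A>. i \<in> A}. mom (card A))"
    by (subst sum.swap) (simp add: sum.inter_filter finite_\<A>)
  also have "\<dots> \<le> (\<Sum>i\<in>Q. real k / real n * \<gamma>)" using Q by (intro sum_mono one) auto
  finally show ?thesis by simp
qed

definition TS :: "nat set set \<Rightarrow> (nat \<Rightarrow> real) \<Rightarrow> real" where
  "TS B w = (\<Sum>A\<in>B. TA t A w)"

lemma TS_meas[measurable]: "B \<subseteq> \<A> \<Longrightarrow> TS B \<in> borel_measurable P"
  unfolding TS_def by (intro borel_measurable_sum TA_meas) auto

text \<open>The von Bahr--Esseen bound for an arbitrary subfamily of kernels; subfamilies are what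
  the block decomposition produces. The constants 6 ^ card A are at most 6 ^ k.\<close>

lemma TS_moment:
  assumes B: "B \<subseteq> \<A>"
  shows "integrable P (\<lambda>w. \<bar>TS B w\<bar> powr \<alpha>)"
    and "(\<integral>w. \<bar>TS B w\<bar> powr \<alpha> \<partial>P) \<le> 6 ^ k * (\<Sum>A\<in>B. mom (card A))"
proof -
  have fB: "finite B" using B finite_\<A> by (rule finite_subset)
  have BP: "B \<subseteq> Pow I" using B by (auto simp: \<A>_def)
  \<comment> \<open>The sum inequality runs over all subsets of I, so the family is extended by 0,
    which is degenerate in every coordinate.\<close>
  define h where "h = (\<lambda>A w. if A \<in> B then TA t A w else 0)"
  have mom_TA: "(\<integral>\<^sup>+w. ennreal (\<bar>TA t A w\<bar> powr \<alpha>) \<partial>P) = ennreal (mom (card A))" if A: "A \<in> \<A>" for A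
  proof -
    have "integrable P (\<lambda>w. \<bar>TA t A w\<bar> powr \<alpha>)"
      using integral_prod_TA(1)[OF A, of "\<lambda>_. 1" "\<lambda>x. \<bar>x\<bar> powr \<alpha>"] ta_int \<A>D[OF A] by (simp add: joint_eq)
    hence "(\<integral>\<^sup>+w. ennreal (\<bar>TA t A w\<bar> powr \<alpha>) \<partial>P) = ennreal (\<integral>w. \<bar>TA t A w\<bar> powr \<alpha> \<partial>P)"
      by (intro nn_integral_eq_integral) auto
    also have "(\<integral>w. \<bar>TA t A w\<bar> powr \<alpha> \<partial>P) = mom (card A)"
      using integral_prod_TA(2)[OF A, of "\<lambda>_. 1" "\<lambda>x. \<bar>x\<bar> powr \<alpha>"] by (simp add: mom_def)
    finally show ?thesis .
  qed
  have h0: "degenerate_at I i (\<lambda>w. 0)" for i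
    unfolding degenerate_at_def by (auto simp: has_bochner_integral_zero)
  have "(\<integral>\<^sup>+w. ennreal (\<bar>\<Sum>A\<in>Pow I. h A w\<bar> powr \<alpha>) \<partial>P)
    \<le> (\<Sum>A\<in>Pow I. 6 ^ card A * (\<integral>\<^sup>+w. ennreal (\<bar>h A w\<bar> powr \<alpha>) \<partial>P))"
  proof (rule nn_integral_degenerate_sum_powr_le)
    fix A assume "A \<subseteq> I"
    show "h A \<in> borel_measurable P"
      using B by (cases "A \<in> B") (auto simp: h_def)
  next
    fix A i w x assume "A \<subseteq> I" "i \<in> I - A"
    thus "h A (w(i := x)) = h A w"
      unfolding h_def by (intro if_cong refl TA_fun_upd) (auto intro: finite_subset)
  next
    fix A i assume "A \<subseteq> I" "i \<in> A"
    thus "degenerate_at I i (h A)"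
      using B h0 TA_degenerate[of A i] by (cases "A \<in> B") (auto simp: h_def)
  qed (use \<alpha> in auto)
  also have "(\<lambda>w. \<Sum>A\<in>Pow I. h A w) = TS B"
  proof
    fix w
    have "(\<Sum>A\<in>Pow I. h A w) = (\<Sum>A\<in>B. h A w)"
      using BP by (intro sum.mono_neutral_right) (auto simp: h_def)
    thus "(\<Sum>A\<in>Pow I. h A w) = TS B w" by (simp add: TS_def h_def)
  qed
  also have "(\<Sum>A\<in>Pow I. 6 ^ card A * (\<integral>\<^sup>+w. ennreal (\<bar>h A w\<bar> powr \<alpha>) \<partial>P)) =
    (\<Sum>A\<in>B. 6 ^ card A * (\<integral>\<^sup>+w. ennreal (\<bar>h A w\<bar> powr \<alpha>) \<partial>P))"
    using BP by (intro sum.mono_neutral_right) (auto simp: h_def)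
  also have "\<dots> = (\<Sum>A\<in>B. ennreal (6 ^ card A * mom (card A)))"
  proof (rule sum.cong[OF refl])
    fix A assume "A \<in> B"
    hence "(\<integral>\<^sup>+w. ennreal (\<bar>h A w\<bar> powr \<alpha>) \<partial>P) = ennreal (mom (card A))"
      using mom_TA[of A] B by (auto simp: h_def)
    thus "6 ^ card A * (\<integral>\<^sup>+w. ennreal (\<bar>h A w\<bar> powr \<alpha>) \<partial>P) = ennreal (6 ^ card A * mom (card A))"
      by (simp add: ennreal_mult mom_nonneg flip: ennreal_power)
  qed
  also have "\<dots> = ennreal (\<Sum>A\<in>B. 6 ^ card A * mom (card A))"
    by (intro sum_ennreal mult_nonneg_nonneg mom_nonneg) auto
  also have "\<dots> \<le> ennreal (6 ^ k * (\<Sum>A\<in>B. mom (card A)))"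
    unfolding sum_distrib_left
  proof (intro ennreal_leI sum_mono mult_right_mono mom_nonneg power_increasing)
    fix A assume "A \<in> B" thus "card A \<le> k" using B \<A>D(3)[of A] by auto
  qed auto
  finally have le: "(\<integral>\<^sup>+w. ennreal (\<bar>TS B w\<bar> powr \<alpha>) \<partial>P) \<le> ennreal (6 ^ k * (\<Sum>A\<in>B. mom (card A)))" .
  have [measurable]: "TS B \<in> borel_measurable P" using B by (rule TS_meas)
  have fin: "(\<integral>\<^sup>+w. ennreal (\<bar>TS B w\<bar> powr \<alpha>) \<partial>P) < \<infinity>"
    using le by (rule order.strict_trans1) simp
  show int: "integrable P (\<lambda>w. \<bar>TS B w\<bar> powr \<alpha>)"
    by (intro integrableI_nonneg) (use fin in auto)
  have "ennreal (\<integral>w. \<bar>TS B w\<bar> powr \<alpha> \<partial>P) \<le> ennreal (6 ^ k * (\<Sum>A\<in>B. mom (card A)))"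
    using le int by (subst nn_integral_eq_integral[symmetric]) auto
  thus "(\<integral>w. \<bar>TS B w\<bar> powr \<alpha> \<partial>P) \<le> 6 ^ k * (\<Sum>A\<in>B. mom (card A))"
    by (subst (asm) ennreal_le_iff) (auto intro!: mult_nonneg_nonneg sum_nonneg mom_nonneg)
qed

end

section \<open>Expansion of the characteristic function\<close>

context ustat
begin

definition \<phi> :: "real \<Rightarrow> complex" where
  "\<phi> \<tau> = (\<integral>x. iexp (\<tau> * l x) \<partial>M)"

lemma integrable_iexp_l: "integrable M (\<lambda>x. iexp (\<tau> * l x))"
  by (intro integrable_const_bound[where B = 1]) auto

lemma LL_meas[measurable]: "LL n l \<in> borel_measurable P"
  unfolding LL_def[abs_def] by measurable

lemma iexp_LL: "iexp (\<tau> * LL n l w) = (\<Prod>i<n. iexp (\<tau> * l (w i)))"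
  by (simp add: LL_def sum_distrib_left exp_sum)

text \<open>The exponential of L is a product over independent coordinates. Those in Q do not meet Z
  and contribute \<phi> each; the remaining ones have modulus 1 and disappear in the norm.\<close>

lemma integral_iexp_LL_mult:
  fixes Z :: "(nat \<Rightarrow> real) \<Rightarrow> complex"
  assumes Q: "Q \<subseteq> I" and Z: "integrable P Z" and ind: "\<And>i w x. i \<in> Q \<Longrightarrow> Z (w(i := x)) = Z w"
  shows "integrable P (\<lambda>w. iexp (\<tau> * LL n l w) * Z w)"
    and "(\<integral>w. iexp (\<tau> * LL n l w) * Z w \<partial>P) =
      \<phi> \<tau> ^ card Q * (\<integral>w. (\<Prod>i\<in>I - Q. iexp (\<tau> * l (w i))) * Z w \<partial>P)"
    and "cmod (\<integral>w. iexp (\<tau> * LL n l w) * Z w \<partial>P) \<le> cmod (\<phi> \<tau>) ^ card Q * (\<integral>w. cmod (Z w) \<partial>P)"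
proof -
  have [measurable]: "Z \<in> borel_measurable P" using Z by auto
  let ?R = "\<lambda>w. (\<Prod>i\<in>I - Q. iexp (\<tau> * l (w i))) * Z w"
  have norm_prod: "cmod (\<Prod>i\<in>J. iexp (\<tau> * l (w i))) = 1" for J w
    by (simp add: prod_norm[symmetric] del: of_real_mult)
  show int0: "integrable P (\<lambda>w. iexp (\<tau> * LL n l w) * Z w)"
    by (rule Bochner_Integration.integrable_bound[OF Z]) (auto simp: norm_mult simp del: of_real_mult)
  have R: "integrable P ?R"
    by (rule Bochner_Integration.integrable_bound[OF Z]) (auto simp: norm_mult norm_prod simp del: of_real_mult)
  have Rind: "?R (w(i := x)) = ?R w" if "i \<in> Q" for i w x
  proof -
    have "(\<Prod>r\<in>I - Q. iexp (\<tau> * l ((w(i := x)) r))) = (\<Prod>r\<in>I - Q. iexp (\<tau> * l (w r)))"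
      using that by (intro prod.cong) auto
    thus ?thesis by (simp only: ind[OF that])
  qed
  have eq: "iexp (\<tau> * LL n l w) * Z w = (\<Prod>i\<in>Q. iexp (\<tau> * l (w i))) * ?R w" for w
    unfolding iexp_LL using prod.subset_diff[OF Q, of "\<lambda>i. iexp (\<tau> * l (w i))"]
    by (simp add: mult.commute mult.left_commute del: of_real_mult)
  from integral_peel_prod[OF finite_lessThan Q integrable_iexp_l R Rind]
  show 1: "(\<integral>w. iexp (\<tau> * LL n l w) * Z w \<partial>P) = \<phi> \<tau> ^ card Q * (\<integral>w. ?R w \<partial>P)"
    unfolding eq \<phi>_def by blast
  have "cmod (\<integral>w. ?R w \<partial>P) \<le> (\<integral>w. cmod (?R w) \<partial>P)" by (rule integral_norm_bound)
  also have "\<dots> = (\<integral>w. cmod (Z w) \<partial>P)" by (simp add: norm_mult norm_prod del: of_real_mult)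
  finally show "cmod (\<integral>w. iexp (\<tau> * LL n l w) * Z w \<partial>P) \<le> cmod (\<phi> \<tau>) ^ card Q * (\<integral>w. cmod (Z w) \<partial>P)"
    unfolding 1 norm_mult norm_power by (intro mult_left_mono) auto
qed

lemma integral_iexp_LL: "(\<integral>w. iexp (\<tau> * LL n l w) \<partial>P) = \<phi> \<tau> ^ n"
  using integral_iexp_LL_mult(2)[of I "\<lambda>_. 1" \<tau>] P.prob_space by simp

lemma TS_integrable: "B \<subseteq> \<A> \<Longrightarrow> integrable P (TS B)"
  unfolding TS_def[abs_def] by (intro Bochner_Integration.integrable_sum TA_integrable) auto

lemma TS_fun_upd:
  assumes "B \<subseteq> \<A>" "\<And>A. A \<in> B \<Longrightarrow> i \<notin> A"
  shows "TS B (w(i := x)) = TS B w"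
  unfolding TS_def using assms \<A>D(2) by (intro sum.cong refl TA_fun_upd) auto

lemma TS_moment_le_\<gamma>:
  assumes B: "B \<subseteq> \<A>"
  shows "(\<integral>w. \<bar>TS B w\<bar> powr \<alpha> \<partial>P) \<le> 6 ^ k * \<gamma>"
proof -
  have "(\<Sum>A\<in>B. mom (card A)) \<le> (\<Sum>A\<in>\<A>. mom (card A))"
    using B finite_\<A> by (intro sum_mono2) (auto intro: mom_nonneg)
  with TS_moment(2)[OF B] show ?thesis
    unfolding sum_mom_\<A> by (meson mult_left_mono order_trans zero_le_numeral zero_le_power)
qed

lemma TT_TS: "TT k n t = TS \<A>"
  by (rule ext) (simp add: TT_eq TS_def)

definition fS :: "real \<Rightarrow> complex" where
  "fS \<tau> = (\<integral>w. iexp (\<tau> * SS k n l t w) \<partial>P)"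

definition fLT :: "real \<Rightarrow> complex" where
  "fLT \<tau> = (\<integral>w. iexp (\<tau> * LL n l w) * TS \<A> w \<partial>P)"

lemma integrable_iexp_P: "g \<in> borel_measurable P \<Longrightarrow> integrable P (\<lambda>w. iexp (g w))"
  by (intro P.integrable_const_bound[where B = 1]) auto

lemma iexp_LL_mult_integrable:
  fixes Z :: "(nat \<Rightarrow> real) \<Rightarrow> complex"
  shows "integrable P Z \<Longrightarrow> integrable P (\<lambda>w. iexp (\<tau> * LL n l w) * Z w)"
  by (rule integral_iexp_LL_mult(1)[of "{}"]) auto

lemma fS_diff_eq:
  "fS \<tau> - \<phi> \<tau> ^ n - \<i> * \<tau> * fLT \<tau> =
    (\<integral>w. iexp (\<tau> * LL n l w) * (iexp (\<tau> * TS \<A> w) - 1 - \<i> * (\<tau> * TS \<A> w)) \<partial>P)"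
proof -
  have [measurable]: "TS \<A> \<in> borel_measurable P" by (rule TS_meas) simp
  have iT: "integrable P (\<lambda>w. complex_of_real (TS \<A> w))" using TS_integrable[of \<A>] by simp
  have e: "iexp (\<tau> * SS k n l t w) = iexp (\<tau> * LL n l w) * iexp (\<tau> * TS \<A> w)" for w
    by (simp add: SS_def TT_TS distrib_left exp_add)
  have i1: "integrable P (\<lambda>w. iexp (\<tau> * LL n l w) * iexp (\<tau> * TS \<A> w))"
    by (intro iexp_LL_mult_integrable integrable_iexp_P) measurable
  have i2: "integrable P (\<lambda>w. iexp (\<tau> * LL n l w))" by (intro integrable_iexp_P) measurable
  have i3: "integrable P (\<lambda>w. (\<i> * \<tau>) * (iexp (\<tau> * LL n l w) * TS \<A> w))"
    by (intro integrable_mult_right iexp_LL_mult_integrable iT)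
  have "(\<integral>w. iexp (\<tau> * LL n l w) * (iexp (\<tau> * TS \<A> w) - 1 - \<i> * (\<tau> * TS \<A> w)) \<partial>P) =
    (\<integral>w. iexp (\<tau> * LL n l w) * iexp (\<tau> * TS \<A> w) - iexp (\<tau> * LL n l w) - (\<i> * \<tau>) * (iexp (\<tau> * LL n l w) * TS \<A> w) \<partial>P)"
    by (intro Bochner_Integration.integral_cong refl) (simp add: algebra_simps)
  also have "\<dots> = (\<integral>w. iexp (\<tau> * LL n l w) * iexp (\<tau> * TS \<A> w) \<partial>P) - (\<integral>w. iexp (\<tau> * LL n l w) \<partial>P)
      - (\<integral>w. (\<i> * \<tau>) * (iexp (\<tau> * LL n l w) * TS \<A> w) \<partial>P)"
    using i1 i2 i3 by (simp only: Bochner_Integration.integral_diff Bochner_Integration.integrable_diff)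
  also have "\<dots> = fS \<tau> - \<phi> \<tau> ^ n - \<i> * \<tau> * fLT \<tau>"
    unfolding fS_def fLT_def e integral_iexp_LL integral_mult_right_zero ..
  finally show ?thesis ..
qed

lemma powr_abs_mult: "\<bar>a * b :: real\<bar> powr c = \<bar>a\<bar> powr c * \<bar>b\<bar> powr c"
  by (simp add: abs_mult powr_mult)

lemma integral_remainder_le:
  assumes B: "B \<subseteq> \<A>"
  shows "integrable P (\<lambda>w. iexp (\<tau> * TS B w) - 1 - \<i> * (\<tau> * TS B w))"
    and "(\<integral>w. cmod (iexp (\<tau> * TS B w) - 1 - \<i> * (\<tau> * TS B w)) \<partial>P) \<le> 2 * \<bar>\<tau>\<bar> powr \<alpha> * (\<integral>w. \<bar>TS B w\<bar> powr \<alpha> \<partial>P)"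
proof -
  have [measurable]: "TS B \<in> borel_measurable P" using B by (rule TS_meas)
  have i: "integrable P (\<lambda>w. \<i> * complex_of_real (\<tau> * TS B w))"
    using TS_integrable[OF B] by (intro integrable_mult_right integrable_of_real) auto
  show int: "integrable P (\<lambda>w. iexp (\<tau> * TS B w) - 1 - \<i> * (\<tau> * TS B w))"
    by (intro Bochner_Integration.integrable_diff integrable_iexp_P i) auto
  have "(\<integral>w. cmod (iexp (\<tau> * TS B w) - 1 - \<i> * (\<tau> * TS B w)) \<partial>P) \<le> (\<integral>w. 2 * \<bar>\<tau>\<bar> powr \<alpha> * \<bar>TS B w\<bar> powr \<alpha> \<partial>P)"
  proof (rule integral_mono)
    show "integrable P (\<lambda>w. cmod (iexp (\<tau> * TS B w) - 1 - \<i> * (\<tau> * TS B w)))"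
      using int by (rule integrable_norm)
    show "integrable P (\<lambda>w. 2 * \<bar>\<tau>\<bar> powr \<alpha> * \<bar>TS B w\<bar> powr \<alpha>)"
      using TS_moment(1)[OF B] by simp
    fix w
    show "cmod (iexp (\<tau> * TS B w) - 1 - \<i> * (\<tau> * TS B w)) \<le> 2 * \<bar>\<tau>\<bar> powr \<alpha> * \<bar>TS B w\<bar> powr \<alpha>"
      using norm_iexp_minus_linear_le[of \<alpha> "\<tau> * TS B w"] \<alpha>
      by (simp add: powr_abs_mult mult.assoc del: of_real_mult)
  qed
  thus "(\<integral>w. cmod (iexp (\<tau> * TS B w) - 1 - \<i> * (\<tau> * TS B w)) \<partial>P) \<le> 2 * \<bar>\<tau>\<bar> powr \<alpha> * (\<integral>w. \<bar>TS B w\<bar> powr \<alpha> \<partial>P)"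
    by simp
qed

lemma fS_expand_small:
  "cmod (fS \<tau> - \<phi> \<tau> ^ n - \<i> * \<tau> * fLT \<tau>) \<le> 2 * \<bar>\<tau>\<bar> powr \<alpha> * (6 ^ k * \<gamma>)"
proof -
  have "cmod (fS \<tau> - \<phi> \<tau> ^ n - \<i> * \<tau> * fLT \<tau>) \<le> cmod (\<phi> \<tau>) ^ card ({}::nat set) *
      (\<integral>w. cmod (iexp (\<tau> * TS \<A> w) - 1 - \<i> * (\<tau> * TS \<A> w)) \<partial>P)"
    unfolding fS_diff_eq by (rule integral_iexp_LL_mult(3)) (use integral_remainder_le(1)[of \<A>] in auto)
  also have "\<dots> \<le> 2 * \<bar>\<tau>\<bar> powr \<alpha> * (\<integral>w. \<bar>TS \<A> w\<bar> powr \<alpha> \<partial>P)"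
    using integral_remainder_le(2)[of \<A>] by simp
  also have "\<dots> \<le> 2 * \<bar>\<tau>\<bar> powr \<alpha> * (6 ^ k * \<gamma>)"
    by (intro mult_left_mono TS_moment_le_\<gamma>) auto
  finally show ?thesis .
qed

text \<open>The indices below \<open>(k + 1) m\<close> form \<open>k + 1\<close> blocks of length \<open>m\<close>. A set of at most \<open>k\<close> indices
  misses one of them, and the \<open>m\<close> variables of that block contribute the factor \<open>\<phi> \<tau> ^ m\<close>.\<close>

lemma fS_expand_blocks:
  assumes m: "(k + 1) * m \<le> n"
  shows "cmod (fS \<tau> - \<phi> \<tau> ^ n - \<i> * \<tau> * fLT \<tau>) \<le>
    2 * \<bar>\<tau>\<bar> powr \<alpha> * (6 ^ k * \<gamma>) * (real ((k + 1) * m) * (real k / real n) + (2 * real k + 3) * cmod (\<phi> \<tau>) ^ m)"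
proof -
  define Q where "Q = {..<(k + 1) * m}"
  define blk where "blk = (\<lambda>q. {q * m..<(q + 1) * m})"
  have QI: "Q \<subseteq> I" using m by (auto simp: Q_def)
  have blkQ: "blk q \<subseteq> Q" if "q \<le> k" for q
  proof -
    have "(q + 1) * m \<le> (k + 1) * m" using that by (intro mult_right_mono) auto
    thus ?thesis unfolding blk_def Q_def by (intro subsetI) (simp only: atLeastLessThan_iff lessThan_iff, linarith)
  qed
  have disj: "blk q \<inter> blk r = {}" if "q \<noteq> r" for q r
  proof -
    have "x div m = s" if "x \<in> blk s" for x s
    proof -
      have "0 < m" using that by (cases m) (auto simp: blk_def)
      with that show ?thesis by (intro div_nat_eqI) (auto simp: blk_def mult.commute)
    qed
    with that show ?thesis by blast
  qed
  have card_blk: "card (blk q) = m" for q by (simp add: blk_def)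
  have miss: "\<exists>q\<le>k. A \<inter> blk q = {}" if A: "A \<in> \<A>" for A
  proof (rule ccontr)
    assume "\<not> ?thesis"
    hence "\<forall>q\<in>{..k}. \<exists>x. x \<in> A \<inter> blk q" by auto
    then obtain g where g: "\<And>q. q \<in> {..k} \<Longrightarrow> g q \<in> A \<inter> blk q" by metis
    have "inj_on g {..k}"
      using g disj by (intro inj_onI) (metis IntD2 disjoint_iff)
    moreover have "g ` {..k} \<subseteq> A" using g by auto
    ultimately have "card {..k} \<le> card A" using \<A>D(2)[OF A] by (intro card_inj_on_le)
    thus False using \<A>D(3)[OF A] by simp
  qed
  \<comment> \<open>Assigning to each A the first block that it misses partitions the sets meeting
    Q, so that all kernels of one class \<open>B r\<close> ignore the same block r.\<close>
  define q where "q = (\<lambda>A. LEAST q. A \<inter> blk q = {})"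
  have q: "q A \<le> k" "A \<inter> blk (q A) = {}" if "A \<in> \<A>" for A
  proof -
    from miss[OF that] obtain q0 where q0: "q0 \<le> k" "A \<inter> blk q0 = {}" by blast
    show "A \<inter> blk (q A) = {}" unfolding q_def by (rule LeastI[of "\<lambda>q. A \<inter> blk q = {}", OF q0(2)])
    show "q A \<le> k" unfolding q_def using Least_le[of "\<lambda>q. A \<inter> blk q = {}", OF q0(2)] q0(1) by simp
  qed
  define B0 where "B0 = {A\<in>\<A>. A \<inter> Q = {}}"
  define B1 where "B1 = {A\<in>\<A>. A \<inter> Q \<noteq> {}}"
  define B where "B = (\<lambda>r. {A\<in>B1. q A = r})"
  have sub: "B0 \<subseteq> \<A>" "B1 \<subseteq> \<A>" "\<And>r. B r \<subseteq> \<A>" by (auto simp: B0_def B1_def B_def)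
  have [measurable]: "TS B0 \<in> borel_measurable P" "TS B1 \<in> borel_measurable P" "\<And>r. TS (B r) \<in> borel_measurable P"
    using sub by (auto intro!: TS_meas)
  have fB: "finite B0" "finite B1" using finite_\<A> sub by (auto intro: finite_subset)
  have T01: "TS \<A> w = TS B0 w + TS B1 w" for w
  proof -
    have "\<A> = B0 \<union> B1" "B0 \<inter> B1 = {}" by (auto simp: B0_def B1_def)
    thus ?thesis using fB unfolding TS_def by (simp add: sum.union_disjoint)
  qed
  have T1: "TS B1 w = (\<Sum>r\<le>k. TS (B r) w)" for w
    unfolding TS_def B_def using fB q(1) sub
    by (intro sum.group[symmetric]) auto
  have ind0: "TS B0 (w(i := x)) = TS B0 w" if "i \<in> Q" for i w x
    by (rule TS_fun_upd[OF sub(1)]) (use that in \<open>auto simp: B0_def\<close>)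
  have indr: "TS (B r) (w(i := x)) = TS (B r) w" if "i \<in> blk r" for i r w x
    by (rule TS_fun_upd[OF sub(3)]) (use that q(2) in \<open>auto simp: B_def B1_def\<close>)
  \<comment> \<open>With T0 the part of T that meets no block and T1 the rest, the remainder splits
    into three kinds of terms. \<open>R1\<close> is of higher order in T1 alone and gains from the
    small moment of T1; \<open>R0\<close> involves T0 only; \<open>Rr r\<close> is the product of a
    part of T1 ignoring block r with a function of T0, so it ignores block r as a whole.\<close>
  define R1 where "R1 = (\<lambda>w. iexp (\<tau> * TS B0 w) * (iexp (\<tau> * TS B1 w) - 1 - \<i> * (\<tau> * TS B1 w)))"
  define R0 where "R0 = (\<lambda>w. iexp (\<tau> * TS B0 w) - 1 - \<i> * (\<tau> * TS B0 w))"
  define Rr where "Rr = (\<lambda>r w. (\<i> * \<tau>) * (TS (B r) w * (iexp (\<tau> * TS B0 w) - 1)))"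
  have split: "iexp (\<tau> * TS \<A> w) - 1 - \<i> * (\<tau> * TS \<A> w) = R1 w + R0 w + (\<Sum>r\<le>k. Rr r w)" for w
  proof -
    have "iexp (\<tau> * TS \<A> w) = iexp (\<tau> * TS B0 w) * iexp (\<tau> * TS B1 w)"
      by (simp add: T01 distrib_left exp_add)
    moreover have "(\<Sum>r\<le>k. Rr r w) = (\<i> * \<tau>) * (TS B1 w * (iexp (\<tau> * TS B0 w) - 1))"
      unfolding Rr_def T1 by (simp add: sum_distrib_left sum_distrib_right del: of_real_mult)
    ultimately show ?thesis
      unfolding R1_def R0_def by (simp add: T01 algebra_simps)
  qed
  let ?c = "2 * \<bar>\<tau>\<bar> powr \<alpha> * (6 ^ k * \<gamma>)"
  have c0: "0 \<le> ?c" using \<gamma>_nonneg by simp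
  have iR1: "integrable P R1"
    by (rule Bochner_Integration.integrable_bound[OF integral_remainder_le(1)[OF sub(2), of \<tau>]])
      (auto simp: R1_def norm_mult simp del: of_real_mult)
  have iR0: "integrable P R0" unfolding R0_def by (rule integral_remainder_le(1)[OF sub(1)])
  have iRr0: "integrable P (\<lambda>w. complex_of_real (TS (B r) w) * (iexp (\<tau> * TS B0 w) - 1))" for r
  proof (rule Bochner_Integration.integrable_bound)
    show "integrable P (\<lambda>w. 2 * TS (B r) w)" using TS_integrable[OF sub(3)] by simp
    show "AE w in P. norm (complex_of_real (TS (B r) w) * (iexp (\<tau> * TS B0 w) - 1)) \<le> norm (2 * TS (B r) w)"
    proof (rule AE_I2)
      fix w
      have "\<bar>TS (B r) w\<bar> * cmod (iexp (\<tau> * TS B0 w) - 1) \<le> \<bar>TS (B r) w\<bar> * 2"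
        by (intro mult_left_mono norm_iexp_minus_one_le_2) auto
      thus "norm (complex_of_real (TS (B r) w) * (iexp (\<tau> * TS B0 w) - 1)) \<le> norm (2 * TS (B r) w)"
        by (simp add: norm_mult abs_mult del: of_real_mult)
    qed
  qed measurable
  have iRr: "integrable P (Rr r)" for r
    unfolding Rr_def by (intro integrable_mult_right iRr0)
  have "fS \<tau> - \<phi> \<tau> ^ n - \<i> * \<tau> * fLT \<tau> = (\<integral>w. iexp (\<tau> * LL n l w) * R1 w + iexp (\<tau> * LL n l w) * R0 w
      + (\<Sum>r\<le>k. iexp (\<tau> * LL n l w) * Rr r w) \<partial>P)"
    unfolding fS_diff_eq split distrib_left sum_distrib_left ..
  also have "\<dots> = (\<integral>w. iexp (\<tau> * LL n l w) * R1 w \<partial>P) + (\<integral>w. iexp (\<tau> * LL n l w) * R0 w \<partial>P)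
      + (\<Sum>r\<le>k. (\<integral>w. iexp (\<tau> * LL n l w) * Rr r w \<partial>P))"
    using iexp_LL_mult_integrable[OF iR1, of \<tau>] iexp_LL_mult_integrable[OF iR0, of \<tau>] iexp_LL_mult_integrable[OF iRr, of \<tau>]
    by (simp only: Bochner_Integration.integral_add Bochner_Integration.integrable_add
        Bochner_Integration.integral_sum Bochner_Integration.integrable_sum)
  finally have eq: "fS \<tau> - \<phi> \<tau> ^ n - \<i> * \<tau> * fLT \<tau> = \<dots>" .
  have le1: "cmod (\<integral>w. iexp (\<tau> * LL n l w) * R1 w \<partial>P) \<le> ?c * (real ((k + 1) * m) * (real k / real n))"
  proof -
    have "cmod (\<integral>w. iexp (\<tau> * LL n l w) * R1 w \<partial>P) \<le> cmod (\<phi> \<tau>) ^ card ({}::nat set) * (\<integral>w. cmod (R1 w) \<partial>P)"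
      by (rule integral_iexp_LL_mult(3)) (use iR1 in auto)
    also have "\<dots> = (\<integral>w. cmod (iexp (\<tau> * TS B1 w) - 1 - \<i> * (\<tau> * TS B1 w)) \<partial>P)"
      by (simp add: R1_def norm_mult del: of_real_mult)
    also have "\<dots> \<le> 2 * \<bar>\<tau>\<bar> powr \<alpha> * (\<integral>w. \<bar>TS B1 w\<bar> powr \<alpha> \<partial>P)"
      by (rule integral_remainder_le(2)[OF sub(2)])
    also have "\<dots> \<le> 2 * \<bar>\<tau>\<bar> powr \<alpha> * (6 ^ k * (\<Sum>A\<in>B1. mom (card A)))"
      by (intro mult_left_mono TS_moment(2) sub) auto
    also have "\<dots> \<le> 2 * \<bar>\<tau>\<bar> powr \<alpha> * (6 ^ k * (real (card Q) * (real k / real n) * \<gamma>))"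
      unfolding B1_def by (intro mult_left_mono sum_mom_hit QI) auto
    also have "\<dots> = ?c * (real ((k + 1) * m) * (real k / real n))" by (simp add: Q_def)
    finally show ?thesis .
  qed
  \<comment> \<open>\<open>R0\<close> ignores all blocks; block 0 suffices for the factor with
    exponent m.\<close>
  have le0: "cmod (\<integral>w. iexp (\<tau> * LL n l w) * R0 w \<partial>P) \<le> ?c * cmod (\<phi> \<tau>) ^ m"
  proof -
    have "cmod (\<integral>w. iexp (\<tau> * LL n l w) * R0 w \<partial>P) \<le> cmod (\<phi> \<tau>) ^ card (blk 0) * (\<integral>w. cmod (R0 w) \<partial>P)"
    proof (rule integral_iexp_LL_mult(3)[OF _ iR0])
      show "blk 0 \<subseteq> I" using blkQ[of 0] QI by auto
      fix i w x assume "i \<in> blk 0"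
      hence "i \<in> Q" using blkQ[of 0] by auto
      from ind0[OF this] show "R0 (w(i := x)) = R0 w" by (simp only: R0_def)
    qed
    also have "\<dots> \<le> cmod (\<phi> \<tau>) ^ card (blk 0) * ?c"
      unfolding R0_def
      by (intro mult_left_mono order_trans[OF integral_remainder_le(2)[OF sub(1)] mult_left_mono[OF TS_moment_le_\<gamma>[OF sub(1)]]]) auto
    finally show ?thesis by (simp only: card_blk mult.commute)
  qed
  have ler: "cmod (\<integral>w. iexp (\<tau> * LL n l w) * Rr r w \<partial>P) \<le> ?c * 2 * cmod (\<phi> \<tau>) ^ m" if r: "r \<le> k" for r
  proof -
    have A0: "cmod (\<integral>w. iexp (\<tau> * LL n l w) * Rr r w \<partial>P) \<le> cmod (\<phi> \<tau>) ^ card (blk r) * (\<integral>w. cmod (Rr r w) \<partial>P)"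
    proof (rule integral_iexp_LL_mult(3)[OF _ iRr])
      show "blk r \<subseteq> I" using blkQ[OF r] QI by auto
      fix i w x assume i: "i \<in> blk r"
      hence "i \<in> Q" using blkQ[OF r] by auto
      from ind0[OF this] indr[OF i] show "Rr r (w(i := x)) = Rr r w" by (simp only: Rr_def)
    qed
    note A = A0[unfolded card_blk]
    have "(\<integral>w. cmod (Rr r w) \<partial>P) \<le> (\<integral>w. 2 * \<bar>\<tau>\<bar> powr \<alpha> * (\<bar>TS (B r) w\<bar> powr \<alpha> + \<bar>TS B0 w\<bar> powr \<alpha>) \<partial>P)"
    proof (rule integral_mono)
      show "integrable P (\<lambda>w. cmod (Rr r w))" using iRr by (rule integrable_norm)
      show "integrable P (\<lambda>w. 2 * \<bar>\<tau>\<bar> powr \<alpha> * (\<bar>TS (B r) w\<bar> powr \<alpha> + \<bar>TS B0 w\<bar> powr \<alpha>))"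
        using TS_moment(1)[OF sub(1)] TS_moment(1)[OF sub(3)] by simp
      fix w
      have "cmod (Rr r w) = \<bar>\<tau>\<bar> * (\<bar>TS (B r) w\<bar> * cmod (iexp (\<tau> * TS B0 w) - 1))"
        by (simp add: Rr_def norm_mult del: of_real_mult)
      \<comment> \<open>Bounding the exponential with exponent \<alpha> - 1 instead of 1 keeps the
        total degree in the statistic at \<alpha>; a product of two linear terms would require
        second moments.\<close>
      also have "\<dots> \<le> \<bar>\<tau>\<bar> * (\<bar>TS (B r) w\<bar> * (2 * \<bar>\<tau> * TS B0 w\<bar> powr (\<alpha> - 1)))"
        using \<alpha> by (intro mult_left_mono norm_iexp_minus_one_le) auto
      also have "\<dots> = 2 * (\<bar>\<tau>\<bar> * \<bar>\<tau>\<bar> powr (\<alpha> - 1)) * (\<bar>TS (B r) w\<bar> * \<bar>TS B0 w\<bar> powr (\<alpha> - 1))"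
        by (simp add: powr_abs_mult)
      also have "\<bar>\<tau>\<bar> * \<bar>\<tau>\<bar> powr (\<alpha> - 1) = \<bar>\<tau>\<bar> powr \<alpha>"
        by (cases "\<tau> = 0") (use \<alpha> in \<open>auto simp: powr_mult_base\<close>)
      also have "2 * \<bar>\<tau>\<bar> powr \<alpha> * (\<bar>TS (B r) w\<bar> * \<bar>TS B0 w\<bar> powr (\<alpha> - 1)) \<le>
          2 * \<bar>\<tau>\<bar> powr \<alpha> * (\<bar>TS (B r) w\<bar> powr \<alpha> + \<bar>TS B0 w\<bar> powr \<alpha>)"
        using \<alpha> by (intro mult_left_mono mult_powr_le) auto
      finally show "cmod (Rr r w) \<le> 2 * \<bar>\<tau>\<bar> powr \<alpha> * (\<bar>TS (B r) w\<bar> powr \<alpha> + \<bar>TS B0 w\<bar> powr \<alpha>)" .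
    qed
    also have "\<dots> = 2 * \<bar>\<tau>\<bar> powr \<alpha> * ((\<integral>w. \<bar>TS (B r) w\<bar> powr \<alpha> \<partial>P) + (\<integral>w. \<bar>TS B0 w\<bar> powr \<alpha> \<partial>P))"
      using TS_moment(1)[OF sub(1)] TS_moment(1)[OF sub(3)] by simp
    also have "\<dots> \<le> 2 * \<bar>\<tau>\<bar> powr \<alpha> * (6 ^ k * \<gamma> + 6 ^ k * \<gamma>)"
      by (intro mult_left_mono add_mono TS_moment_le_\<gamma> sub) auto
    also have "\<dots> = ?c * 2" by simp
    finally have "cmod (\<phi> \<tau>) ^ m * (\<integral>w. cmod (Rr r w) \<partial>P) \<le> cmod (\<phi> \<tau>) ^ m * (?c * 2)"
      by (intro mult_left_mono) auto
    with A show ?thesis by (simp only: mult.commute)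
  qed
  have "cmod (fS \<tau> - \<phi> \<tau> ^ n - \<i> * \<tau> * fLT \<tau>) \<le>
    cmod (\<integral>w. iexp (\<tau> * LL n l w) * R1 w \<partial>P) + cmod (\<integral>w. iexp (\<tau> * LL n l w) * R0 w \<partial>P)
      + (\<Sum>r\<le>k. cmod (\<integral>w. iexp (\<tau> * LL n l w) * Rr r w \<partial>P))"
    unfolding eq by (intro norm_triangle_le add_mono norm_sum order_refl norm_triangle_ineq)
  also have "\<dots> \<le> ?c * (real ((k + 1) * m) * (real k / real n)) + ?c * cmod (\<phi> \<tau>) ^ m + (\<Sum>r\<le>k. ?c * 2 * cmod (\<phi> \<tau>) ^ m)"
    by (intro add_mono le1 le0 sum_mono ler) auto
  \<comment> \<open>2k + 3 is 1 from \<open>R0\<close> plus 2 for each of the k + 1 terms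
    \<open>Rr\<close>.\<close>
  also have "\<dots> = ?c * (real ((k + 1) * m) * (real k / real n) + (2 * real k + 3) * cmod (\<phi> \<tau>) ^ m)"
    by (simp add: algebra_simps)
  finally show ?thesis .
qed

section \<open>The first-order term, evaluated by degeneracy\<close>

definition ahat :: "real \<Rightarrow> nat \<Rightarrow> complex" where
  "ahat \<tau> j = (\<integral>x. (\<Prod>i<j. iexp (\<tau> * l (x i)) - 1) * t j x \<partial>iid {..<j})"

lemma norm_prod_iexp_le:
  "cmod ((\<Prod>i\<in>B. iexp (\<tau> * l (w i)) - 1) * (\<Prod>i\<in>B'. iexp (\<tau> * l (w i)))) \<le> 2 ^ card B"
proof -
  have "cmod (\<Prod>i\<in>B'. iexp (\<tau> * l (w i))) = 1"
    by (simp add: prod_norm[symmetric] del: of_real_mult)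
  moreover have "cmod (\<Prod>i\<in>B. iexp (\<tau> * l (w i)) - 1) \<le> (\<Prod>i\<in>B. 2)"
    unfolding prod_norm[symmetric] by (intro prod_mono conjI norm_iexp_minus_one_le_2) auto
  ultimately show ?thesis by (simp add: norm_mult del: of_real_mult)
qed

text \<open>Subtracting 1 from one exponential changes the integrand by a term in which only the
  kernel depends on that coordinate, and degeneracy makes its integral 0. The set B records the
  positions already changed, as the induction requires.\<close>

lemma integral_prod_iexp_TA:
  assumes A: "A \<in> \<A>" and BA: "B \<subseteq> A"
  shows "(\<integral>w. ((\<Prod>i\<in>B. iexp (\<tau> * l (w i)) - 1) * (\<Prod>i\<in>A - B. iexp (\<tau> * l (w i)))) * TA t A w \<partial>P) =
    (\<integral>w. (\<Prod>i\<in>A. iexp (\<tau> * l (w i))) * TA t A w \<partial>P)"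
proof -
  have [measurable]: "TA t A \<in> borel_measurable P" using A by (rule TA_meas)
  have AI: "A \<subseteq> I" using \<A>D(1)[OF A] .
  have fA: "finite A" using \<A>D(2)[OF A] .
  have cm[measurable]: "(\<lambda>w. l (w i)) \<in> borel_measurable P" if "i \<in> A" for i
    using that AI by (intro measurable_compose[OF measurable_component_singleton[of i I "\<lambda>_. M"] lM]) auto
  have iT: "integrable P (\<lambda>w. complex_of_real (TA t A w))" using TA_integrable[OF A] by simp
  have pint: "integrable P (\<lambda>w. ((\<Prod>i\<in>B. iexp (\<tau> * l (w i)) - 1) * (\<Prod>i\<in>B'. iexp (\<tau> * l (w i)))) * TA t A w)"
    if "B \<subseteq> A" "B' \<subseteq> A" for B B'
  proof (rule Bochner_Integration.integrable_bound)
    show "integrable P (\<lambda>w. 2 ^ card B * TA t A w)" using TA_integrable[OF A] by simp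
    show "AE w in P. norm (((\<Prod>i\<in>B. iexp (\<tau> * l (w i)) - 1) * (\<Prod>i\<in>B'. iexp (\<tau> * l (w i)))) * TA t A w) \<le> norm (2 ^ card B * TA t A w)"
      using norm_prod_iexp_le[of \<tau> _ B B']
      by (intro AE_I2) (auto simp: norm_mult[of _ "complex_of_real _"] abs_mult intro!: mult_right_mono simp del: of_real_mult)
    have pm: "(\<lambda>w. \<Prod>i\<in>C. g (l (w i))) \<in> borel_measurable P"
      if "C \<subseteq> A" "g \<in> borel_measurable borel" for C and g :: "real \<Rightarrow> complex"
      using that by (intro borel_measurable_prod measurable_compose[OF cm]) auto
    have "(\<lambda>w. \<Prod>i\<in>B. iexp (\<tau> * l (w i)) - 1) \<in> borel_measurable P"
      by (rule pm[OF \<open>B \<subseteq> A\<close>]) measurable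
    moreover have "(\<lambda>w. \<Prod>i\<in>B'. iexp (\<tau> * l (w i))) \<in> borel_measurable P"
      by (rule pm[OF \<open>B' \<subseteq> A\<close>]) measurable
    ultimately show "(\<lambda>w. ((\<Prod>i\<in>B. iexp (\<tau> * l (w i)) - 1) * (\<Prod>i\<in>B'. iexp (\<tau> * l (w i)))) * TA t A w) \<in> borel_measurable P"
      by measurable
  qed
  have "finite B" using BA fA by (rule finite_subset)
  thus ?thesis using BA
  proof (induction B rule: finite_induct)
    case (insert i B)
    let ?R = "\<lambda>w. (\<Prod>i\<in>B. iexp (\<tau> * l (w i)) - 1) * (\<Prod>i\<in>A - insert i B. iexp (\<tau> * l (w i)))"
    have iA: "i \<in> A" "i \<in> I" using insert.prems AI by auto
    have e: "(\<Prod>i\<in>A - B. iexp (\<tau> * l (w i))) = iexp (\<tau> * l (w i)) * (\<Prod>i\<in>A - insert i B. iexp (\<tau> * l (w i)))" for w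
      unfolding Diff_insert[of A i B] by (rule prod.remove) (use fA iA insert.hyps in auto)
    have "(\<integral>w. ((\<Prod>i\<in>insert i B. iexp (\<tau> * l (w i)) - 1) * (\<Prod>i\<in>A - insert i B. iexp (\<tau> * l (w i)))) * TA t A w \<partial>P) =
      (\<integral>w. ((\<Prod>i\<in>B. iexp (\<tau> * l (w i)) - 1) * (\<Prod>i\<in>A - B. iexp (\<tau> * l (w i)))) * TA t A w - ?R w * TA t A w \<partial>P)"
      using insert.hyps unfolding e
      by (intro Bochner_Integration.integral_cong refl) (simp add: algebra_simps)
    also have "\<dots> = (\<integral>w. ((\<Prod>i\<in>B. iexp (\<tau> * l (w i)) - 1) * (\<Prod>i\<in>A - B. iexp (\<tau> * l (w i)))) * TA t A w \<partial>P) - (\<integral>w. ?R w * TA t A w \<partial>P)"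
      by (intro Bochner_Integration.integral_diff pint) (use insert.prems in auto)
    also have "(\<integral>w. ?R w * TA t A w \<partial>P) = 0"
    proof (rule integral_degenerate_eq_0[OF _ iA(2) TA_degenerate[OF A iA(1)]])
      show "integrable P (\<lambda>w. ?R w * of_real (TA t A w))"
        by (intro pint) (use insert.prems in auto)
      fix w x
      have "(\<Prod>r\<in>B. iexp (\<tau> * l ((w(i := x)) r)) - 1) = (\<Prod>r\<in>B. iexp (\<tau> * l (w r)) - 1)"
        using insert.hyps by (intro prod.cong) auto
      moreover have "(\<Prod>r\<in>A - insert i B. iexp (\<tau> * l ((w(i := x)) r))) = (\<Prod>r\<in>A - insert i B. iexp (\<tau> * l (w r)))"
        by (intro prod.cong) auto
      ultimately show "?R (w(i := x)) = ?R w" by (simp only:)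
    qed simp
    finally show ?case using insert by simp
  qed simp
qed

text \<open>The indices outside A are independent of the kernel and give the powers of \<phi>;
  inside A each exponential may be reduced by 1.\<close>

lemma integral_iexp_LL_TA:
  assumes A: "A \<in> \<A>"
  shows "(\<integral>w. iexp (\<tau> * LL n l w) * TA t A w \<partial>P) = \<phi> \<tau> ^ (n - card A) * ahat \<tau> (card A)"
proof -
  have "I - (I - A) = A" using \<A>D(1)[OF A] by auto
  moreover have "card (I - A) = n - card A" using \<A>D[OF A] by (simp add: card_Diff_subset)
  ultimately have "(\<integral>w. iexp (\<tau> * LL n l w) * TA t A w \<partial>P) = \<phi> \<tau> ^ (n - card A) * (\<integral>w. (\<Prod>i\<in>A. iexp (\<tau> * l (w i))) * TA t A w \<partial>P)"
    using integral_iexp_LL_mult(2)[of "I - A" "\<lambda>w. complex_of_real (TA t A w)" \<tau>] TA_integrable[OF A] TA_fun_upd[OF \<A>D(2)[OF A]]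
    by (simp del: of_real_mult fun_upd_apply)
  also have "(\<integral>w. (\<Prod>i\<in>A. iexp (\<tau> * l (w i))) * TA t A w \<partial>P) = (\<integral>w. (\<Prod>i\<in>A. iexp (\<tau> * l (w i)) - 1) * TA t A w \<partial>P)"
    using integral_prod_iexp_TA[OF A order_refl, of \<tau>] by (simp del: of_real_mult)
  also have "\<dots> = ahat \<tau> (card A)"
    unfolding ahat_def by (rule integral_prod_TA(2)[OF A]) measurable
  finally show ?thesis .
qed

lemma fLT_eq: "fLT \<tau> = (\<Sum>j=1..k. (n choose j) * \<phi> \<tau> ^ (n - j) * ahat \<tau> j)"
proof -
  have "fLT \<tau> = (\<Sum>A\<in>\<A>. \<integral>w. iexp (\<tau> * LL n l w) * TA t A w \<partial>P)"
    unfolding fLT_def TS_def of_real_sum sum_distrib_left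
    by (intro Bochner_Integration.integral_sum iexp_LL_mult_integrable integrable_of_real TA_integrable)
  also have "\<dots> = (\<Sum>A\<in>{A\<in>\<A>. True}. \<phi> \<tau> ^ (n - card A) * ahat \<tau> (card A))"
    by (intro sum.cong integral_iexp_LL_TA) auto
  also have "\<dots> = (\<Sum>j=1..k. \<Sum>A\<in>{A. A \<subseteq> I \<and> card A = j \<and> True}. \<phi> \<tau> ^ (n - card A) * ahat \<tau> (card A))"
    by (rule sum_\<A>)
  also have "\<dots> = (\<Sum>j=1..k. (n choose j) * \<phi> \<tau> ^ (n - j) * ahat \<tau> j)"
    using n_subsets[of I] by (intro sum.cong refl) (simp add: mult.assoc)
  finally show ?thesis .
qed

end

section \<open>Characteristic function of the linear part\<close>

text \<open>The upper bound follows from exp y \<ge> 1 + y + y^2/2, since the product of this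
  polynomial with 1 - y + y^2/2 is 1 + (y^2/2)^2.\<close>

lemma exp_minus_second_order:
  fixes y :: real
  assumes "0 \<le> y"
  shows "\<bar>exp (- y) - (1 - y)\<bar> \<le> y\<^sup>2 / 2"
proof -
  have "1 - y \<le> exp (- y)" using exp_ge_add_one_self[of "- y"] by simp
  moreover have "exp (- y) \<le> 1 - y + y\<^sup>2 / 2"
  proof -
    have "1 \<le> (1 - y + y\<^sup>2 / 2) * (1 + y + y\<^sup>2 / 2)"
    proof -
      have "(1 - y + y\<^sup>2 / 2) * (1 + y + y\<^sup>2 / 2) = 1 + (y\<^sup>2 / 2)\<^sup>2"
        by (simp add: power2_eq_square algebra_simps)
      thus ?thesis by simp
    qed
    also have "\<dots> \<le> (1 - y + y\<^sup>2 / 2) * exp y"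
    proof (rule mult_left_mono[OF exp_lower_Taylor_quadratic[OF assms]])
      have "0 \<le> (1 - y)\<^sup>2 + 1" by simp
      thus "0 \<le> 1 - y + y\<^sup>2 / 2" by (simp add: power2_eq_square algebra_simps)
    qed
    finally show ?thesis by (simp add: exp_minus field_simps)
  qed
  ultimately show ?thesis by linarith
qed

text \<open>Rescaling by r reduces to numbers in the unit disc. The point is the retained factor r ^
  N, which carries the Gaussian decay.\<close>

lemma norm_power_diff_le:
  fixes z w :: complex and r :: real
  assumes "cmod z \<le> r" "cmod w \<le> r" "0 < r"
  shows "cmod (z ^ N - w ^ N) \<le> r ^ N / r * (real N * cmod (z - w))"
proof -
  have "cmod ((z / r) ^ N - (w / r) ^ N) \<le> real N * cmod (z / r - w / r)"
    using assms by (intro norm_power_diff) (auto simp: norm_divide)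
  hence "r ^ N * cmod ((z / r) ^ N - (w / r) ^ N) \<le> r ^ N * (real N * cmod (z / r - w / r))"
    using assms by (intro mult_left_mono) auto
  moreover have "r ^ N * cmod ((z / r) ^ N - (w / r) ^ N) = cmod (z ^ N - w ^ N)"
  proof -
    have "z ^ N - w ^ N = of_real (r ^ N) * ((z / r) ^ N - (w / r) ^ N)"
      using assms by (simp add: power_divide right_diff_distrib)
    hence "cmod (z ^ N - w ^ N) = \<bar>r ^ N\<bar> * cmod ((z / r) ^ N - (w / r) ^ N)"
      by (simp only: norm_mult norm_of_real)
    thus ?thesis using assms by simp
  qed
  moreover have "cmod (z / r - w / r) = cmod (z - w) / r"
    using assms by (simp add: norm_divide flip: diff_divide_distrib)
  ultimately show ?thesis by (simp add: field_simps)
qed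

text \<open>Factors are exchanged one by one; the domination of w by u lets every factor other than
  the exchanged one be bounded by that of u.\<close>

lemma norm_prod_diff_telescope:
  fixes w u :: "nat \<Rightarrow> complex"
  assumes "\<And>i. cmod (w i) \<le> cmod (u i)"
  shows "cmod ((\<Prod>i<j. w i) - (\<Prod>i<j. u i)) \<le> (\<Sum>r<j. cmod (w r - u r) * (\<Prod>i\<in>{..<j} - {r}. cmod (u i)))"
proof (induction j)
  case (Suc j)
  have "(\<Prod>i<Suc j. w i) - (\<Prod>i<Suc j. u i) = w j * ((\<Prod>i<j. w i) - (\<Prod>i<j. u i)) + (w j - u j) * (\<Prod>i<j. u i)"
    by (simp add: algebra_simps)
  hence "cmod ((\<Prod>i<Suc j. w i) - (\<Prod>i<Suc j. u i)) \<le>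
    cmod (w j) * cmod ((\<Prod>i<j. w i) - (\<Prod>i<j. u i)) + cmod (w j - u j) * cmod (\<Prod>i<j. u i)"
    by (metis norm_mult norm_triangle_ineq)
  also have "\<dots> \<le> cmod (u j) * (\<Sum>r<j. cmod (w r - u r) * (\<Prod>i\<in>{..<j} - {r}. cmod (u i))) + cmod (w j - u j) * (\<Prod>i<j. cmod (u i))"
    by (intro add_mono mult_mono assms Suc.IH) (auto simp: prod_norm intro!: sum_nonneg mult_nonneg_nonneg prod_nonneg)
  also have "cmod (u j) * (\<Sum>r<j. cmod (w r - u r) * (\<Prod>i\<in>{..<j} - {r}. cmod (u i))) =
    (\<Sum>r<j. cmod (w r - u r) * (\<Prod>i\<in>{..<Suc j} - {r}. cmod (u i)))"
    unfolding sum_distrib_left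
  proof (rule sum.cong[OF refl])
    fix r assume "r \<in> {..<j}"
    hence "{..<Suc j} - {r} = insert j ({..<j} - {r})" by auto
    thus "cmod (u j) * (cmod (w r - u r) * (\<Prod>i\<in>{..<j} - {r}. cmod (u i))) = cmod (w r - u r) * (\<Prod>i\<in>{..<Suc j} - {r}. cmod (u i))"
      by simp
  qed
  also have "(\<Prod>i<j. cmod (u i)) = (\<Prod>i\<in>{..<Suc j} - {j}. cmod (u i))"
    by (rule prod.cong) auto
  finally show ?case by simp
qed simp

section \<open>Decay of \<phi> for \<tau> \<le> 1/\<beta> and its comparison with the normal
  characteristic function\<close>

context ustat
begin

lemma n_pos: "real n > 0" using n1 by simp

lemma int_l2: "(\<integral>x. (l x)\<^sup>2 \<partial>M) = 1 / real n"
  using l2 n_pos by (simp add: field_simps)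

lemma int_l3: "(\<integral>x. \<bar>l x\<bar> ^ 3 \<partial>M) = \<beta> / real n"
  using n_pos by (simp add: beta_def)

text \<open>The third moment dominates the second one: n E L^2 = 1 forces \<beta> \<ge> n^(-1/2).
  This is what makes \<tau>^2 \<le> n for all \<tau> \<le> 1/\<beta> and turns errors of order 1/n
  into errors of order \<beta>.\<close>

lemma \<beta>_ge: "1 \<le> real n * \<beta>\<^sup>2" and \<beta>_pos: "0 < \<beta>"
proof -
  define s where "s = 1 / sqrt (real n)"
  have s: "s > 0" "s\<^sup>2 = 1 / real n" using n_pos by (auto simp: s_def power_divide)
  \<comment> \<open>A cubic in |l x| with a double zero at s, the standard deviation of L_1;
    integrating it replaces an appeal to Hoelder's inequality.\<close>
  have pw: "3 * (l x)\<^sup>2 \<le> 2 / s * \<bar>l x\<bar> ^ 3 + s\<^sup>2" for x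
  proof -
    have "0 \<le> (\<bar>l x\<bar> - s)\<^sup>2 * (2 * \<bar>l x\<bar> + s)" using s by simp
    also have "\<dots> = 2 * \<bar>l x\<bar> ^ 3 + s ^ 3 - 3 * s * \<bar>l x\<bar>\<^sup>2"
      by (simp add: power2_eq_square power3_eq_cube algebra_simps)
    finally have "3 * (l x)\<^sup>2 * s \<le> (2 / s * \<bar>l x\<bar> ^ 3 + s\<^sup>2) * s"
      using s by (simp add: algebra_simps power2_eq_square power3_eq_cube)
    thus ?thesis using s by simp
  qed
  have "(\<integral>x. 3 * (l x)\<^sup>2 \<partial>M) \<le> (\<integral>x. 2 / s * \<bar>l x\<bar> ^ 3 + s\<^sup>2 \<partial>M)"
    using l2_int l3_int pw by (intro integral_mono) auto
  hence "3 / real n \<le> 2 / s * (\<beta> / real n) + s\<^sup>2"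
    using l2_int l3_int by (simp add: int_l2 int_l3 prob_space mult.commute)
  hence "2 / real n \<le> 2 / s * (\<beta> / real n)" using s by simp
  hence sb: "s \<le> \<beta>" using s n_pos by (simp add: field_simps)
  thus "0 < \<beta>" using s by linarith
  have "1 / real n \<le> \<beta>\<^sup>2" using power_mono[OF sb, of 2] s by simp
  thus "1 \<le> real n * \<beta>\<^sup>2" using n_pos by (simp add: field_simps)
qed

lemma norm_\<phi>_approx: "cmod (\<phi> \<tau> - (1 - \<tau>\<^sup>2 / (2 * real n))) \<le> \<bar>\<tau>\<bar> ^ 3 * \<beta> / (6 * real n)"
proof -
  have i1: "integrable M (\<lambda>x. \<i> * complex_of_real (\<tau> * l x))"
    using l_int by (intro integrable_mult_right integrable_of_real) auto
  have i2: "integrable M (\<lambda>x. complex_of_real (\<tau>\<^sup>2 / 2 * (l x)\<^sup>2))"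
    using l2_int by (intro integrable_of_real) auto
  have id: "integrable M (\<lambda>x. iexp (\<tau> * l x) - 1 - \<i> * complex_of_real (\<tau> * l x) + complex_of_real (\<tau>\<^sup>2 / 2 * (l x)\<^sup>2))"
    by (intro Bochner_Integration.integrable_add Bochner_Integration.integrable_diff integrable_iexp_l i1 i2) simp
  have "(\<integral>x. iexp (\<tau> * l x) - 1 - \<i> * complex_of_real (\<tau> * l x) + complex_of_real (\<tau>\<^sup>2 / 2 * (l x)\<^sup>2) \<partial>M) =
    (\<integral>x. iexp (\<tau> * l x) \<partial>M) - (\<integral>x. 1 \<partial>M) - (\<integral>x. \<i> * complex_of_real (\<tau> * l x) \<partial>M) + (\<integral>x. complex_of_real (\<tau>\<^sup>2 / 2 * (l x)\<^sup>2) \<partial>M)"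
    using integrable_iexp_l[of \<tau>] i1 i2
    by (simp only: Bochner_Integration.integral_add Bochner_Integration.integral_diff Bochner_Integration.integrable_diff Bochner_Integration.integrable_add integrable_const)
  also have "(\<integral>x. \<i> * complex_of_real (\<tau> * l x) \<partial>M) = \<i> * complex_of_real (\<integral>x. \<tau> * l x \<partial>M)"
    by (simp only: integral_mult_right_zero integral_complex_of_real)
  also have "(\<integral>x. \<tau> * l x \<partial>M) = 0" using l_mean by simp
  also have "(\<integral>x. complex_of_real (\<tau>\<^sup>2 / 2 * (l x)\<^sup>2) \<partial>M) = complex_of_real (\<tau>\<^sup>2 / 2 * (1 / real n))"
    unfolding int_l2[symmetric] by (simp only: integral_mult_right_zero integral_complex_of_real)
  finally have eq: "\<phi> \<tau> - (1 - \<tau>\<^sup>2 / (2 * real n)) =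
    (\<integral>x. iexp (\<tau> * l x) - 1 - \<i> * complex_of_real (\<tau> * l x) + complex_of_real (\<tau>\<^sup>2 / 2 * (l x)\<^sup>2) \<partial>M)"
    by (simp add: \<phi>_def prob_space del: of_real_mult)
  have "cmod (\<phi> \<tau> - (1 - \<tau>\<^sup>2 / (2 * real n))) \<le>
    (\<integral>x. cmod (iexp (\<tau> * l x) - 1 - \<i> * complex_of_real (\<tau> * l x) + complex_of_real (\<tau>\<^sup>2 / 2 * (l x)\<^sup>2)) \<partial>M)"
    unfolding eq by (rule integral_norm_bound)
  also have "\<dots> \<le> (\<integral>x. \<bar>\<tau>\<bar> ^ 3 / 6 * \<bar>l x\<bar> ^ 3 \<partial>M)"
  proof (rule integral_mono)
    show "integrable M (\<lambda>x. cmod (iexp (\<tau> * l x) - 1 - \<i> * complex_of_real (\<tau> * l x) + complex_of_real (\<tau>\<^sup>2 / 2 * (l x)\<^sup>2)))"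
      using id by (rule integrable_norm)
    show "integrable M (\<lambda>x. \<bar>\<tau>\<bar> ^ 3 / 6 * \<bar>l x\<bar> ^ 3)" using l3_int by simp
    fix x
    let ?y = "\<tau> * l x"
    have "iexp ?y - (\<Sum>k\<le>2. (\<i> * complex_of_real ?y) ^ k / fact k) = iexp ?y - 1 - \<i> * complex_of_real ?y + complex_of_real (\<tau>\<^sup>2 / 2 * (l x)\<^sup>2)"
      by (simp add: numeral_2_eq_2 power_mult_distrib)
    hence "cmod (iexp ?y - 1 - \<i> * complex_of_real ?y + complex_of_real (\<tau>\<^sup>2 / 2 * (l x)\<^sup>2)) \<le> \<bar>?y\<bar> ^ Suc 2 / fact (Suc 2)"
      using iexp_approx1[of ?y 2] by (simp only:)
    also have "\<dots> = \<bar>\<tau>\<bar> ^ 3 / 6 * \<bar>l x\<bar> ^ 3" by (simp add: abs_mult power_mult_distrib fact_numeral)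
    finally show "cmod (iexp ?y - 1 - \<i> * complex_of_real ?y + complex_of_real (\<tau>\<^sup>2 / 2 * (l x)\<^sup>2)) \<le> \<bar>\<tau>\<bar> ^ 3 / 6 * \<bar>l x\<bar> ^ 3" .
  qed
  also have "\<dots> = \<bar>\<tau>\<bar> ^ 3 * \<beta> / (6 * real n)" by (simp add: int_l3)
  finally show ?thesis .
qed

lemma tau_sq_le:
  assumes "0 < \<tau>" "\<tau> \<le> 1 / \<beta>"
  shows "\<tau>\<^sup>2 \<le> real n"
proof -
  have "\<tau>\<^sup>2 \<le> (1 / \<beta>)\<^sup>2" using assms by (intro power_mono) auto
  also have "\<dots> \<le> real n" using \<beta>_ge \<beta>_pos by (simp add: power_divide field_simps)
  finally show ?thesis .
qed

text \<open>With \<tau> \<beta> \<le> 1 the cubic error is at most \<tau>^2/(6n), and 1/2 - 1/6 =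
  1/3.\<close>

lemma norm_\<phi>_le:
  assumes \<tau>: "0 < \<tau>" "\<tau> \<le> 1 / \<beta>"
  shows "cmod (\<phi> \<tau>) \<le> exp (- \<tau>\<^sup>2 / (3 * real n))"
proof -
  have sq: "\<tau>\<^sup>2 \<le> real n" by (rule tau_sq_le[OF \<tau>])
  have tb: "\<tau> * \<beta> \<le> 1" using \<tau> \<beta>_pos by (simp add: field_simps)
  have "\<bar>\<tau>\<bar> ^ 3 * \<beta> = \<tau>\<^sup>2 * (\<tau> * \<beta>)" using \<tau> by (simp add: power2_eq_square power3_eq_cube)
  also have "\<dots> \<le> \<tau>\<^sup>2 * 1" using tb by (intro mult_left_mono) auto
  finally have 3: "\<bar>\<tau>\<bar> ^ 3 * \<beta> / (6 * real n) \<le> \<tau>\<^sup>2 / (6 * real n)" using n_pos by (simp add: divide_right_mono)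
  have nn: "0 \<le> 1 - \<tau>\<^sup>2 / (2 * real n)" using sq n_pos by (simp add: field_simps)
  have "cmod (\<phi> \<tau>) \<le> cmod (complex_of_real (1 - \<tau>\<^sup>2 / (2 * real n))) + cmod (\<phi> \<tau> - complex_of_real (1 - \<tau>\<^sup>2 / (2 * real n)))"
    by (metis add.commute diff_add_cancel norm_triangle_ineq)
  also have "\<dots> \<le> (1 - \<tau>\<^sup>2 / (2 * real n)) + \<tau>\<^sup>2 / (6 * real n)"
    using norm_\<phi>_approx[of \<tau>] 3 nn by (simp only: norm_of_real)
  also have "\<dots> = 1 + (- \<tau>\<^sup>2 / (3 * real n))" using n_pos by (simp add: field_simps)
  also have "\<dots> \<le> exp (- \<tau>\<^sup>2 / (3 * real n))" by (rule exp_ge_add_one_self)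
  finally show ?thesis .
qed

text \<open>Each of the j \<le> k missing factors costs at most exp(1/3), because \<tau>^2 \<le>
  n.\<close>

lemma norm_\<phi>_power_le:
  assumes \<tau>: "0 < \<tau>" "\<tau> \<le> 1 / \<beta>" and j: "j \<le> k" "j \<le> n"
  shows "exp (- \<tau>\<^sup>2 / (3 * real n)) ^ (n - j) \<le> exp (real k / 3) * exp (- \<tau>\<^sup>2 / 3)"
    and "cmod (\<phi> \<tau>) ^ (n - j) \<le> exp (real k / 3) * exp (- \<tau>\<^sup>2 / 3)"
proof -
  have sq: "\<tau>\<^sup>2 / real n \<le> 1" using tau_sq_le[OF \<tau>] n_pos by simp
  have "real (n - j) * (- \<tau>\<^sup>2 / (3 * real n)) = - \<tau>\<^sup>2 / 3 + real j * (\<tau>\<^sup>2 / real n) / 3"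
    using j n_pos by (simp add: of_nat_diff field_simps)
  also have "real j * (\<tau>\<^sup>2 / real n) \<le> real k * 1"
    using j sq by (intro mult_mono) auto
  finally have "real (n - j) * (- \<tau>\<^sup>2 / (3 * real n)) \<le> real k / 3 + - \<tau>\<^sup>2 / 3" by simp
  hence "exp (real (n - j) * (- \<tau>\<^sup>2 / (3 * real n))) \<le> exp (real k / 3 + - \<tau>\<^sup>2 / 3)" by simp
  thus 1: "exp (- \<tau>\<^sup>2 / (3 * real n)) ^ (n - j) \<le> exp (real k / 3) * exp (- \<tau>\<^sup>2 / 3)"
    by (simp only: exp_of_nat_mult exp_add)
  have "cmod (\<phi> \<tau>) ^ (n - j) \<le> exp (- \<tau>\<^sup>2 / (3 * real n)) ^ (n - j)"
    by (intro power_mono norm_\<phi>_le \<tau>) auto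
  thus "cmod (\<phi> \<tau>) ^ (n - j) \<le> exp (real k / 3) * exp (- \<tau>\<^sup>2 / 3)" using 1 by linarith
qed

text \<open>The detour over \<psi> = exp(-\<tau>^2/(2n)) separates the error of replacing \<phi> by
  \<psi> in n - j factors from the effect of the j missing factors. A factor \<tau> is kept in
  front, because the smoothing inequality divides by \<tau>.\<close>

lemma norm_\<phi>_power_minus_normal_le:
  assumes \<tau>: "0 < \<tau>" "\<tau> \<le> 1 / \<beta>" and j: "j \<le> k" "j \<le> n" and \<beta>1: "\<beta> \<le> 1"
  shows "cmod (\<phi> \<tau> ^ (n - j) - exp (- \<tau>\<^sup>2 / 2)) \<le> exp (real k + 1) * (real k + 1) * \<beta> * \<tau> * (1 + \<tau>) ^ 3 * exp (- \<tau>\<^sup>2 / 3)"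
proof -
  define \<psi> where "\<psi> = exp (- (\<tau>\<^sup>2 / (2 * real n)))"
  define r where "r = exp (- \<tau>\<^sup>2 / (3 * real n))"
  have sq: "\<tau>\<^sup>2 \<le> real n" by (rule tau_sq_le[OF \<tau>])
  have sq': "\<tau>\<^sup>2 / real n \<le> 1" using sq n_pos by simp
  have r0: "r > 0" by (simp add: r_def)
  have \<psi>r: "\<psi> \<le> r" using n_pos by (simp add: \<psi>_def r_def divide_simps)
  \<comment> \<open>This converts the second-order error \<tau>^4/n^2 of the exponential into the
    shape \<tau>^3 \<beta>/n of the Taylor error of \<phi>.\<close>
  have "\<tau> \<le> real n * \<beta>"
  proof -
    have "1 / \<beta> \<le> real n * \<beta>" using \<beta>_ge \<beta>_pos by (simp add: field_simps power2_eq_square)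
    thus ?thesis using \<tau> by linarith
  qed
  hence t4: "\<tau> * \<tau> ^ 3 \<le> real n * \<beta> * \<tau> ^ 3" using \<tau> by (intro mult_right_mono) auto
  have "cmod (\<phi> \<tau> - \<psi>) \<le> cmod (\<phi> \<tau> - (1 - \<tau>\<^sup>2 / (2 * real n))) + cmod (complex_of_real (\<psi> - (1 - \<tau>\<^sup>2 / (2 * real n))))"
    using norm_triangle_ineq4[of "\<phi> \<tau> - (1 - \<tau>\<^sup>2 / (2 * real n))" "complex_of_real (\<psi> - (1 - \<tau>\<^sup>2 / (2 * real n)))"]
    by simp
  also have "\<dots> \<le> \<bar>\<tau>\<bar> ^ 3 * \<beta> / (6 * real n) + (\<tau>\<^sup>2 / (2 * real n))\<^sup>2 / 2"
    unfolding norm_of_real \<psi>_def using n_pos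
    by (intro add_mono norm_\<phi>_approx exp_minus_second_order) auto
  also have "(\<tau>\<^sup>2 / (2 * real n))\<^sup>2 / 2 = (\<tau> * \<tau> ^ 3) / (8 * (real n)\<^sup>2)"
    by (simp add: power_divide power_mult_distrib power2_eq_square power3_eq_cube)
  also have "\<dots> \<le> (real n * \<beta> * \<tau> ^ 3) / (8 * (real n)\<^sup>2)"
    using t4 by (rule divide_right_mono) simp
  also have "\<dots> = \<tau> ^ 3 * \<beta> / (8 * real n)" using n_pos by (simp add: power2_eq_square)
  also have "\<bar>\<tau>\<bar> ^ 3 * \<beta> / (6 * real n) + \<tau> ^ 3 * \<beta> / (8 * real n) \<le> \<tau> ^ 3 * \<beta> / real n"
    using n_pos \<tau> \<beta>_pos by (simp add: field_simps)
  finally have d: "cmod (\<phi> \<tau> - \<psi>) \<le> \<tau> ^ 3 * \<beta> / real n" by simp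
  have p1: "cmod (\<phi> \<tau> ^ (n - j) - complex_of_real \<psi> ^ (n - j)) \<le> exp (real k + 1) * \<tau> ^ 3 * \<beta> * exp (- \<tau>\<^sup>2 / 3)"
  proof -
    have "cmod (\<phi> \<tau> ^ (n - j) - complex_of_real \<psi> ^ (n - j)) \<le> r ^ (n - j) / r * (real (n - j) * cmod (\<phi> \<tau> - \<psi>))"
      using norm_\<phi>_le[OF \<tau>] \<psi>r r0 by (intro norm_power_diff_le) (auto simp: r_def \<psi>_def)
    also have "\<dots> \<le> (exp (real k / 3) * exp (- \<tau>\<^sup>2 / 3)) * exp (1 / 3) * (real n * (\<tau> ^ 3 * \<beta> / real n))"
    proof (intro mult_mono d)
      have "1 / r \<le> exp (1 / 3)"
      proof -
        have "1 / r = exp (- (- \<tau>\<^sup>2 / (3 * real n)))"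
          by (simp only: r_def exp_minus inverse_eq_divide)
        also have "- (- \<tau>\<^sup>2 / (3 * real n)) = (\<tau>\<^sup>2 / real n) / 3" by simp
        also have "exp \<dots> \<le> exp (1 / 3)" using sq' by simp
        finally show ?thesis .
      qed
      hence "r ^ (n - j) * (1 / r) \<le> (exp (real k / 3) * exp (- \<tau>\<^sup>2 / 3)) * exp (1 / 3)"
        using norm_\<phi>_power_le(1)[OF \<tau> j] r0 unfolding r_def by (intro mult_mono) auto
      thus "r ^ (n - j) / r \<le> (exp (real k / 3) * exp (- \<tau>\<^sup>2 / 3)) * exp (1 / 3)" by simp
    qed auto
    also have "\<dots> = exp (real k / 3 + 1 / 3) * \<tau> ^ 3 * \<beta> * exp (- \<tau>\<^sup>2 / 3)"
      unfolding exp_add using n_pos by simp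
    also have "\<dots> \<le> exp (real k + 1) * \<tau> ^ 3 * \<beta> * exp (- \<tau>\<^sup>2 / 3)"
      using \<tau> \<beta>_pos by (intro mult_right_mono) auto
    finally show ?thesis .
  qed
  have p2: "cmod (complex_of_real \<psi> ^ (n - j) - exp (- \<tau>\<^sup>2 / 2)) \<le> exp (real k + 1) * real k * \<tau>\<^sup>2 * \<beta> * exp (- \<tau>\<^sup>2 / 3)"
  proof -
    \<comment> \<open>The exponent contributed by the j missing factors. It is of order \<tau>^2/n,
      hence of order \<tau>^2 \<beta> by 1/n \<le> \<beta>^2 \<le> \<beta>.\<close>
    define y where "y = real j * \<tau>\<^sup>2 / (2 * real n)"
    have y0: "0 \<le> y" by (simp add: y_def)
    have yk: "y \<le> real k"
    proof -
      have "y = real j * (\<tau>\<^sup>2 / real n) / 2" by (simp add: y_def)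
      also have "\<dots> \<le> real k * 1 / 2" using j sq' by (intro divide_right_mono mult_mono) auto
      finally show ?thesis by simp
    qed
    have yb: "y \<le> real k * \<tau>\<^sup>2 * \<beta>"
    proof -
      have "1 / real n \<le> \<beta>\<^sup>2" using \<beta>_ge n_pos by (simp add: field_simps)
      also have "\<beta>\<^sup>2 \<le> \<beta>" using \<beta>1 \<beta>_pos by (simp add: power2_eq_square mult_left_le)
      finally have nb: "1 / real n \<le> \<beta>" .
      have "y = (real j / 2) * \<tau>\<^sup>2 * (1 / real n)" by (simp add: y_def)
      also have "\<dots> \<le> real k * \<tau>\<^sup>2 * \<beta>" using j nb by (intro mult_mono) auto
      finally show ?thesis .
    qed
    have "\<psi> ^ (n - j) = exp (real (n - j) * (- (\<tau>\<^sup>2 / (2 * real n))))" by (simp only: \<psi>_def exp_of_nat_mult)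
    also have "real (n - j) * (- (\<tau>\<^sup>2 / (2 * real n))) = - \<tau>\<^sup>2 / 2 + y"
      using j n_pos by (simp add: y_def of_nat_diff field_simps)
    finally have "\<psi> ^ (n - j) - exp (- \<tau>\<^sup>2 / 2) = exp (- \<tau>\<^sup>2 / 2) * (exp y - 1)"
      by (simp only: exp_add right_diff_distrib mult_1_right)
    moreover have "exp y - 1 \<le> y * exp y"
      using exp_ge_add_one_self[of "- y"] by (simp add: exp_minus field_simps)
    moreover have "0 \<le> exp y - 1" using y0 by simp
    moreover have "complex_of_real \<psi> ^ (n - j) - exp (- \<tau>\<^sup>2 / 2) = complex_of_real (\<psi> ^ (n - j) - exp (- \<tau>\<^sup>2 / 2))"
      by simp
    ultimately have "cmod (complex_of_real \<psi> ^ (n - j) - exp (- \<tau>\<^sup>2 / 2)) \<le> exp (- \<tau>\<^sup>2 / 2) * (y * exp y)"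
      by (simp only: norm_of_real) (simp add: abs_mult mult_left_mono)
    also have "\<dots> \<le> exp (- \<tau>\<^sup>2 / 3) * ((real k * \<tau>\<^sup>2 * \<beta>) * exp (real k + 1))"
      using y0 yk yb \<beta>_pos by (intro mult_mono) auto
    finally show ?thesis by (simp add: mult.commute mult.left_commute)
  qed
  have "cmod (\<phi> \<tau> ^ (n - j) - exp (- \<tau>\<^sup>2 / 2)) \<le> exp (real k + 1) * \<tau> ^ 3 * \<beta> * exp (- \<tau>\<^sup>2 / 3) + exp (real k + 1) * real k * \<tau>\<^sup>2 * \<beta> * exp (- \<tau>\<^sup>2 / 3)"
    using norm_triangle_ineq[of "\<phi> \<tau> ^ (n - j) - complex_of_real \<psi> ^ (n - j)" "complex_of_real \<psi> ^ (n - j) - exp (- \<tau>\<^sup>2 / 2)"] p1 p2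
    by simp
  also have "\<dots> = exp (real k + 1) * \<beta> * \<tau> * exp (- \<tau>\<^sup>2 / 3) * (\<tau>\<^sup>2 + real k * \<tau>)"
    by (simp add: algebra_simps power2_eq_square power3_eq_cube)
  also have "\<dots> \<le> exp (real k + 1) * \<beta> * \<tau> * exp (- \<tau>\<^sup>2 / 3) * ((real k + 1) * (1 + \<tau>) ^ 3)"
  proof (intro mult_left_mono)
    have a: "\<tau>\<^sup>2 \<le> (1 + \<tau>) ^ 3" "\<tau> \<le> (1 + \<tau>) ^ 3"
      using \<tau> by (simp_all add: power2_eq_square power3_eq_cube algebra_simps)
    have "\<tau>\<^sup>2 + real k * \<tau> \<le> (1 + \<tau>) ^ 3 + real k * (1 + \<tau>) ^ 3"
      by (intro add_mono mult_left_mono a) auto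
    thus "\<tau>\<^sup>2 + real k * \<tau> \<le> (real k + 1) * (1 + \<tau>) ^ 3" by (simp add: algebra_simps)
  qed (use \<beta>_pos \<tau> in auto)
  finally show ?thesis by (simp only: mult.assoc mult.commute mult.left_commute)
qed

text \<open>The conjugate exponent of \<alpha>. At \<alpha> = 1 the convention for division makes it
  0, so that case is treated separately wherever Young's inequality is applied.\<close>

definition \<alpha>' :: real where "\<alpha>' = \<alpha> / (\<alpha> - 1)"

text \<open>Young's inequality separates the kernel from the product. The binomial coefficient fits
  both parts: with the kernel it gives a summand of \<gamma>, and through binom(n, j) \<le> n^j it
  supplies one factor n for each of the j moments. The functions \<open>h i\<close> may differ,
  which allows one position to be treated specially.\<close>

lemma young_int:
  fixes h :: "nat \<Rightarrow> real \<Rightarrow> real"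
  assumes j: "j \<in> {1..k}" "j \<le> n" and \<alpha>1: "1 < \<alpha>"
    and hm: "\<And>i. i < j \<Longrightarrow> h i \<in> borel_measurable M" and h0: "\<And>i x. 0 \<le> h i x"
    and hi: "\<And>i. i < j \<Longrightarrow> integrable M (\<lambda>x. h i x powr \<alpha>')"
  shows "integrable (iid {..<j}) (\<lambda>x. (\<Prod>i<j. h i (x i)) * \<bar>t j x\<bar>)"
    and "real (n choose j) * (\<integral>x. (\<Prod>i<j. h i (x i)) * \<bar>t j x\<bar> \<partial>iid {..<j})
      \<le> \<gamma> + (\<Prod>i<j. real n * (\<integral>x. h i x powr \<alpha>' \<partial>M))"
proof -
  have conj: "\<alpha> > 1" "\<alpha>' > 1" "1 / \<alpha> + 1 / \<alpha>' = 1"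
    using \<alpha>1 by (auto simp: \<alpha>'_def field_simps)
  have [measurable]: "t j \<in> borel_measurable (iid {..<j})" using j by (intro t_meas) auto
  have cm: "(\<lambda>x. h i (x i)) \<in> borel_measurable (iid {..<j})" if "i < j" for i
    using that by (intro measurable_compose[OF measurable_component_singleton[of i "{..<j}" "\<lambda>_. M"] hm]) auto
  have [measurable]: "(\<lambda>x. \<Prod>i<j. h i (x i)) \<in> borel_measurable (iid {..<j})"
    by (intro borel_measurable_prod cm) auto
  have it: "integrable (iid {..<j}) (\<lambda>x. \<bar>t j x\<bar> powr \<alpha>)"
    using ta_int j by (simp add: joint_eq)
  have ip: "integrable (iid {..<j}) (\<lambda>x. \<Prod>i<j. h i (x i) powr \<alpha>')"
    by (rule pp.product_integrable_prod) (use hi in auto)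
  have pw: "(\<Prod>i<j. h i (x i)) * \<bar>t j x\<bar> \<le> \<bar>t j x\<bar> powr \<alpha> + (\<Prod>i<j. h i (x i) powr \<alpha>')" for x
  proof -
    have "\<bar>t j x\<bar> * (\<Prod>i<j. h i (x i)) \<le> \<bar>t j x\<bar> powr \<alpha> + (\<Prod>i<j. h i (x i)) powr \<alpha>'"
      using conj h0 by (intro Youngs_inequality_sum prod_nonneg) auto
    also have "(\<Prod>i<j. h i (x i)) powr \<alpha>' = (\<Prod>i<j. h i (x i) powr \<alpha>')"
      using h0 by (intro prod_powr_distrib)
    finally show ?thesis by (simp add: mult.commute)
  qed
  show int: "integrable (iid {..<j}) (\<lambda>x. (\<Prod>i<j. h i (x i)) * \<bar>t j x\<bar>)"
  proof (rule Bochner_Integration.integrable_bound[OF Bochner_Integration.integrable_add[OF it ip]])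
    show "AE x in iid {..<j}. norm ((\<Prod>i<j. h i (x i)) * \<bar>t j x\<bar>) \<le> norm (\<bar>t j x\<bar> powr \<alpha> + (\<Prod>i<j. h i (x i) powr \<alpha>'))"
    proof (rule AE_I2)
      fix x
      have "0 \<le> (\<Prod>i<j. h i (x i)) * \<bar>t j x\<bar>" using h0 by (intro mult_nonneg_nonneg prod_nonneg) auto
      with pw[of x] show "norm ((\<Prod>i<j. h i (x i)) * \<bar>t j x\<bar>) \<le> norm (\<bar>t j x\<bar> powr \<alpha> + (\<Prod>i<j. h i (x i) powr \<alpha>'))"
        by simp
    qed
  qed measurable
  have "(\<integral>x. (\<Prod>i<j. h i (x i)) * \<bar>t j x\<bar> \<partial>iid {..<j}) \<le> (\<integral>x. \<bar>t j x\<bar> powr \<alpha> + (\<Prod>i<j. h i (x i) powr \<alpha>') \<partial>iid {..<j})"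
    using int it ip pw by (intro integral_mono) auto
  also have "\<dots> = mom j + (\<Prod>i<j. \<integral>x. h i x powr \<alpha>' \<partial>M)"
    using it ip pp.product_integral_prod[of "{..<j}" "\<lambda>i x. h i x powr \<alpha>'"] hi
    by (subst Bochner_Integration.integral_add) (auto simp: mom_def)
  finally have "real (n choose j) * (\<integral>x. (\<Prod>i<j. h i (x i)) * \<bar>t j x\<bar> \<partial>iid {..<j}) \<le>
    real (n choose j) * mom j + real (n choose j) * (\<Prod>i<j. \<integral>x. h i x powr \<alpha>' \<partial>M)"
    by (simp add: mult_left_mono flip: distrib_left)
  also have "real (n choose j) * mom j \<le> \<gamma>" using j by (intro mom_le_\<gamma>)
  also have "real (n choose j) * (\<Prod>i<j. \<integral>x. h i x powr \<alpha>' \<partial>M) \<le> real (n ^ j) * (\<Prod>i<j. \<integral>x. h i x powr \<alpha>' \<partial>M)"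
    using j binomial_le_pow[of j n] by (intro mult_right_mono prod_nonneg) (auto simp del: of_nat_power)
  also have "real (n ^ j) * (\<Prod>i<j. \<integral>x. h i x powr \<alpha>' \<partial>M) = (\<Prod>i<j. real n * (\<integral>x. h i x powr \<alpha>' \<partial>M))"
    by (simp add: prod.distrib)
  finally show "real (n choose j) * (\<integral>x. (\<Prod>i<j. h i (x i)) * \<bar>t j x\<bar> \<partial>iid {..<j})
      \<le> \<gamma> + (\<Prod>i<j. real n * (\<integral>x. h i x powr \<alpha>' \<partial>M))"
    by simp
qed

end

section \<open>Coefficients of the expansion\<close>

definition decay_const :: "nat \<Rightarrow> real" where
  "decay_const k = exp (real k + 1) * (real k + 1)"

text \<open>The first summand is for \<alpha> = 1, where the factors are simply bounded by 2; the
  second bounds the j-th power of 2 powr (\<alpha>' - 3) for 1 < \<alpha> \<le> 3/2.\<close>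

definition young_const :: "nat \<Rightarrow> real \<Rightarrow> real" where
  "young_const k \<alpha> = 2 ^ k + 2 powr (real k * (\<alpha> / (\<alpha> - 1)))"

lemma young_const_ge_1: "1 \<le> young_const k \<alpha>"
  unfolding young_const_def by (intro add_increasing2) auto

context ustat
begin

text \<open>The weight of the third moment when |l|^\<alpha>' is interpolated between l^2 and |l|^3.
  For \<alpha> > 3/2 the condition in \<open>pidx\<close> on j says that j \<theta> < 1.\<close>

definition \<theta> :: real where "\<theta> = \<alpha>' - 2"

lemma \<alpha>'_bounds:
  assumes "\<alpha> > 3/2"
  shows "2 < \<alpha>'" "\<alpha>' < 3" "0 < \<theta>" "\<theta> < 1" "\<theta> = (2 - \<alpha>) / (\<alpha> - 1)"
  using assms \<alpha> by (auto simp: \<alpha>'_def \<theta>_def field_simps)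

text \<open>Hoelder interpolation, done pointwise by weighted AM-GM for |l|/\<beta> and 1. Scaling
  by \<beta> balances the two moments: multiplied by n they contribute 1 - \<theta> and
  \<theta>.\<close>

lemma l_moment:
  assumes a: "\<alpha> > 3/2"
  shows "integrable M (\<lambda>x. \<bar>l x\<bar> powr \<alpha>')" and "real n * (\<integral>x. \<bar>l x\<bar> powr \<alpha>' \<partial>M) \<le> \<beta> powr \<theta>"
proof -
  note b = \<alpha>'_bounds[OF a]
  let ?g = "\<lambda>x. \<beta> powr \<theta> * ((1 - \<theta>) * (l x)\<^sup>2 + \<theta> / \<beta> * \<bar>l x\<bar> ^ 3)"
  have pw: "\<bar>l x\<bar> powr \<alpha>' \<le> ?g x" for x
  proof (cases "l x = 0")
    case False
    have "\<bar>l x\<bar> powr \<alpha>' = \<bar>l x\<bar> powr 2 * \<bar>l x\<bar> powr \<theta>"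
      unfolding powr_add[symmetric] by (simp add: \<theta>_def)
    also have "\<bar>l x\<bar> powr 2 = (l x)\<^sup>2" using False powr_numeral[of "\<bar>l x\<bar>" "num.Bit0 num.One"] by simp
    also have "\<bar>l x\<bar> powr \<theta> = \<beta> powr \<theta> * ((\<bar>l x\<bar> / \<beta>) powr \<theta> * 1 powr (1 - \<theta>))"
      using \<beta>_pos False by (simp add: powr_divide)
    also have "(l x)\<^sup>2 * \<dots> \<le> (l x)\<^sup>2 * (\<beta> powr \<theta> * (\<theta> * (\<bar>l x\<bar> / \<beta>) + (1 - \<theta>) * 1))"
      using b \<beta>_pos False by (intro mult_left_mono Youngs_inequality_0) auto
    also have "\<dots> = \<beta> powr \<theta> * ((1 - \<theta>) * (l x)\<^sup>2 + \<theta> / \<beta> * ((l x)\<^sup>2 * \<bar>l x\<bar>))"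
      by (simp add: algebra_simps)
    also have "(l x)\<^sup>2 * \<bar>l x\<bar> = \<bar>l x\<bar> ^ 3" by (simp add: power2_eq_square power3_eq_cube)
    finally show ?thesis .
  qed (use b \<beta>_pos in simp)
  have ig: "integrable M ?g" using l2_int l3_int by simp
  show int: "integrable M (\<lambda>x. \<bar>l x\<bar> powr \<alpha>')"
    by (rule Bochner_Integration.integrable_bound[OF ig])
      (use pw in \<open>auto intro!: AE_I2 order_trans[OF pw]\<close>)
  have "(\<integral>x. \<bar>l x\<bar> powr \<alpha>' \<partial>M) \<le> (\<integral>x. ?g x \<partial>M)"
    using int ig pw by (intro integral_mono) auto
  also have "\<dots> = \<beta> powr \<theta> * ((1 - \<theta>) * (\<integral>x. (l x)\<^sup>2 \<partial>M) + \<theta> / \<beta> * (\<integral>x. \<bar>l x\<bar> ^ 3 \<partial>M))"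
    using l2_int l3_int by simp
  also have "\<dots> = \<beta> powr \<theta> / real n"
    unfolding int_l2 int_l3 using \<beta>_pos n_pos by (simp add: field_simps)
  finally show "real n * (\<integral>x. \<bar>l x\<bar> powr \<alpha>' \<partial>M) \<le> \<beta> powr \<theta>"
    using n_pos by (simp add: field_simps)
qed

definition bhat :: "nat \<Rightarrow> real" where
  "bhat j = (\<integral>x. (\<Prod>i<j. l (x i)) * t j x \<partial>iid {..<j})"

text \<open>Young's inequality again. J is not tied to A, because evaluating \<kappa> pairs the
  product over a fixed J with every kernel T_A.\<close>

lemma prod_l_TA_integrable:
  assumes a: "\<alpha> > 3/2" and J: "J \<subseteq> I" and A: "A \<in> \<A>"
  shows "integrable P (\<lambda>w. (\<Prod>i\<in>J. l (w i)) * TA t A w)"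
proof -
  have conj: "\<alpha> > 1" "\<alpha>' > 1" "1 / \<alpha> + 1 / \<alpha>' = 1"
    using a by (auto simp: \<alpha>'_def field_simps)
  have [measurable]: "TA t A \<in> borel_measurable P" using A by (rule TA_meas)
  have cm: "(\<lambda>w. l (w i)) \<in> borel_measurable P" if "i \<in> J" for i
    using that J by (intro measurable_compose[OF measurable_component_singleton[of i I "\<lambda>_. M"] lM]) auto
  have [measurable]: "(\<lambda>w. \<Prod>i\<in>J. l (w i)) \<in> borel_measurable P"
    by (intro borel_measurable_prod cm)
  have ip: "integrable P (\<lambda>w. \<Prod>i\<in>J. \<bar>l (w i)\<bar> powr \<alpha>')"
    using integral_peel_prod[OF finite_lessThan J l_moment(1)[OF a], of "\<lambda>_. 1"] by simp
  have it: "integrable P (\<lambda>w. \<bar>TA t A w\<bar> powr \<alpha>)"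
    using TS_moment(1)[of "{A}"] A by (simp add: TS_def)
  show ?thesis
  proof (rule Bochner_Integration.integrable_bound[OF Bochner_Integration.integrable_add[OF it ip]])
    show "AE w in P. norm ((\<Prod>i\<in>J. l (w i)) * TA t A w) \<le> norm (\<bar>TA t A w\<bar> powr \<alpha> + (\<Prod>i\<in>J. \<bar>l (w i)\<bar> powr \<alpha>'))"
    proof (rule AE_I2)
      fix w
      have "\<bar>TA t A w\<bar> * (\<Prod>i\<in>J. \<bar>l (w i)\<bar>) \<le> \<bar>TA t A w\<bar> powr \<alpha> + (\<Prod>i\<in>J. \<bar>l (w i)\<bar>) powr \<alpha>'"
        using conj by (intro Youngs_inequality_sum prod_nonneg) auto
      also have "(\<Prod>i\<in>J. \<bar>l (w i)\<bar>) powr \<alpha>' = (\<Prod>i\<in>J. \<bar>l (w i)\<bar> powr \<alpha>')"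
        by (intro prod_powr_distrib)
      finally have le: "\<bar>TA t A w\<bar> * (\<Prod>i\<in>J. \<bar>l (w i)\<bar>) \<le> \<bar>TA t A w\<bar> powr \<alpha> + (\<Prod>i\<in>J. \<bar>l (w i)\<bar> powr \<alpha>')" .
      have "norm ((\<Prod>i\<in>J. l (w i)) * TA t A w) = \<bar>TA t A w\<bar> * (\<Prod>i\<in>J. \<bar>l (w i)\<bar>)"
        by (simp add: abs_mult abs_prod mult.commute)
      thus "norm ((\<Prod>i\<in>J. l (w i)) * TA t A w) \<le> norm (\<bar>TA t A w\<bar> powr \<alpha> + (\<Prod>i\<in>J. \<bar>l (w i)\<bar> powr \<alpha>'))"
        using le by simp
    qed
  qed measurable
qed

text \<open>In the expectation defining \<kappa> only the kernel on the indices {..<j} itself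
  survives: a set A with an index outside is annihilated by degeneracy, and a proper subset leaves
  some L_i alone, which has mean 0. For j > n both sides contain the vanishing binomial
  coefficient.\<close>

lemma kappa_eq:
  assumes a: "\<alpha> > 3/2" and j: "j \<in> {1..k}"
  shows "kappa k n M l t j = real (n choose j) * bhat j"
proof (cases "j \<le> n")
  case True
  let ?J = "{..<j}"
  have JI: "?J \<subseteq> I" using True by auto
  have JA: "?J \<in> \<A>" using j JI by (auto simp: \<A>_def)
  have "(\<integral>w. (\<Prod>i<j. l (w i)) * TT k n t w \<partial>P) = (\<Sum>A\<in>\<A>. \<integral>w. (\<Prod>i<j. l (w i)) * TA t A w \<partial>P)"
    unfolding TT_eq sum_distrib_left
    by (intro Bochner_Integration.integral_sum prod_l_TA_integrable a JI)
  also have "\<dots> = (\<Sum>A\<in>\<A>. if A = ?J then bhat j else 0)"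
  proof (rule sum.cong[OF refl])
    fix A assume A: "A \<in> \<A>"
    show "(\<integral>w. (\<Prod>i<j. l (w i)) * TA t A w \<partial>P) = (if A = ?J then bhat j else 0)"
    proof (cases "A = ?J")
      case True
      hence c: "card A = j" by simp
      have "(\<integral>w. (\<Prod>i\<in>A. l (w i)) * TA t A w \<partial>P) = (\<integral>x. (\<Prod>i<card A. l (x i)) * t (card A) x \<partial>iid {..<card A})"
        by (rule integral_prod_TA(2)[OF A, of l "\<lambda>x. x"]) measurable
      from this[unfolded c] True show ?thesis by (simp only: bhat_def refl if_True)
    next
      case AJ: False
      show ?thesis
      proof (cases "A \<subseteq> ?J")
        case False
        then obtain i where i: "i \<in> A" "i \<notin> ?J" by blast
        have "(\<integral>w. (\<Prod>i<j. l (w i)) * of_real (TA t A w) \<partial>P) = 0"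
        proof (rule integral_degenerate_eq_0[OF _ _ TA_degenerate[OF A i(1)]])
          show "i \<in> I" using i \<A>D(1)[OF A] by auto
          show "integrable P (\<lambda>w. (\<Prod>i<j. l (w i)) * of_real (TA t A w))"
            using prod_l_TA_integrable[OF a JI A] by simp
          fix w x
          show "(\<Prod>r<j. l ((w(i := x)) r)) = (\<Prod>r<j. l (w r))"
            using i(2) by (intro prod.cong) auto
        qed simp
        thus ?thesis using AJ by simp
      next
        case True
        with AJ obtain i where i: "i \<in> ?J" "i \<notin> A" by blast
        let ?Z = "\<lambda>w. (\<Prod>r\<in>?J - {i}. l (w r)) * TA t A w"
        have pe: "(\<integral>w. l (w i) * ?Z w \<partial>P) = (\<integral>x. l x \<partial>M) * (\<integral>w. ?Z w \<partial>P)"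
        proof (rule integral_peel(2)[OF _ _ l_int])
          show "i \<in> I" using i JI by auto
          show "integrable P ?Z" using JI by (intro prod_l_TA_integrable a A) auto
          fix w x
          have "(\<Prod>r\<in>?J - {i}. l ((w(i := x)) r)) = (\<Prod>r\<in>?J - {i}. l (w r))"
            by (intro prod.cong) auto
          thus "?Z (w(i := x)) = ?Z w"
            by (simp only: TA_fun_upd[OF \<A>D(2)[OF A] i(2)])
        qed simp
        have eq: "(\<Prod>r<j. l (w r)) * TA t A w = l (w i) * ?Z w" for w
          using prod.remove[OF finite_lessThan i(1), of "\<lambda>r. l (w r)"] by (simp only: mult.assoc)
        have "(\<integral>w. (\<Prod>i<j. l (w i)) * TA t A w \<partial>P) = (\<integral>w. l (w i) * ?Z w \<partial>P)"
          by (rule Bochner_Integration.integral_cong[OF refl eq])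
        also have "\<dots> = 0" by (simp only: pe l_mean mult_zero_left)
        finally have "(\<integral>w. (\<Prod>i<j. l (w i)) * TA t A w \<partial>P) = 0" .
        thus ?thesis using AJ by simp
      qed
    qed
  qed
  also have "\<dots> = bhat j" using JA finite_\<A> by simp
  finally show ?thesis by (simp add: kappa_def joint_eq)
qed (simp add: kappa_def)

lemma kappa_le:
  assumes a: "\<alpha> > 3/2" and j: "j \<in> {1..k}"
  shows "\<bar>kappa k n M l t j\<bar> \<le> \<gamma> + (\<beta> powr \<theta>) ^ j"
proof (cases "j \<le> n")
  case True
  have "real (n choose j) * (\<integral>x. (\<Prod>i<j. \<bar>l (x i)\<bar>) * \<bar>t j x\<bar> \<partial>iid {..<j})
      \<le> \<gamma> + (\<Prod>i<j. real n * (\<integral>x. \<bar>l x\<bar> powr \<alpha>' \<partial>M))"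
    using a by (intro young_int(2)[OF j True, of "\<lambda>_ x. \<bar>l x\<bar>"] l_moment(1)) auto
  also have "(\<Prod>i<j. real n * (\<integral>x. \<bar>l x\<bar> powr \<alpha>' \<partial>M)) \<le> (\<beta> powr \<theta>) ^ j"
    using l_moment(2)[OF a] by (auto intro!: power_mono simp flip: power_mult_distrib)
  finally have le: "real (n choose j) * (\<integral>x. (\<Prod>i<j. \<bar>l (x i)\<bar>) * \<bar>t j x\<bar> \<partial>iid {..<j}) \<le> \<gamma> + (\<beta> powr \<theta>) ^ j"
    by simp
  have "\<bar>bhat j\<bar> \<le> (\<integral>x. \<bar>(\<Prod>i<j. l (x i)) * t j x\<bar> \<partial>iid {..<j})"
    unfolding bhat_def by (rule integral_abs_bound)
  also have "\<dots> = (\<integral>x. (\<Prod>i<j. \<bar>l (x i)\<bar>) * \<bar>t j x\<bar> \<partial>iid {..<j})"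
    by (simp add: abs_mult abs_prod)
  finally have "real (n choose j) * \<bar>bhat j\<bar> \<le> real (n choose j) * (\<integral>x. (\<Prod>i<j. \<bar>l (x i)\<bar>) * \<bar>t j x\<bar> \<partial>iid {..<j})"
    by (intro mult_left_mono) auto
  thus ?thesis using le by (simp add: kappa_eq[OF a j] abs_mult)
qed (use \<gamma>_nonneg in \<open>simp add: kappa_eq[OF a j] binomial_eq_0\<close>)

definition wnorm :: "real \<Rightarrow> real \<Rightarrow> real" where
  "wnorm \<tau> x = cmod (iexp (\<tau> * l x) - 1)"

lemma wnorm_meas[measurable]: "wnorm \<tau> \<in> borel_measurable M"
  unfolding wnorm_def[abs_def] by measurable

lemma ahat_le_young:
  assumes j: "j \<in> {1..k}" "j \<le> n" and a: "1 < \<alpha>"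
  shows "real (n choose j) * cmod (ahat \<tau> j) \<le> \<gamma> + (real n * (\<integral>x. wnorm \<tau> x powr \<alpha>' \<partial>M)) ^ j"
proof -
  have \<alpha>'0: "0 < \<alpha>'" using a by (simp add: \<alpha>'_def)
  have int: "integrable M (\<lambda>x. wnorm \<tau> x powr \<alpha>')"
  proof (rule integrable_const_bound[where B = "2 powr \<alpha>'"])
    show "AE x in M. norm (wnorm \<tau> x powr \<alpha>') \<le> 2 powr \<alpha>'"
      using norm_iexp_minus_one_le_2 \<alpha>'0 by (intro AE_I2) (auto simp: wnorm_def simp del: of_real_mult intro!: powr_mono2)
  qed measurable
  have "cmod (ahat \<tau> j) \<le> (\<integral>x. cmod ((\<Prod>i<j. iexp (\<tau> * l (x i)) - 1) * t j x) \<partial>iid {..<j})"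
    unfolding ahat_def by (rule integral_norm_bound)
  also have "\<dots> = (\<integral>x. (\<Prod>i<j. wnorm \<tau> (x i)) * \<bar>t j x\<bar> \<partial>iid {..<j})"
    by (simp add: norm_mult wnorm_def prod_norm del: of_real_mult)
  finally have "real (n choose j) * cmod (ahat \<tau> j) \<le> real (n choose j) * (\<integral>x. (\<Prod>i<j. wnorm \<tau> (x i)) * \<bar>t j x\<bar> \<partial>iid {..<j})"
    by (intro mult_left_mono) auto
  also have "\<dots> \<le> \<gamma> + (\<Prod>i<j. real n * (\<integral>x. wnorm \<tau> x powr \<alpha>' \<partial>M))"
    using a int by (intro young_int(2)[OF j, of "\<lambda>_. wnorm \<tau>"]) (auto simp: wnorm_def[of \<tau>])
  finally show ?thesis by (simp add: power_mult_distrib)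
qed

text \<open>Three regimes: for \<alpha> = 1 the factors are bounded by 2; for 1 < \<alpha> \<le> 3/2
  third moments suffice and already one factor yields \<beta>; for \<alpha> > 3/2 the product yields
  \<beta>^(j \<theta>) \<le> \<beta>, because j \<theta> \<ge> 1 and \<beta> \<le> 1. The polynomial
  growth in \<tau> is harmless against the Gaussian factor added later.\<close>

lemma ahat_le_far:
  assumes j: "j \<in> {1..k}" "j \<le> n" and \<tau>: "0 < \<tau>" and \<beta>1: "\<beta> \<le> 1"
    and far: "\<alpha> \<le> 3/2 \<or> (\<alpha> - 1) / (2 - \<alpha>) \<le> real j"
  shows "real (n choose j) * cmod (ahat \<tau> j) \<le> young_const k \<alpha> * (1 + \<tau>) ^ (3 * k) * (\<beta> + \<gamma>)"
proof -
  let ?C = "young_const k \<alpha>"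
  have T1: "1 \<le> (1 + \<tau>) ^ (3 * k)" using \<tau> by (intro one_le_power) auto
  have C1: "1 \<le> ?C" by (rule young_const_ge_1)
  have CT: "1 \<le> ?C * (1 + \<tau>) ^ (3 * k)" using mult_mono[OF C1 T1] C1 by simp
  have T3: "((1 + \<tau>) ^ 3) ^ j \<le> (1 + \<tau>) ^ (3 * k)"
    using j \<tau> by (simp flip: power_mult add: power_increasing)
  have combine: "\<gamma> + X \<le> ?C * (1 + \<tau>) ^ (3 * k) * (\<beta> + \<gamma>)" if "X \<le> ?C * (1 + \<tau>) ^ (3 * k) * \<beta>" for X
  proof -
    have "1 * \<gamma> \<le> (?C * (1 + \<tau>) ^ (3 * k)) * \<gamma>" by (intro mult_right_mono CT \<gamma>_nonneg)
    with that show ?thesis by (simp add: distrib_left)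
  qed
  consider "\<alpha> = 1" | "1 < \<alpha>" "\<alpha> \<le> 3/2" | "\<alpha> > 3/2" using \<alpha> by linarith
  thus ?thesis
  proof cases
    case 1
    have tj: "integrable (iid {..<j}) (t j)" using j by (intro t_props)
    have "cmod (ahat \<tau> j) \<le> (\<integral>x. cmod ((\<Prod>i<j. iexp (\<tau> * l (x i)) - 1) * t j x) \<partial>iid {..<j})"
      unfolding ahat_def by (rule integral_norm_bound)
    also have "\<dots> \<le> (\<integral>x. 2 ^ j * \<bar>t j x\<bar> \<partial>iid {..<j})"
    proof (rule integral_mono_AE')
      show "integrable (iid {..<j}) (\<lambda>x. 2 ^ j * \<bar>t j x\<bar>)" using tj by simp
      show "AE x in iid {..<j}. cmod ((\<Prod>i<j. iexp (\<tau> * l (x i)) - 1) * t j x) \<le> 2 ^ j * \<bar>t j x\<bar>"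
        using norm_prod_iexp_le[of \<tau> _ "{..<j}" "{}"]
        by (intro AE_I2) (auto simp: norm_mult intro!: mult_right_mono simp del: of_real_mult)
    qed auto
    also have "\<dots> = 2 ^ j * mom j" unfolding mom_def using 1 by simp
    also have "\<dots> \<le> 2 ^ k * mom j" using j by (intro mult_right_mono mom_nonneg power_increasing) auto
    finally have "real (n choose j) * cmod (ahat \<tau> j) \<le> real (n choose j) * (2 ^ k * mom j)"
      by (intro mult_left_mono) auto
    also have "\<dots> = 2 ^ k * (real (n choose j) * mom j)" by simp
    also have "\<dots> \<le> 2 ^ k * \<gamma>" using j by (intro mult_left_mono mom_le_\<gamma>) auto
    also have "\<dots> \<le> (?C * (1 + \<tau>) ^ (3 * k)) * (\<beta> + \<gamma>)"
    proof (rule mult_mono)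
      have "2 ^ k * 1 \<le> ?C * (1 + \<tau>) ^ (3 * k)"
        by (rule mult_mono[OF _ T1]) (auto simp: young_const_def)
      thus "2 ^ k \<le> ?C * (1 + \<tau>) ^ (3 * k)" by simp
    qed (use \<beta>_pos \<gamma>_nonneg CT in auto)
    finally show ?thesis .
  next
    case 2
    \<comment> \<open>Of the \<alpha>' powers of |exp(i\<tau>l) - 1|, three are spent on \<tau>|l|
      and the excess \<alpha>' - 3 on the trivial bound 2.\<close>
    have a3: "3 \<le> \<alpha>'" using 2 by (simp add: \<alpha>'_def field_simps)
    have pw: "wnorm \<tau> x powr \<alpha>' \<le> 2 powr (\<alpha>' - 3) * \<tau> ^ 3 * \<bar>l x\<bar> ^ 3" for x
    proof -
      have w: "0 \<le> wnorm \<tau> x" "wnorm \<tau> x \<le> 2" "wnorm \<tau> x \<le> \<tau> * \<bar>l x\<bar>"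
        using norm_iexp_minus_one_le_2[of "\<tau> * l x"] norm_iexp_minus_one_le_abs[of "\<tau> * l x"] \<tau>
        by (auto simp: wnorm_def abs_mult simp del: of_real_mult)
      have "wnorm \<tau> x powr \<alpha>' = wnorm \<tau> x powr (\<alpha>' - 3) * wnorm \<tau> x ^ 3"
      proof (cases "wnorm \<tau> x = 0")
        case False
        hence "wnorm \<tau> x powr 3 = wnorm \<tau> x ^ 3" using w powr_numeral[of "wnorm \<tau> x" "num.Bit1 num.One"] by simp
        moreover have "wnorm \<tau> x powr \<alpha>' = wnorm \<tau> x powr (\<alpha>' - 3) * wnorm \<tau> x powr 3"
          unfolding powr_add[symmetric] by simp
        ultimately show ?thesis by simp
      qed simp
      also have "\<dots> \<le> 2 powr (\<alpha>' - 3) * (\<tau> * \<bar>l x\<bar>) ^ 3"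
        using w a3 by (intro mult_mono powr_mono2 power_mono) auto
      finally show ?thesis by (simp add: power_mult_distrib mult.assoc)
    qed
    have "(\<integral>x. wnorm \<tau> x powr \<alpha>' \<partial>M) \<le> (\<integral>x. 2 powr (\<alpha>' - 3) * \<tau> ^ 3 * \<bar>l x\<bar> ^ 3 \<partial>M)"
      using l3_int pw \<tau> by (intro integral_mono_AE') (auto intro!: AE_I2)
    hence "real n * (\<integral>x. wnorm \<tau> x powr \<alpha>' \<partial>M) \<le> 2 powr (\<alpha>' - 3) * \<tau> ^ 3 * \<beta>"
      using n_pos by (simp add: int_l3 field_simps)
    hence "(real n * (\<integral>x. wnorm \<tau> x powr \<alpha>' \<partial>M)) ^ j \<le> (2 powr (\<alpha>' - 3) * \<tau> ^ 3 * \<beta>) ^ j"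
      by (intro power_mono mult_nonneg_nonneg Bochner_Integration.integral_nonneg) auto
    also have "\<dots> = (2 powr (\<alpha>' - 3)) ^ j * (\<tau> ^ 3) ^ j * \<beta> ^ j" by (simp add: power_mult_distrib)
    also have "\<dots> \<le> ?C * (1 + \<tau>) ^ (3 * k) * \<beta>"
    proof (intro mult_mono)
      have "(2 powr (\<alpha>' - 3)) ^ j = 2 powr ((\<alpha>' - 3) * real j)"
        by (simp add: powr_powr flip: powr_realpow)
      also have "\<dots> \<le> 2 powr (real k * \<alpha>')"
      proof (rule powr_mono)
        have "(\<alpha>' - 3) * real j \<le> \<alpha>' * real k" using j a3 by (intro mult_mono) auto
        thus "(\<alpha>' - 3) * real j \<le> real k * \<alpha>'" by (simp add: mult.commute)
      qed simp
      also have "\<dots> \<le> ?C" by (simp add: young_const_def \<alpha>'_def)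
      finally show "(2 powr (\<alpha>' - 3)) ^ j \<le> ?C" .
      have "(\<tau> ^ 3) ^ j \<le> ((1 + \<tau>) ^ 3) ^ j" using \<tau> by (intro power_mono) auto
      thus "(\<tau> ^ 3) ^ j \<le> (1 + \<tau>) ^ (3 * k)" using T3 by linarith
      show "\<beta> ^ j \<le> \<beta>" using j \<beta>_pos \<beta>1 power_decreasing[of 1 j \<beta>] by simp
    qed (use C1 \<tau> \<beta>_pos in auto)
    finally have "(real n * (\<integral>x. wnorm \<tau> x powr \<alpha>' \<partial>M)) ^ j \<le> ?C * (1 + \<tau>) ^ (3 * k) * \<beta>" .
    from order_trans[OF ahat_le_young[OF j 2(1)] combine[OF this]] show ?thesis .
  next
    case 3
    note b = \<alpha>'_bounds[OF 3]
    have "(\<integral>x. wnorm \<tau> x powr \<alpha>' \<partial>M) \<le> (\<integral>x. \<tau> powr \<alpha>' * \<bar>l x\<bar> powr \<alpha>' \<partial>M)"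
    proof (rule integral_mono_AE')
      show "integrable M (\<lambda>x. \<tau> powr \<alpha>' * \<bar>l x\<bar> powr \<alpha>')" using l_moment(1)[OF 3] by simp
      have "wnorm \<tau> x powr \<alpha>' \<le> (\<tau> * \<bar>l x\<bar>) powr \<alpha>'" for x
        using norm_iexp_minus_one_le_abs[of "\<tau> * l x"] \<tau> b
        by (intro powr_mono2) (auto simp: wnorm_def abs_mult simp del: of_real_mult)
      thus "AE x in M. wnorm \<tau> x powr \<alpha>' \<le> \<tau> powr \<alpha>' * \<bar>l x\<bar> powr \<alpha>'"
        using \<tau> by (intro AE_I2) (simp add: powr_mult)
    qed auto
    also have "\<dots> = \<tau> powr \<alpha>' * (\<integral>x. \<bar>l x\<bar> powr \<alpha>' \<partial>M)" by simp
    finally have "real n * (\<integral>x. wnorm \<tau> x powr \<alpha>' \<partial>M) \<le> \<tau> powr \<alpha>' * (real n * (\<integral>x. \<bar>l x\<bar> powr \<alpha>' \<partial>M))"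
      using n_pos by (simp add: mult_left_mono mult.left_commute)
    also have "\<dots> \<le> (1 + \<tau>) ^ 3 * \<beta> powr \<theta>"
    proof (intro mult_mono l_moment(2) 3)
      have "\<tau> powr \<alpha>' \<le> (1 + \<tau>) powr \<alpha>'" using \<tau> b by (intro powr_mono2) auto
      also have "\<dots> \<le> (1 + \<tau>) powr 3" using \<tau> b by (intro powr_mono) auto
      also have "\<dots> = (1 + \<tau>) ^ 3" using \<tau> powr_numeral[of "1 + \<tau>" "num.Bit1 num.One"] by simp
      finally show "\<tau> powr \<alpha>' \<le> (1 + \<tau>) ^ 3" .
    qed (use \<tau> in auto)
    finally have "(real n * (\<integral>x. wnorm \<tau> x powr \<alpha>' \<partial>M)) ^ j \<le> ((1 + \<tau>) ^ 3 * \<beta> powr \<theta>) ^ j"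
      by (intro power_mono mult_nonneg_nonneg Bochner_Integration.integral_nonneg) auto
    also have "\<dots> = 1 * ((1 + \<tau>) ^ 3) ^ j * (\<beta> powr \<theta>) ^ j" by (simp add: power_mult_distrib)
    also have "\<dots> \<le> ?C * (1 + \<tau>) ^ (3 * k) * \<beta>"
    proof (intro mult_mono C1 T3)
      have "(\<beta> powr \<theta>) ^ j = \<beta> powr (\<theta> * real j)"
        using \<beta>_pos by (simp add: powr_powr flip: powr_realpow)
      also have "\<dots> \<le> \<beta> powr 1"
      proof (rule powr_mono')
        have "(\<alpha> - 1) / (2 - \<alpha>) \<le> real j" using far 3 by auto
        thus "1 \<le> \<theta> * real j" unfolding b(5) using 3 \<alpha> by (simp add: field_simps)
      qed (use \<beta>_pos \<beta>1 in auto)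
      finally show "(\<beta> powr \<theta>) ^ j \<le> \<beta>" using \<beta>_pos by simp
    qed (use C1 \<tau> \<beta>_pos in auto)
    finally have "(real n * (\<integral>x. wnorm \<tau> x powr \<alpha>' \<partial>M)) ^ j \<le> ?C * (1 + \<tau>) ^ (3 * k) * \<beta>" .
    moreover have "1 < \<alpha>" using 3 by simp
    ultimately show ?thesis using order_trans[OF ahat_le_young[OF j] combine] by blast
  qed
qed

text \<open>Telescoping linearizes one factor at a time. The position r under exchange has an error
  of higher than linear order, and this surplus is what produces a full factor \<beta>.\<close>

lemma ahat_minus_bhat_le:
  assumes a: "\<alpha> > 3/2" and j: "j \<in> {1..k}" "j \<le> n" and \<tau>: "0 < \<tau>" and \<beta>1: "\<beta> \<le> 1"
  shows "real (n choose j) * cmod (ahat \<tau> j - (\<i> * \<tau>) ^ j * bhat j) \<le> 2 * real k * (1 + \<tau>) ^ (k + 1) * (\<beta> + \<gamma>)"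
proof -
  note b = \<alpha>'_bounds[OF a]
  \<comment> \<open>With s \<alpha>' = 3 the exchanged factor |l|^s turns into n E|l|^3 = \<beta>
    after Young's inequality, while the others give n E|l|^\<alpha>' \<le> \<beta>^\<theta> \<le> 1.
    From 2 < \<alpha>' < 3 it follows that s lies between 1 and 2, as the bound on the linear
    remainder demands.\<close>
  define s where "s = 3 / \<alpha>'"
  have s: "1 \<le> s" "s \<le> 2" "s * \<alpha>' = 3" using b by (auto simp: s_def field_simps)
  define h where "h = (\<lambda>(r::nat) (i::nat) x. if i = r then \<bar>l x\<bar> powr s else \<bar>l x\<bar>)"
  define H where "H = (\<lambda>r x. (\<Prod>i<j. h r i (x i)) * \<bar>t j x\<bar>)"
  have hp: "h r i x powr \<alpha>' = (if i = r then \<bar>l x\<bar> ^ 3 else \<bar>l x\<bar> powr \<alpha>')" for r i x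
  proof -
    have "\<bar>l x\<bar> powr 3 = \<bar>l x\<bar> ^ 3"
      using powr_numeral[of "\<bar>l x\<bar>" "num.Bit1 num.One"] by (cases "l x = 0") auto
    thus ?thesis by (simp add: h_def powr_powr s)
  qed
  have hint: "integrable M (\<lambda>x. h r i x powr \<alpha>')" for r i
    unfolding hp using l3_int l_moment(1)[OF a] by (cases "i = r") auto
  have hm: "h r i \<in> borel_measurable M" for r i
    unfolding h_def by (cases "i = r") auto
  have h0: "0 \<le> h r i x" for r i x by (simp add: h_def)
  have a1: "1 < \<alpha>" using a by simp
  have Hint: "integrable (iid {..<j}) (H r)" for r
    unfolding H_def by (rule young_int(1)[OF j a1 hm h0 hint])
  have Hle: "real (n choose j) * (\<integral>x. H r x \<partial>iid {..<j}) \<le> \<beta> + \<gamma>" if r: "r < j" for r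
  proof -
    have "real (n choose j) * (\<integral>x. H r x \<partial>iid {..<j}) \<le> \<gamma> + (\<Prod>i<j. real n * (\<integral>x. h r i x powr \<alpha>' \<partial>M))"
      unfolding H_def by (rule young_int(2)[OF j a1 hm h0 hint])
    also have "(\<Prod>i<j. real n * (\<integral>x. h r i x powr \<alpha>' \<partial>M)) \<le> (\<Prod>i<j. if i = r then \<beta> else 1)"
    proof (rule prod_mono)
      fix i assume "i \<in> {..<j}"
      have "\<beta> powr \<theta> \<le> 1" using b \<beta>_pos \<beta>1 powr_mono2[of \<theta> \<beta> 1] by simp
      hence "real n * (\<integral>x. h r i x powr \<alpha>' \<partial>M) \<le> (if i = r then \<beta> else 1)"
        unfolding hp using l_moment(2)[OF a] n_pos by (auto simp: int_l3)
      thus "0 \<le> real n * (\<integral>x. h r i x powr \<alpha>' \<partial>M) \<and> real n * (\<integral>x. h r i x powr \<alpha>' \<partial>M) \<le> (if i = r then \<beta> else 1)"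
        by auto
    qed
    also have "(\<Prod>i<j. if i = r then \<beta> else 1) = \<beta>" using r by simp
    finally show ?thesis by simp
  qed
  have [measurable]: "t j \<in> borel_measurable (iid {..<j})" using j by (intro t_meas) auto
  have cm[measurable]: "(\<lambda>x. l (x i)) \<in> borel_measurable (iid {..<j})" if "i < j" for i
    using that by (intro measurable_compose[OF measurable_component_singleton[of i "{..<j}" "\<lambda>_. M"] lM]) auto
  have tj: "integrable (iid {..<j}) (t j)" using j by (intro t_props)
  have i1: "integrable (iid {..<j}) (\<lambda>x. (\<Prod>i<j. iexp (\<tau> * l (x i)) - 1) * t j x)"
  proof (rule Bochner_Integration.integrable_bound)
    show "integrable (iid {..<j}) (\<lambda>x. 2 ^ j * t j x)" using tj by simp
    show "AE x in iid {..<j}. norm ((\<Prod>i<j. iexp (\<tau> * l (x i)) - 1) * t j x) \<le> norm (2 ^ j * t j x)"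
      using norm_prod_iexp_le[of \<tau> _ "{..<j}" "{}"]
      by (intro AE_I2) (auto simp: norm_mult abs_mult intro!: mult_right_mono simp del: of_real_mult)
  qed measurable
  have i2r: "integrable (iid {..<j}) (\<lambda>x. (\<Prod>i<j. l (x i)) * t j x)"
  proof (rule Bochner_Integration.integrable_bound)
    show "integrable (iid {..<j}) (\<lambda>x. (\<Prod>i<j. \<bar>l (x i)\<bar>) * \<bar>t j x\<bar>)"
      using l_moment(1)[OF a] by (intro young_int(1)[OF j a1, of "\<lambda>_ x. \<bar>l x\<bar>"]) auto
  qed (auto simp: abs_mult abs_prod)
  have i2: "integrable (iid {..<j}) (\<lambda>x. (\<Prod>i<j. \<i> * complex_of_real (\<tau> * l (x i))) * t j x)"
  proof -
    have "(\<Prod>i<j. \<i> * complex_of_real (\<tau> * l (x i))) * t j x = (\<i> * \<tau>) ^ j * complex_of_real ((\<Prod>i<j. l (x i)) * t j x)" for x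
      by (simp add: prod.distrib power_mult_distrib)
    thus ?thesis using i2r by (simp only:) (intro integrable_mult_right integrable_of_real)
  qed
  have bh: "(\<i> * \<tau>) ^ j * bhat j = (\<integral>x. (\<Prod>i<j. \<i> * complex_of_real (\<tau> * l (x i))) * t j x \<partial>iid {..<j})"
  proof -
    have eq: "(\<Prod>i<j. \<i> * complex_of_real (\<tau> * l (x i))) * t j x = (\<i> * \<tau>) ^ j * complex_of_real ((\<Prod>i<j. l (x i)) * t j x)" for x
      by (simp add: prod.distrib power_mult_distrib)
    show ?thesis unfolding eq bhat_def by (simp only: integral_mult_right_zero integral_complex_of_real)
  qed
  have pw: "cmod ((\<Prod>i<j. iexp (\<tau> * l (x i)) - 1) * t j x - (\<Prod>i<j. \<i> * complex_of_real (\<tau> * l (x i))) * t j x)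
     \<le> (\<Sum>r<j. 2 * (1 + \<tau>) ^ (k + 1) * H r x)" for x
  proof -
    let ?w = "\<lambda>i. iexp (\<tau> * l (x i)) - 1" and ?u = "\<lambda>i. \<i> * complex_of_real (\<tau> * l (x i))"
    have "cmod ((\<Prod>i<j. ?w i) - (\<Prod>i<j. ?u i)) \<le> (\<Sum>r<j. cmod (?w r - ?u r) * (\<Prod>i\<in>{..<j} - {r}. cmod (?u i)))"
      using norm_iexp_minus_one_le_abs by (intro norm_prod_diff_telescope) (auto simp: norm_mult simp del: of_real_mult)
    also have "\<dots> \<le> (\<Sum>r<j. 2 * (1 + \<tau>) ^ (k + 1) * (\<Prod>i<j. h r i (x i)))"
    proof (rule sum_mono)
      fix r assume r: "r \<in> {..<j}"
      have "(\<Prod>i\<in>{..<j} - {r}. cmod (?u i)) = (\<Prod>i\<in>{..<j} - {r}. \<tau> * h r i (x i))"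
        using \<tau> by (intro prod.cong) (auto simp: norm_mult abs_mult h_def)
      also have "\<dots> = \<tau> ^ (j - 1) * (\<Prod>i\<in>{..<j} - {r}. h r i (x i))"
        using r by (simp add: prod.distrib)
      finally have 1: "(\<Prod>i\<in>{..<j} - {r}. cmod (?u i)) = \<tau> ^ (j - 1) * (\<Prod>i\<in>{..<j} - {r}. h r i (x i))" .
      have "cmod (?w r - ?u r) \<le> 2 * \<bar>\<tau> * l (x r)\<bar> powr s"
        using s by (intro norm_iexp_minus_linear_le)
      also have "\<dots> = 2 * \<tau> powr s * h r r (x r)"
        using \<tau> by (simp add: powr_abs_mult h_def)
      finally have 2: "cmod (?w r - ?u r) \<le> 2 * \<tau> powr s * h r r (x r)" .
      have "cmod (?w r - ?u r) * (\<Prod>i\<in>{..<j} - {r}. cmod (?u i)) \<le>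
        (2 * \<tau> powr s * h r r (x r)) * (\<tau> ^ (j - 1) * (\<Prod>i\<in>{..<j} - {r}. h r i (x i)))"
        unfolding 1 using \<tau> by (intro mult_right_mono 2 mult_nonneg_nonneg prod_nonneg ballI h0) auto
      also have "\<dots> = 2 * (\<tau> powr s * \<tau> ^ (j - 1)) * (\<Prod>i<j. h r i (x i))"
        using prod.remove[of "{..<j}" r "\<lambda>i. h r i (x i)"] r by simp
      also have "\<dots> \<le> 2 * (1 + \<tau>) ^ (k + 1) * (\<Prod>i<j. h r i (x i))"
      proof (intro mult_right_mono mult_left_mono prod_nonneg ballI h0)
        have "\<tau> powr s \<le> (1 + \<tau>) powr s" using \<tau> s by (intro powr_mono2) auto
        also have "\<dots> \<le> (1 + \<tau>) powr 2" using \<tau> s by (intro powr_mono) auto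
        also have "\<dots> = (1 + \<tau>) ^ 2" using \<tau> powr_numeral[of "1 + \<tau>" "num.Bit0 num.One"] by simp
        finally have "\<tau> powr s * \<tau> ^ (j - 1) \<le> (1 + \<tau>) ^ 2 * (1 + \<tau>) ^ (j - 1)"
          using \<tau> by (intro mult_mono power_mono) auto
        also have "\<dots> = (1 + \<tau>) ^ (2 + (j - 1))" by (rule power_add[symmetric])
        also have "\<dots> \<le> (1 + \<tau>) ^ (k + 1)" using j \<tau> by (intro power_increasing) auto
        finally show "\<tau> powr s * \<tau> ^ (j - 1) \<le> (1 + \<tau>) ^ (k + 1)" .
      qed auto
      finally show "cmod (?w r - ?u r) * (\<Prod>i\<in>{..<j} - {r}. cmod (?u i)) \<le> 2 * (1 + \<tau>) ^ (k + 1) * (\<Prod>i<j. h r i (x i))" .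
    qed
    finally have "cmod ((\<Prod>i<j. ?w i) - (\<Prod>i<j. ?u i)) * \<bar>t j x\<bar> \<le> (\<Sum>r<j. 2 * (1 + \<tau>) ^ (k + 1) * (\<Prod>i<j. h r i (x i))) * \<bar>t j x\<bar>"
      by (rule mult_right_mono) simp
    moreover have "cmod ((\<Prod>i<j. ?w i) * t j x - (\<Prod>i<j. ?u i) * t j x) = cmod ((\<Prod>i<j. ?w i) - (\<Prod>i<j. ?u i)) * \<bar>t j x\<bar>"
      by (simp only: left_diff_distrib[symmetric] norm_mult norm_of_real)
    moreover have "(\<Sum>r<j. 2 * (1 + \<tau>) ^ (k + 1) * (\<Prod>i<j. h r i (x i))) * \<bar>t j x\<bar> = (\<Sum>r<j. 2 * (1 + \<tau>) ^ (k + 1) * H r x)"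
      unfolding sum_distrib_right H_def by (intro sum.cong refl) (simp only: mult.assoc)
    ultimately show ?thesis by (simp only:)
  qed
  have "cmod (ahat \<tau> j - (\<i> * \<tau>) ^ j * bhat j) \<le>
    (\<integral>x. cmod ((\<Prod>i<j. iexp (\<tau> * l (x i)) - 1) * t j x - (\<Prod>i<j. \<i> * complex_of_real (\<tau> * l (x i))) * t j x) \<partial>iid {..<j})"
    unfolding bh ahat_def Bochner_Integration.integral_diff[OF i1 i2, symmetric]
    by (rule integral_norm_bound)
  also have "\<dots> \<le> (\<integral>x. (\<Sum>r<j. 2 * (1 + \<tau>) ^ (k + 1) * H r x) \<partial>iid {..<j})"
    by (intro integral_mono pw integrable_norm Bochner_Integration.integrable_diff i1 i2
        Bochner_Integration.integrable_sum integrable_mult_right Hint)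
  also have "\<dots> = (\<Sum>r<j. 2 * (1 + \<tau>) ^ (k + 1) * (\<integral>x. H r x \<partial>iid {..<j}))"
    using Hint by (subst Bochner_Integration.integral_sum) auto
  finally have "real (n choose j) * cmod (ahat \<tau> j - (\<i> * \<tau>) ^ j * bhat j) \<le>
    real (n choose j) * (\<Sum>r<j. 2 * (1 + \<tau>) ^ (k + 1) * (\<integral>x. H r x \<partial>iid {..<j}))"
    by (intro mult_left_mono) auto
  also have "\<dots> = (\<Sum>r<j. 2 * (1 + \<tau>) ^ (k + 1) * (real (n choose j) * (\<integral>x. H r x \<partial>iid {..<j})))"
    unfolding sum_distrib_left by (intro sum.cong refl) simp
  also have "\<dots> \<le> (\<Sum>r<j. 2 * (1 + \<tau>) ^ (k + 1) * (\<beta> + \<gamma>))"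
    using \<tau> by (intro sum_mono mult_left_mono Hle) auto
  also have "\<dots> = real j * (2 * (1 + \<tau>) ^ (k + 1) * (\<beta> + \<gamma>))" by simp
  also have "\<dots> \<le> real k * (2 * (1 + \<tau>) ^ (k + 1) * (\<beta> + \<gamma>))"
    using j \<tau> \<beta>_pos \<gamma>_nonneg by (intro mult_right_mono) auto
  finally show ?thesis by (simp add: mult.assoc mult.left_commute)
qed

end

section \<open>The main theorem\<close>

definition cf_const1 :: "nat \<Rightarrow> real" where
  "cf_const1 k = 2 * 6 ^ k * (2 * real k + 3) * (real k + 1)"

text \<open>\<open>exp (real k)\<close> bounds the loss in the powers of \<phi>; inside the bracket
  \<open>young_const\<close> is for j > p and 2k for the linearization when j \<le> p. The last
  summand is the normal approximation of the powers of \<phi>, weighted with |\<kappa> j| \<le>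
  2.\<close>

definition cf_const2 :: "nat \<Rightarrow> real \<Rightarrow> real" where
  "cf_const2 k \<alpha> = exp (real k) * (young_const k \<alpha> + 2 * real k) + 2 * decay_const k"

text \<open>The error between the characteristic functions, divided by \<tau> (\<beta> + \<gamma>),
  is at most this function. The threshold k + 1 is the frequency above which k + 1 blocks are
  guaranteed to fit; the exponent 3k + 4 dominates the powers 3k, k + 1 and j + 4 that occur. Only
  positive frequencies matter, hence the value 0 for x < 0.\<close>

definition cf_bound :: "nat \<Rightarrow> real \<Rightarrow> real \<Rightarrow> real" where
  "cf_bound k \<alpha> x = (if x < 0 then 0 else
     cf_const1 k * (if x \<le> real k + 1 then 1
       else x powr (- 1 - (2 - \<alpha>) / 2) + x * exp (- (x powr ((2 - \<alpha>) / 2)) / 6)) +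
     (decay_const k + real k * cf_const2 k \<alpha>) * ((1 + x) ^ (3 * k + 4) * exp (- x\<^sup>2 / 3)))"

lemma decay_const_pos: "0 < decay_const k"
  by (simp add: decay_const_def)

lemma cf_const2_nonneg: "0 \<le> cf_const2 k \<alpha>"
  using young_const_ge_1[of k \<alpha>] decay_const_pos[of k] by (simp add: cf_const2_def)

lemma cf_const1_pos: "0 < cf_const1 k"
  by (simp add: cf_const1_def)

lemma cf_bound_nonneg: "0 \<le> cf_bound k \<alpha> x"
  using decay_const_pos[of k] cf_const2_nonneg[of k \<alpha>] cf_const1_pos[of k]
  by (auto simp: cf_bound_def intro!: add_nonneg_nonneg mult_nonneg_nonneg)

lemma integrable_powr_tail:
  assumes "\<delta> > (0::real)"
  shows "integrable lborel (\<lambda>x. indicator {1..} x * x powr (- 1 - \<delta>))"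
proof -
  have "((\<lambda>x. x powr (- 1 - \<delta>)) has_integral - (1 powr (- 1 - \<delta> + 1)) / (- 1 - \<delta> + 1)) {1..}"
    using assms by (intro has_integral_powr_to_inf) auto
  hence "(\<lambda>x. x powr (- 1 - \<delta>)) absolutely_integrable_on {1..}"
    by (intro nonnegative_absolutely_integrable_1) (auto simp: has_integral_integrable)
  hence "integrable (completion lborel) (\<lambda>x. indicator {1..} x * x powr (- 1 - \<delta>))"
    by (simp add: set_integrable_def)
  thus ?thesis by (subst (asm) integrable_completion) auto
qed

text \<open>A limit at infinity gives the bound from some R on, and compactness gives it on [0, R].
  This turns asymptotic decay into a majorant on the whole half-line.\<close>

lemma bounded_times_powr:
  fixes f :: "real \<Rightarrow> real"
  assumes "continuous_on {0..} f" "((\<lambda>x. f x * x powr s) \<longlongrightarrow> 0) at_top"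
  shows "\<exists>C. \<forall>x\<ge>0. \<bar>f x\<bar> \<le> C * (if x \<le> 1 then 1 else x powr (- s))"
proof -
  have "eventually (\<lambda>x. \<bar>f x * x powr s\<bar> < 1) at_top"
    using order_tendstoD(2)[OF tendsto_norm[OF assms(2)], of 1] by simp
  then obtain R0 where R0: "\<And>x. x \<ge> R0 \<Longrightarrow> \<bar>f x * x powr s\<bar> < 1"
    by (auto simp: eventually_at_top_linorder)
  define R where "R = max R0 1"
  have "compact (f ` {0..R})"
    by (intro compact_continuous_image continuous_on_subset[OF assms(1)]) auto
  then obtain B where B: "\<And>x. x \<in> {0..R} \<Longrightarrow> \<bar>f x\<bar> \<le> B"
    using compact_imp_bounded bounded_iff by (metis imageI real_norm_def)
  have "\<bar>f 0\<bar> \<le> B" by (rule B) (simp add: R_def)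
  hence B0: "0 \<le> B" by simp
  \<comment> \<open>The maximum with 1 takes care of negative s, for which x powr s decreases on
    [1, R].\<close>
  define D where "D = Max {1, R powr s}"
  have "\<bar>f x\<bar> \<le> (B * D + B + 1) * (if x \<le> 1 then 1 else x powr (- s))" if x: "x \<ge> 0" for x
  proof (cases "x \<le> 1")
    case True
    hence "\<bar>f x\<bar> \<le> B" using x by (intro B) (auto simp: R_def)
    moreover have "0 \<le> B * D" using B0 by (simp add: D_def max_def)
    ultimately show ?thesis using True by simp
  next
    case False
    show ?thesis
    proof (cases "x \<le> R")
      case True
      have "x powr s \<le> D"
      proof (cases "s \<ge> 0")
        case True
        have "x powr s \<le> R powr s" using x \<open>x \<le> R\<close> True by (intro powr_mono2) auto
        thus ?thesis by (simp add: D_def)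
      next
        case False
        hence "x powr s \<le> x powr 0" using \<open>\<not> x \<le> 1\<close> by (intro powr_mono) auto
        thus ?thesis using \<open>\<not> x \<le> 1\<close> by (simp add: D_def)
      qed
      hence 1: "1 \<le> D * x powr (- s)" using False by (simp add: powr_minus field_simps)
      have "\<bar>f x\<bar> \<le> B * 1" using x True B by simp
      also have "\<dots> \<le> B * (D * x powr (- s))" using B0 1 by (intro mult_left_mono)
      also have "\<dots> \<le> (B * D + B + 1) * x powr (- s)" using B0 by (simp add: algebra_simps)
      finally show ?thesis using False by simp
    next
      case RF: False
      hence "R0 \<le> x" by (simp add: R_def)
      from R0[OF this] have "\<bar>f x\<bar> * x powr s \<le> 1" by (simp add: abs_mult)
      hence "\<bar>f x\<bar> \<le> 1 * x powr (- s)" using False by (simp add: powr_minus field_simps)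
      also have "\<dots> \<le> (B * D + B + 1) * x powr (- s)"
        using B0 by (intro mult_right_mono) (auto simp: D_def max_def)
      finally show ?thesis using False by simp
    qed
  qed
  thus ?thesis by blast
qed

lemma integrable_cf_bound:
  assumes "\<alpha> < 2"
  shows "integrable lborel (cf_bound k \<alpha>)"
proof -
  define \<delta> where "\<delta> = (2 - \<alpha>) / 2"
  have \<delta>: "\<delta> > 0" using assms by (simp add: \<delta>_def)
  let ?N = "3 * k + 4"
  \<comment> \<open>Both exponential terms are compared with the tail of the power term, with
    exponent -(1 + \<delta>), so that one majorant serves all; it is integrable because \<delta> >
    0, which is where \<alpha> < 2 enters.\<close>
  have "\<exists>C. \<forall>x\<ge>0. \<bar>x * exp (- (x powr \<delta>) / 6)\<bar> \<le> C * (if x \<le> 1 then 1 else x powr (- (1 + \<delta>)))"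
  proof (rule bounded_times_powr)
    show "((\<lambda>x. x * exp (- (x powr \<delta>) / 6) * x powr (1 + \<delta>)) \<longlongrightarrow> 0) at_top"
      using \<delta> by real_asymp
    have "continuous_on {0..} (\<lambda>x. x powr \<delta>)"
      using \<delta> by (intro continuous_on_powr' continuous_intros) auto
    thus "continuous_on {0..} (\<lambda>x. x * exp (- (x powr \<delta>) / 6))"
      by (intro continuous_on_mult continuous_on_id continuous_on_exp continuous_on_divide continuous_on_minus continuous_on_const) auto
  qed
  then obtain C1 where C1: "\<And>x. x \<ge> 0 \<Longrightarrow> \<bar>x * exp (- (x powr \<delta>) / 6)\<bar> \<le> C1 * (if x \<le> 1 then 1 else x powr (- (1 + \<delta>)))" by blast
  have "\<exists>C. \<forall>x\<ge>0. \<bar>(1 + x) ^ ?N * exp (- x\<^sup>2 / 3)\<bar> \<le> C * (if x \<le> 1 then 1 else x powr (- (1 + \<delta>)))"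
  proof (rule bounded_times_powr)
    show "((\<lambda>x. (1 + x) ^ ?N * exp (- x\<^sup>2 / 3) * x powr (1 + \<delta>)) \<longlongrightarrow> 0) at_top"
      by real_asymp
  qed (auto intro!: continuous_intros)
  then obtain C2 where C2: "\<And>x. x \<ge> 0 \<Longrightarrow> \<bar>(1 + x) ^ ?N * exp (- x\<^sup>2 / 3)\<bar> \<le> C2 * (if x \<le> 1 then 1 else x powr (- (1 + \<delta>)))" by blast
  define c where "c = cf_const1 k * (1 + \<bar>C1\<bar>) + (decay_const k + real k * cf_const2 k \<alpha>) * C2"
  define g where "g = (\<lambda>x. indicator {0..real k + 1} x * cf_const1 k + c * (indicator {0..1} x + indicator {1..} x * x powr (- 1 - \<delta>)))"
  have ig: "integrable lborel g"
    unfolding g_def using integrable_powr_tail[OF \<delta>]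
    by (intro Bochner_Integration.integrable_add integrable_mult_right integrable_mult_left)
      (auto simp: integrable_indicator_iff emeasure_lborel_Icc_eq)
  have C20: "0 \<le> C2" using C2[of 0] by simp
  have c0: "0 \<le> c"
    unfolding c_def using C20 decay_const_pos[of k] cf_const2_nonneg[of k \<alpha>] cf_const1_pos[of k]
    by (intro add_nonneg_nonneg mult_nonneg_nonneg) auto
  have le: "cf_bound k \<alpha> x \<le> g x" if x: "x \<ge> 0" for x
  proof -
    let ?q = "if x \<le> 1 then 1 else x powr (- (1 + \<delta>))"
    have q0: "0 \<le> ?q" by simp
    have qle: "?q \<le> indicator {0..1} x + indicator {1..} x * x powr (- 1 - \<delta>)"
      using x by (auto simp: indicator_def algebra_simps)
    have 2: "(decay_const k + real k * cf_const2 k \<alpha>) * ((1 + x) ^ ?N * exp (- x\<^sup>2 / 3)) \<le> (decay_const k + real k * cf_const2 k \<alpha>) * (C2 * ?q)"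
      using C2[OF x] decay_const_pos[of k] cf_const2_nonneg[of k \<alpha>] by (intro mult_left_mono) auto
    have 1: "cf_const1 k * (if x \<le> real k + 1 then 1 else x powr (- 1 - \<delta>) + x * exp (- (x powr \<delta>) / 6))
       \<le> indicator {0..real k + 1} x * cf_const1 k + cf_const1 k * ((1 + \<bar>C1\<bar>) * ?q)"
    proof (cases "x \<le> real k + 1")
      case True
      thus ?thesis using x q0 cf_const1_pos[of k] by simp
    next
      case False
      hence x1: "\<not> x \<le> 1" by simp
      have "x * exp (- (x powr \<delta>) / 6) \<le> \<bar>C1\<bar> * x powr (- (1 + \<delta>))"
        using C1[OF x] x1 by (smt (verit) mult_right_mono powr_ge_zero)
      hence "x powr (- 1 - \<delta>) + x * exp (- (x powr \<delta>) / 6) \<le> (1 + \<bar>C1\<bar>) * ?q"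
        using x1 by (simp add: algebra_simps)
      hence "cf_const1 k * (x powr (- 1 - \<delta>) + x * exp (- (x powr \<delta>) / 6)) \<le> cf_const1 k * ((1 + \<bar>C1\<bar>) * ?q)"
        using cf_const1_pos[of k] by (intro mult_left_mono) auto
      thus ?thesis using False by simp
    qed
    have "cf_bound k \<alpha> x = cf_const1 k * (if x \<le> real k + 1 then 1 else x powr (- 1 - \<delta>) + x * exp (- (x powr \<delta>) / 6))
      + (decay_const k + real k * cf_const2 k \<alpha>) * ((1 + x) ^ ?N * exp (- x\<^sup>2 / 3))"
      using x by (simp add: cf_bound_def \<delta>_def)
    also have "\<dots> \<le> indicator {0..real k + 1} x * cf_const1 k + c * ?q"
      using 1 2 unfolding c_def by (simp only: distrib_right mult.assoc)
    also have "\<dots> \<le> g x"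
      unfolding g_def using qle c0 by (intro add_left_mono mult_left_mono)
    finally show ?thesis .
  qed
  show ?thesis
  proof (rule Bochner_Integration.integrable_bound[OF ig])
    show "cf_bound k \<alpha> \<in> borel_measurable lborel" unfolding cf_bound_def by measurable
    show "AE x in lborel. norm (cf_bound k \<alpha> x) \<le> norm (g x)"
    proof (rule AE_I2)
      fix x
      show "norm (cf_bound k \<alpha> x) \<le> norm (g x)"
      proof (cases "x < 0")
        case True
        thus ?thesis by (simp add: cf_bound_def)
      next
        case False
        thus ?thesis using le[of x] cf_bound_nonneg[of k \<alpha> x] by simp
      qed
    qed
  qed
qed

text \<open>The set under the maximum is finite and contains 0. For \<alpha> \<le> 3/2 the quotient
  is at most 1, so a positive index j \<le> \<open>pidx \<alpha> k\<close> already implies \<alpha>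
  > 3/2.\<close>

lemma pidx_props:
  assumes "1 \<le> \<alpha>" "\<alpha> < 2"
  shows "pidx \<alpha> k \<le> k"
    and "\<And>j. 1 \<le> j \<Longrightarrow> j \<le> pidx \<alpha> k \<Longrightarrow> \<alpha> > 3/2 \<and> real j < (\<alpha> - 1) / (2 - \<alpha>)"
    and "\<And>j. pidx \<alpha> k < j \<Longrightarrow> j \<le> k \<Longrightarrow> (\<alpha> - 1) / (2 - \<alpha>) \<le> real j"
proof -
  let ?S = "{0} \<union> {q. q \<le> k \<and> real q < (\<alpha> - 1) / (2 - \<alpha>)}"
  have fin: "finite ?S" by (rule finite_subset[of _ "{..k}"]) auto
  have "pidx \<alpha> k \<in> ?S" unfolding pidx_def using fin by (intro Max_in) auto
  thus "pidx \<alpha> k \<le> k" by auto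
  {
    fix j assume j: "1 \<le> j" "j \<le> pidx \<alpha> k"
    with \<open>pidx \<alpha> k \<in> ?S\<close> have "real (pidx \<alpha> k) < (\<alpha> - 1) / (2 - \<alpha>)" by auto
    hence lt: "real j < (\<alpha> - 1) / (2 - \<alpha>)" using j by simp
    hence "1 < (\<alpha> - 1) / (2 - \<alpha>)" using j by simp
    hence "\<alpha> > 3/2" using assms by (simp add: field_simps)
    with lt show "\<alpha> > 3/2 \<and> real j < (\<alpha> - 1) / (2 - \<alpha>)" by simp
  }
  fix j assume j: "pidx \<alpha> k < j" "j \<le> k"
  show "(\<alpha> - 1) / (2 - \<alpha>) \<le> real j"
  proof (rule ccontr)
    assume "\<not> ?thesis"
    hence "j \<in> ?S" using j by auto
    hence "j \<le> pidx \<alpha> k" unfolding pidx_def using fin by (intro Max_ge)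
    with j show False by simp
  qed
qed

section \<open>Collecting the estimates of the characteristic function\<close>

context ustat
begin

abbreviation "\<kappa> \<equiv> kappa k n M l t"
abbreviation "p \<equiv> pidx \<alpha> k"

text \<open>For j \<le> p the exponent j \<theta> stays below 1, so \<beta>^(j \<theta>) is at most
  1 or at most \<beta>. The form with the maximum serves both cases of the theorem: it is at most 2
  if \<beta> + \<gamma> \<le> 1, and at most 2 (\<beta> + \<gamma>) otherwise.\<close>

lemma abs_kappa_le:
  assumes j: "1 \<le> j" "j \<le> p"
  shows "\<bar>\<kappa> j\<bar> \<le> \<gamma> + max 1 \<beta>"
proof -
  have a: "\<alpha> > 3/2" "real j < (\<alpha> - 1) / (2 - \<alpha>)" and jk: "j \<in> {1..k}"
    using pidx_props(1)[OF \<alpha>, of k] pidx_props(2)[OF \<alpha> j] j by auto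
  note b = \<alpha>'_bounds[OF a(1)]
  have tj: "\<theta> * real j < 1" unfolding b(5) using a \<alpha> by (simp add: field_simps)
  have "(\<beta> powr \<theta>) ^ j = \<beta> powr (\<theta> * real j)"
    using \<beta>_pos by (simp add: powr_powr flip: powr_realpow)
  also have "\<dots> \<le> max 1 \<beta>"
  proof (cases "\<beta> \<le> 1")
    case True
    have "\<beta> powr (\<theta> * real j) \<le> 1 powr (\<theta> * real j)"
      using True \<beta>_pos b(3) by (intro powr_mono2) auto
    thus ?thesis by simp
  next
    case False
    have "\<beta> powr (\<theta> * real j) \<le> \<beta> powr 1" using False tj by (intro powr_mono) auto
    thus ?thesis using \<beta>_pos by simp
  qed
  finally show ?thesis using kappa_le[OF a(1) jk] by simp
qed

text \<open>Up to k + 1 the plain expansion loses only a constant, by \<tau>^\<alpha> \<le> \<tau>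
  (k + 1); beyond it the block expansion is available. In both cases a factor \<tau> is split off
  for the smoothing inequality.\<close>

lemma fS_first_order_le:
  assumes \<tau>: "0 < \<tau>" "\<tau> \<le> 1 / \<beta>"
  shows "cmod (fS \<tau> - \<phi> \<tau> ^ n - \<i> * \<tau> * fLT \<tau>) \<le> \<tau> * \<gamma> * (cf_const1 k * (if \<tau> \<le> real k + 1 then 1
       else \<tau> powr (- 1 - (2 - \<alpha>) / 2) + \<tau> * exp (- (\<tau> powr ((2 - \<alpha>) / 2)) / 6)))"
proof (cases "\<tau> \<le> real k + 1")
  case True
  have "\<tau> powr \<alpha> = \<tau> * \<tau> powr (\<alpha> - 1)"
    using \<tau> by (simp add: powr_mult_base)
  also have "\<tau> powr (\<alpha> - 1) \<le> (real k + 1) powr (\<alpha> - 1)"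
    using \<tau> True \<alpha> by (intro powr_mono2) auto
  also have "\<dots> \<le> (real k + 1) powr 1" using \<alpha> by (intro powr_mono) auto
  finally have t: "\<tau> powr \<alpha> \<le> \<tau> * (real k + 1)" using \<tau> by simp
  have "cmod (fS \<tau> - \<phi> \<tau> ^ n - \<i> * \<tau> * fLT \<tau>) \<le> 2 * \<bar>\<tau>\<bar> powr \<alpha> * (6 ^ k * \<gamma>)"
    by (rule fS_expand_small)
  also have "\<dots> \<le> 2 * (\<tau> * (real k + 1)) * (6 ^ k * \<gamma>)"
    using t \<tau> \<gamma>_nonneg by (intro mult_right_mono mult_left_mono) auto
  also have "\<dots> = \<tau> * \<gamma> * (2 * 6 ^ k * 1 * (real k + 1))" by simp
  also have "\<dots> \<le> \<tau> * \<gamma> * cf_const1 k"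
    unfolding cf_const1_def using \<tau> \<gamma>_nonneg by (intro mult_left_mono mult_right_mono) auto
  finally show ?thesis using True by simp
next
  case False
  define \<delta> where "\<delta> = (2 - \<alpha>) / 2"
  have \<delta>: "0 < \<delta>" "\<delta> \<le> 1/2" "\<alpha> = 2 - 2 * \<delta>" using \<alpha> by (auto simp: \<delta>_def field_simps)
  have t1: "1 \<le> \<tau>" using False by simp
  \<comment> \<open>For m of order n \<tau>^e the term with m/n is integrable against d\<tau>/\<tau>
    if e < -\<alpha>, and \<phi>^m decays like the exponential of a negative power term if e > -2.
    The exponent \<delta> - 2 is the midpoint of -2 and -\<alpha>.\<close>
  define m where "m = nat \<lfloor>real n * \<tau> powr (\<delta> - 2)\<rfloor>"
  have sq: "\<tau>\<^sup>2 \<le> real n" by (rule tau_sq_le[OF \<tau>])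
  have p2: "\<tau> powr 2 = \<tau>\<^sup>2" using \<tau> powr_numeral[of \<tau> "num.Bit0 num.One"] by simp
  have big: "1 \<le> real n * \<tau> powr (\<delta> - 2)"
  proof -
    have "1 \<le> \<tau> powr \<delta>" using t1 \<delta> by (intro ge_one_powr_ge_zero) auto
    also have "\<dots> = \<tau> powr 2 * \<tau> powr (\<delta> - 2)" by (simp flip: powr_add)
    also have "\<dots> \<le> real n * \<tau> powr (\<delta> - 2)" using sq p2 by (intro mult_right_mono) auto
    finally show ?thesis .
  qed
  have m_le: "real m \<le> real n * \<tau> powr (\<delta> - 2)" using big by (simp add: m_def)
  \<comment> \<open>Since \<tau>^2 \<le> n, the number before rounding is at least 1, so rounding
    down loses at most half of it.\<close>
  have m_ge: "real n * \<tau> powr (\<delta> - 2) / 2 \<le> real m"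
  proof -
    have "1 \<le> \<lfloor>real n * \<tau> powr (\<delta> - 2)\<rfloor>" using big by (simp add: le_floor_iff)
    hence "real m = of_int \<lfloor>real n * \<tau> powr (\<delta> - 2)\<rfloor>" "(1::real) \<le> of_int \<lfloor>real n * \<tau> powr (\<delta> - 2)\<rfloor>"
      by (simp_all add: m_def)
    moreover have "real n * \<tau> powr (\<delta> - 2) < of_int \<lfloor>real n * \<tau> powr (\<delta> - 2)\<rfloor> + 1"
      by simp
    ultimately show ?thesis by linarith
  qed
  \<comment> \<open>The k + 1 blocks fit because \<tau> > k + 1 and \<tau> times \<tau>^(\<delta> -
    2) is at most 1.\<close>
  have km: "(k + 1) * m \<le> n"
  proof -
    have "(real k + 1) * real m \<le> \<tau> * (real n * \<tau> powr (\<delta> - 2))"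
      using False m_le \<tau> by (intro mult_mono) auto
    also have "\<dots> = real n * \<tau> powr (\<delta> - 1)"
      using \<tau> powr_add[of \<tau> 1 "\<delta> - 2"] by simp
    also have "\<dots> \<le> real n * \<tau> powr 0" using t1 \<delta> by (intro mult_left_mono powr_mono) auto
    finally have "real ((k + 1) * m) \<le> real n" using \<tau> by (simp add: algebra_simps)
    thus ?thesis by (simp only: of_nat_le_iff)
  qed
  have phim: "cmod (\<phi> \<tau>) ^ m \<le> exp (- (\<tau> powr \<delta>) / 6)"
  proof -
    have "cmod (\<phi> \<tau>) ^ m \<le> exp (- \<tau>\<^sup>2 / (3 * real n)) ^ m"
      by (intro power_mono norm_\<phi>_le \<tau>) auto
    also have "\<dots> = exp (real m * (- \<tau>\<^sup>2 / (3 * real n)))" by (simp only: exp_of_nat_mult)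
    also have "\<dots> \<le> exp (- (\<tau> powr \<delta>) / 6)"
    proof (subst exp_le_cancel_iff)
      have "\<tau> powr \<delta> / 6 = (real n * \<tau> powr (\<delta> - 2) / 2) * (\<tau>\<^sup>2 / (3 * real n))"
        using n_pos \<tau> unfolding p2[symmetric] by (simp add: powr_diff)
      also have "\<dots> \<le> real m * (\<tau>\<^sup>2 / (3 * real n))" using m_ge n_pos by (intro mult_right_mono) auto
      finally show "real m * (- \<tau>\<^sup>2 / (3 * real n)) \<le> - (\<tau> powr \<delta>) / 6" by simp
    qed
    finally show ?thesis .
  qed
  have A: "real ((k + 1) * m) * (real k / real n) \<le> (real k + 1) * real k * \<tau> powr (\<delta> - 2)"
  proof -
    have "real ((k + 1) * m) * (real k / real n) = (real k + 1) * real k * (real m / real n)" by (simp add: algebra_simps)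
    also have "\<dots> \<le> (real k + 1) * real k * \<tau> powr (\<delta> - 2)"
      using m_le n_pos by (intro mult_left_mono) (auto simp: field_simps)
    finally show ?thesis .
  qed
  have t\<alpha>: "\<tau> powr \<alpha> * \<tau> powr (\<delta> - 2) = \<tau> * \<tau> powr (- 1 - \<delta>)"
  proof -
    have "\<tau> powr \<alpha> * \<tau> powr (\<delta> - 2) = \<tau> powr (- \<delta>)" unfolding \<delta>(3) powr_add[symmetric] by simp
    also have "\<dots> = \<tau> powr 1 * \<tau> powr (- 1 - \<delta>)" unfolding powr_add[symmetric] by simp
    finally show ?thesis using \<tau> by simp
  qed
  have t\<alpha>2: "\<tau> powr \<alpha> \<le> \<tau> * \<tau>"
  proof -
    have "\<tau> powr \<alpha> \<le> \<tau> powr 2" using t1 \<alpha> by (intro powr_mono) auto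
    thus ?thesis unfolding p2 power2_eq_square .
  qed
  have "cmod (fS \<tau> - \<phi> \<tau> ^ n - \<i> * \<tau> * fLT \<tau>) \<le>
    2 * \<bar>\<tau>\<bar> powr \<alpha> * (6 ^ k * \<gamma>) * (real ((k + 1) * m) * (real k / real n) + (2 * real k + 3) * cmod (\<phi> \<tau>) ^ m)"
    by (rule fS_expand_blocks[OF km])
  also have "\<dots> \<le> 2 * \<bar>\<tau>\<bar> powr \<alpha> * (6 ^ k * \<gamma>) * ((real k + 1) * real k * \<tau> powr (\<delta> - 2) + (2 * real k + 3) * exp (- (\<tau> powr \<delta>) / 6))"
    using \<gamma>_nonneg by (intro mult_left_mono add_mono A phim) auto
  also have "\<dots> = 2 * (6 ^ k * \<gamma>) * ((real k + 1) * real k * (\<tau> powr \<alpha> * \<tau> powr (\<delta> - 2)) + (2 * real k + 3) * (\<tau> powr \<alpha> * exp (- (\<tau> powr \<delta>) / 6)))"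
    using \<tau> by (simp add: algebra_simps)
  \<comment> \<open>Both coefficients are raised to the common value (2k + 3)(k + 1) that enters
    \<open>cf_const1\<close>.\<close>
  also have "\<dots> \<le> 2 * (6 ^ k * \<gamma>) * (((2 * real k + 3) * (real k + 1)) * (\<tau> * \<tau> powr (- 1 - \<delta>)) + ((2 * real k + 3) * (real k + 1)) * (\<tau> * \<tau> * exp (- (\<tau> powr \<delta>) / 6)))"
  proof (intro mult_left_mono add_mono)
    show "(real k + 1) * real k * (\<tau> powr \<alpha> * \<tau> powr (\<delta> - 2)) \<le> (2 * real k + 3) * (real k + 1) * (\<tau> * \<tau> powr (- 1 - \<delta>))"
      unfolding t\<alpha> using \<tau> by (intro mult_right_mono) (auto simp: mult.commute intro!: mult_left_mono)
    show "(2 * real k + 3) * (\<tau> powr \<alpha> * exp (- (\<tau> powr \<delta>) / 6)) \<le> (2 * real k + 3) * (real k + 1) * (\<tau> * \<tau> * exp (- (\<tau> powr \<delta>) / 6))"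
    proof (intro mult_mono t\<alpha>2)
      show "2 * real k + 3 \<le> (2 * real k + 3) * (real k + 1)" by (simp add: algebra_simps)
    qed auto
  qed (use \<gamma>_nonneg in auto)
  also have "\<dots> = \<tau> * \<gamma> * (cf_const1 k * (\<tau> powr (- 1 - \<delta>) + \<tau> * exp (- (\<tau> powr \<delta>) / 6)))"
    unfolding cf_const1_def by (simp add: algebra_simps)
  finally show ?thesis using False by (simp add: \<delta>_def)
qed

text \<open>For j > p the whole term is an error, small by \<open>ahat_le_far\<close>; for j \<le> p
  only its distance from the Edgeworth term counts; for j > n both disappear with the binomial
  coefficient.\<close>

lemma fLT_term_le:
  assumes \<tau>: "0 < \<tau>" "\<tau> \<le> 1 / \<beta>" and small: "\<beta> + \<gamma> \<le> 1" and j: "j \<in> {1..k}"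
  shows "cmod ((n choose j) * \<phi> \<tau> ^ (n - j) * ahat \<tau> j - (if j \<le> p then \<kappa> j * (\<i> * \<tau>) ^ j * complex_of_real (exp (- \<tau>\<^sup>2 / 2)) else 0))
    \<le> cf_const2 k \<alpha> * ((1 + \<tau>) ^ (3 * k + 4) * exp (- \<tau>\<^sup>2 / 3)) * (\<beta> + \<gamma>)"
proof -
  define T where "T = (1 + \<tau>) ^ (3 * k + 4)"
  define E where "E = exp (- \<tau>\<^sup>2 / 3)"
  define \<epsilon> where "\<epsilon> = \<beta> + \<gamma>"
  have \<epsilon>: "0 < \<epsilon>" "\<beta> \<le> \<epsilon>" using \<beta>_pos \<gamma>_nonneg by (auto simp: \<epsilon>_def)
  have \<beta>1: "\<beta> \<le> 1" using small \<gamma>_nonneg by simp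
  have T0: "0 \<le> T" "0 < E" using \<tau> by (auto simp: T_def E_def)
  have powT: "(1 + \<tau>) ^ i \<le> T" if "i \<le> 3 * k + 4" for i
    unfolding T_def using \<tau> that by (intro power_increasing) auto
  show ?thesis
  proof (cases "j \<le> n")
    case False
    hence nc: "n choose j = 0" by (simp add: binomial_eq_0)
    have k0: "\<kappa> j = 0" by (simp add: kappa_def nc)
    show ?thesis
      using cf_const2_nonneg[of k \<alpha>] T0 \<epsilon> unfolding T_def[symmetric] E_def[symmetric] \<epsilon>_def[symmetric]
      by (simp add: nc k0)
  next
    case jn: True
    have jk: "j \<le> k" using j by simp
    have ph: "cmod (\<phi> \<tau>) ^ (n - j) \<le> exp (real k) * E"
    proof -
      have "cmod (\<phi> \<tau>) ^ (n - j) \<le> exp (real k / 3) * E"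
        using norm_\<phi>_power_le(2)[OF \<tau> jk jn] by (simp add: E_def)
      also have "\<dots> \<le> exp (real k) * E" using T0 by (intro mult_right_mono) auto
      finally show ?thesis .
    qed
    show ?thesis
    proof (cases "j \<le> p")
      case False
      have "real (n choose j) * cmod (ahat \<tau> j) \<le> young_const k \<alpha> * (1 + \<tau>) ^ (3 * k) * \<epsilon>"
        unfolding \<epsilon>_def using pidx_props(3)[OF \<alpha>, of k j] False jk
        by (intro ahat_le_far j jn \<tau> \<beta>1) auto
      also have "\<dots> \<le> young_const k \<alpha> * T * \<epsilon>"
        using young_const_ge_1[of k \<alpha>] \<epsilon> by (intro mult_right_mono mult_left_mono powT) auto
      finally have le: "real (n choose j) * cmod (ahat \<tau> j) \<le> young_const k \<alpha> * T * \<epsilon>" .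
      have "cmod (\<phi> \<tau>) ^ (n - j) * (real (n choose j) * cmod (ahat \<tau> j)) \<le> (exp (real k) * E) * (young_const k \<alpha> * T * \<epsilon>)"
        by (rule mult_mono[OF ph le]) (use T0 in auto)
      also have "\<dots> = (exp (real k) * young_const k \<alpha>) * (T * E) * \<epsilon>" by simp
      also have "\<dots> \<le> cf_const2 k \<alpha> * (T * E) * \<epsilon>"
        unfolding cf_const2_def using \<epsilon> T0 decay_const_pos[of k]
        by (intro mult_right_mono) (auto simp: distrib_left)
      finally show ?thesis
        using False unfolding T_def E_def \<epsilon>_def by (simp add: norm_mult norm_power mult.assoc mult.left_commute)
    next
      case True
      have a: "\<alpha> > 3/2" using pidx_props(2)[OF \<alpha>, of j k] True j by auto
      have kap: "\<bar>\<kappa> j\<bar> \<le> 2" using abs_kappa_le[of j] True j \<beta>1 small \<beta>_pos by auto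
      have c: "complex_of_real (\<kappa> j) = (n choose j) * bhat j" using kappa_eq[OF a j] by simp
      \<comment> \<open>Two exchanges, one after the other: the coefficient \<open>ahat\<close> by
        its linearization with \<phi>^(n - j) kept as decay, and the power of \<phi> by the normal
        characteristic function with \<kappa> j kept as a bounded factor.\<close>
      have "(n choose j) * \<phi> \<tau> ^ (n - j) * ahat \<tau> j - \<kappa> j * (\<i> * \<tau>) ^ j * exp (- \<tau>\<^sup>2 / 2) =
        \<phi> \<tau> ^ (n - j) * ((n choose j) * (ahat \<tau> j - (\<i> * \<tau>) ^ j * bhat j)) + \<kappa> j * (\<i> * \<tau>) ^ j * (\<phi> \<tau> ^ (n - j) - exp (- \<tau>\<^sup>2 / 2))"
        unfolding c by (simp add: algebra_simps)
      hence "cmod ((n choose j) * \<phi> \<tau> ^ (n - j) * ahat \<tau> j - \<kappa> j * (\<i> * \<tau>) ^ j * exp (- \<tau>\<^sup>2 / 2)) \<le>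
        cmod (\<phi> \<tau> ^ (n - j) * ((n choose j) * (ahat \<tau> j - (\<i> * \<tau>) ^ j * bhat j))) + cmod (\<kappa> j * (\<i> * \<tau>) ^ j * (\<phi> \<tau> ^ (n - j) - exp (- \<tau>\<^sup>2 / 2)))"
        by (metis norm_triangle_ineq)
      also have "cmod (\<phi> \<tau> ^ (n - j) * ((n choose j) * (ahat \<tau> j - (\<i> * \<tau>) ^ j * bhat j))) \<le> (exp (real k) * (2 * real k)) * (T * E) * \<epsilon>"
      proof -
        have "real (n choose j) * cmod (ahat \<tau> j - (\<i> * \<tau>) ^ j * bhat j) \<le> 2 * real k * (1 + \<tau>) ^ (k + 1) * \<epsilon>"
          unfolding \<epsilon>_def by (intro ahat_minus_bhat_le a j jn \<tau> \<beta>1)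
        also have "\<dots> \<le> 2 * real k * T * \<epsilon>"
          using \<epsilon> by (intro mult_right_mono mult_left_mono powT) auto
        finally have le: "real (n choose j) * cmod (ahat \<tau> j - (\<i> * \<tau>) ^ j * bhat j) \<le> 2 * real k * T * \<epsilon>" .
        have "cmod (\<phi> \<tau>) ^ (n - j) * (real (n choose j) * cmod (ahat \<tau> j - (\<i> * \<tau>) ^ j * bhat j)) \<le> (exp (real k) * E) * (2 * real k * T * \<epsilon>)"
          by (rule mult_mono[OF ph le]) (use T0 in auto)
        thus ?thesis by (simp add: norm_mult norm_power mult.assoc mult.left_commute)
      qed
      also have "cmod (\<kappa> j * (\<i> * \<tau>) ^ j * (\<phi> \<tau> ^ (n - j) - exp (- \<tau>\<^sup>2 / 2))) \<le> 2 * decay_const k * (T * E) * \<epsilon>"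
      proof -
        have "\<tau> ^ j * (\<tau> * (1 + \<tau>) ^ 3) \<le> (1 + \<tau>) ^ j * ((1 + \<tau>) ^ 1 * (1 + \<tau>) ^ 3)"
          using \<tau> by (intro mult_mono power_mono) auto
        also have "\<dots> = (1 + \<tau>) ^ (j + 4)" unfolding power_add[symmetric] by simp
        also have "\<dots> \<le> T" using jk by (intro powT) auto
        finally have tT: "\<tau> ^ j * (\<tau> * (1 + \<tau>) ^ 3) \<le> T" .
        have "cmod (\<kappa> j * (\<i> * \<tau>) ^ j * (\<phi> \<tau> ^ (n - j) - exp (- \<tau>\<^sup>2 / 2))) = \<bar>\<kappa> j\<bar> * (\<tau> ^ j * cmod (\<phi> \<tau> ^ (n - j) - exp (- \<tau>\<^sup>2 / 2)))"
          using \<tau> by (simp add: norm_mult norm_power)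
        also have "\<dots> \<le> 2 * (\<tau> ^ j * (decay_const k * \<beta> * \<tau> * (1 + \<tau>) ^ 3 * E))"
          using norm_\<phi>_power_minus_normal_le[OF \<tau> jk jn \<beta>1] kap \<tau>
          unfolding decay_const_def E_def by (intro mult_mono) auto
        also have "\<dots> = 2 * decay_const k * ((\<tau> ^ j * (\<tau> * (1 + \<tau>) ^ 3)) * E) * \<beta>" by simp
        also have "\<dots> \<le> 2 * decay_const k * (T * E) * \<epsilon>"
          using \<epsilon> T0 \<tau> \<beta>_pos decay_const_pos[of k] tT by (intro mult_mono mult_nonneg_nonneg) auto
        finally show ?thesis .
      qed
      also have "(exp (real k) * (2 * real k)) * (T * E) * \<epsilon> + 2 * decay_const k * (T * E) * \<epsilon> =
        (exp (real k) * (2 * real k) + 2 * decay_const k) * (T * E) * \<epsilon>" by (simp add: distrib_right)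
      also have "\<dots> \<le> cf_const2 k \<alpha> * (T * E) * \<epsilon>"
        unfolding cf_const2_def using \<epsilon> T0 young_const_ge_1[of k \<alpha>]
        by (intro mult_right_mono) (auto simp: distrib_left)
      finally show ?thesis using True unfolding T_def E_def \<epsilon>_def by simp
    qed
  qed
qed

lemma fS_minus_edgeworth_le:
  assumes \<tau>: "0 < \<tau>" "\<tau> \<le> 1 / \<beta>" and small: "\<beta> + \<gamma> \<le> 1"
  shows "cmod (fS \<tau> - complex_of_real (exp (- \<tau>\<^sup>2 / 2)) * (1 + (\<Sum>j=1..p. \<kappa> j * (\<i> * \<tau>) ^ (j + 1))))
    \<le> \<tau> * ((\<beta> + \<gamma>) * cf_bound k \<alpha> \<tau>)"
proof -
  let ?e = "complex_of_real (exp (- \<tau>\<^sup>2 / 2))"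
  define TE where "TE = (1 + \<tau>) ^ (3 * k + 4) * exp (- \<tau>\<^sup>2 / 3)"
  define \<epsilon> where "\<epsilon> = \<beta> + \<gamma>"
  define X where "X = cf_const1 k * (if \<tau> \<le> real k + 1 then 1
       else \<tau> powr (- 1 - (2 - \<alpha>) / 2) + \<tau> * exp (- (\<tau> powr ((2 - \<alpha>) / 2)) / 6))"
  have X0: "0 \<le> X" unfolding X_def using \<tau> cf_const1_pos[of k] by auto
  have \<epsilon>: "0 < \<epsilon>" "\<beta> \<le> \<epsilon>" "\<gamma> \<le> \<epsilon>" using \<beta>_pos \<gamma>_nonneg by (auto simp: \<epsilon>_def)
  have \<beta>1: "\<beta> \<le> 1" using small \<gamma>_nonneg by simp
  let ?D = "\<lambda>j. (n choose j) * \<phi> \<tau> ^ (n - j) * ahat \<tau> j - (if j \<le> p then \<kappa> j * (\<i> * \<tau>) ^ j * ?e else 0)"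
  have sumD: "(\<Sum>j=1..k. ?D j) = fLT \<tau> - (\<Sum>j=1..p. \<kappa> j * (\<i> * \<tau>) ^ j * ?e)"
  proof -
    have "(\<Sum>j=1..k. if j \<le> p then \<kappa> j * (\<i> * \<tau>) ^ j * ?e else 0) = (\<Sum>j=1..p. \<kappa> j * (\<i> * \<tau>) ^ j * ?e)"
      using pidx_props(1)[OF \<alpha>, of k] by (intro sum.mono_neutral_cong_right) auto
    thus ?thesis unfolding fLT_eq by (simp add: sum_subtractf)
  qed
  \<comment> \<open>The zeroth-order error is written with exponent n - 0, so that the comparison of
    \<phi>^(n - j) with the normal characteristic function applies with j = 0.\<close>
  have split: "fS \<tau> - ?e * (1 + (\<Sum>j=1..p. \<kappa> j * (\<i> * \<tau>) ^ (j + 1))) =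
    (fS \<tau> - \<phi> \<tau> ^ n - \<i> * \<tau> * fLT \<tau>) + (\<phi> \<tau> ^ (n - 0) - ?e) + (\<i> * \<tau>) * (\<Sum>j=1..k. ?D j)"
    unfolding sumD by (simp add: algebra_simps sum_distrib_left)
  have 1: "cmod (fS \<tau> - \<phi> \<tau> ^ n - \<i> * \<tau> * fLT \<tau>) \<le> \<tau> * \<epsilon> * X"
  proof -
    have "cmod (fS \<tau> - \<phi> \<tau> ^ n - \<i> * \<tau> * fLT \<tau>) \<le> \<tau> * \<gamma> * X" unfolding X_def by (rule fS_first_order_le[OF \<tau>])
    also have "\<dots> \<le> \<tau> * \<epsilon> * X" using \<epsilon> X0 \<tau> by (intro mult_right_mono mult_left_mono) auto
    finally show ?thesis .
  qed
  have 2: "cmod (\<phi> \<tau> ^ (n - 0) - ?e) \<le> \<tau> * \<epsilon> * (decay_const k * TE)"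
  proof -
    have "cmod (\<phi> \<tau> ^ (n - 0) - ?e) \<le> decay_const k * \<beta> * \<tau> * (1 + \<tau>) ^ 3 * exp (- \<tau>\<^sup>2 / 3)"
      unfolding decay_const_def by (rule norm_\<phi>_power_minus_normal_le[OF \<tau> _ _ \<beta>1]) auto
    also have "\<dots> \<le> decay_const k * \<epsilon> * \<tau> * (1 + \<tau>) ^ (3 * k + 4) * exp (- \<tau>\<^sup>2 / 3)"
      using \<epsilon> \<tau> decay_const_pos[of k] \<beta>_pos by (intro mult_right_mono mult_mono power_increasing) auto
    finally show ?thesis by (simp add: TE_def mult.assoc mult.left_commute)
  qed
  have 3: "cmod ((\<i> * \<tau>) * (\<Sum>j=1..k. ?D j)) \<le> \<tau> * \<epsilon> * (real k * cf_const2 k \<alpha> * TE)"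
  proof -
    have "cmod (\<Sum>j=1..k. ?D j) \<le> (\<Sum>j=1..k. cf_const2 k \<alpha> * TE * \<epsilon>)"
      unfolding TE_def \<epsilon>_def by (intro sum_norm_le fLT_term_le \<tau> small)
    hence "\<tau> * cmod (\<Sum>j=1..k. ?D j) \<le> \<tau> * (real k * (cf_const2 k \<alpha> * TE * \<epsilon>))"
      using \<tau> by (intro mult_left_mono) auto
    moreover have "cmod ((\<i> * \<tau>) * (\<Sum>j=1..k. ?D j)) = \<tau> * cmod (\<Sum>j=1..k. ?D j)"
      using \<tau> by (simp only: norm_mult norm_of_real norm_ii abs_of_pos mult_1_left)
    moreover have "\<tau> * (real k * (cf_const2 k \<alpha> * TE * \<epsilon>)) = \<tau> * \<epsilon> * (real k * cf_const2 k \<alpha> * TE)" by simp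
    ultimately show ?thesis by (simp only:)
  qed
  have "cmod (fS \<tau> - ?e * (1 + (\<Sum>j=1..p. \<kappa> j * (\<i> * \<tau>) ^ (j + 1)))) \<le>
    \<tau> * \<epsilon> * X + \<tau> * \<epsilon> * (decay_const k * TE) + \<tau> * \<epsilon> * (real k * cf_const2 k \<alpha> * TE)"
    unfolding split by (intro norm_triangle_le add_mono 1 2 3)
  also have "\<dots> = \<tau> * (\<epsilon> * (X + (decay_const k + real k * cf_const2 k \<alpha>) * TE))" by (simp add: algebra_simps)
  also have "X + (decay_const k + real k * cf_const2 k \<alpha>) * TE = cf_bound k \<alpha> \<tau>"
    using \<tau> by (simp add: cf_bound_def X_def TE_def)
  finally show ?thesis by (simp add: \<epsilon>_def)
qed

lemma SS_meas[measurable]: "SS k n l t \<in> borel_measurable P"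
proof -
  have "TS \<A> \<in> borel_measurable P" by (rule TS_meas) simp
  thus ?thesis unfolding SS_def[abs_def] TT_TS by measurable
qed

lemma FS_eq_cdf: "FS k n M l t x = cdf (distr P borel (SS k n l t)) x"
proof -
  have "cdf (distr P borel (SS k n l t)) x = measure P (SS k n l t -` {..x} \<inter> space P)"
    unfolding cdf_def by (subst measure_distr) auto
  also have "SS k n l t -` {..x} \<inter> space P = {w \<in> space P. SS k n l t w \<le> x}" by auto
  finally show ?thesis by (simp add: FS_def joint_eq)
qed

lemma char_SS: "char (distr P borel (SS k n l t)) \<tau> = fS \<tau>"
  unfolding char_def fS_def by (subst integral_distr) auto

lemma Np_eq: "Np k n M l t p x = Phi x + (\<Sum>j=1..p. (-1) ^ (j + 1) * \<kappa> j * dnormal j x)"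
  unfolding Np_def deriv_Phi ..

end

theorem theorem3:
  fixes k :: nat and \<alpha> :: real
  assumes "k \<ge> 1" and "1 \<le> \<alpha>" and "\<alpha> < 2"
  shows "\<exists>c>0. \<forall>(n::nat) (\<mu>::real measure) (l::real \<Rightarrow> real) (t::nat \<Rightarrow> (nat \<Rightarrow> real) \<Rightarrow> real).
    n \<ge> 1 \<longrightarrow>
    prob_space \<mu> \<longrightarrow> sets \<mu> = sets borel \<longrightarrow>
    l \<in> borel_measurable borel \<longrightarrow>
    integrable \<mu> l \<longrightarrow> (\<integral>x. l x \<partial>\<mu>) = 0 \<longrightarrow>
    integrable \<mu> (\<lambda>x. (l x)\<^sup>2) \<longrightarrow> real n * (\<integral>x. (l x)\<^sup>2 \<partial>\<mu>) = 1 \<longrightarrow>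
    (\<forall>j\<in>{1..k}. t j \<in> borel_measurable (PiM {..<j} (\<lambda>_. borel)) \<and> symmetric_fun j (t j) \<and>
        integrable (joint j \<mu>) (t j) \<and> degenerate \<mu> j (t j)) \<longrightarrow>
    integrable \<mu> (\<lambda>x. \<bar>l x\<bar> ^ 3) \<longrightarrow>
    (\<forall>j\<in>{1..k}. j \<le> n \<longrightarrow> integrable (joint j \<mu>) (\<lambda>x. \<bar>t j x\<bar> powr \<alpha>)) \<longrightarrow>
    (\<forall>x. \<bar>FS k n \<mu> l t x - Np k n \<mu> l t (pidx \<alpha> k) x\<bar>
           \<le> c * (beta n \<mu> l + gamma \<alpha> k n \<mu> t))"
proof (rule esseen_smoothing)
  \<comment> \<open>C, like all constants below, is fixed before n, \<mu>, l and t are introduced;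
    this gives the uniformity of c.\<close>
  fix C :: real
  let ?p = "pidx \<alpha> k"
  assume C: "C > 0" and smoothing: "\<And>M G D B U K x. real_distribution M \<Longrightarrow>
    (\<And>x. (G has_real_derivative D x) (at x)) \<Longrightarrow> continuous_on UNIV D \<Longrightarrow> integrable lborel D \<Longrightarrow>
    (G \<longlongrightarrow> 0) at_bot \<Longrightarrow> (\<exists>b. \<forall>x. \<bar>G x\<bar> \<le> b) \<Longrightarrow> 0 < K \<Longrightarrow> (\<And>x. \<bar>D x\<bar> \<le> K) \<Longrightarrow> 0 < U \<Longrightarrow>
    integrable lborel B \<Longrightarrow> (\<And>t. 0 \<le> B t) \<Longrightarrow>
    (\<And>t. 0 < t \<Longrightarrow> t \<le> U \<Longrightarrow> cmod (char M t - (\<integral>x. D x *\<^sub>R iexp (t * x) \<partial>lborel)) \<le> t * B t) \<Longrightarrow>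
    \<bar>cdf M x - G x\<bar> \<le> C * ((\<integral>t. B t \<partial>lborel) + K / U)"
  obtain c1 where c1: "c1 > 0" "\<And>\<kappa> x. \<bar>edgeworth_density \<kappa> ?p x\<bar> \<le> c1 * (1 + (\<Sum>j=1..?p. \<bar>\<kappa> j\<bar>))"
    using edgeworth_density_bounded[of ?p] by blast
  obtain c2 where c2: "c2 > 0" "\<And>\<kappa> x. \<bar>Phi x + (\<Sum>j=1..?p. (-1) ^ (j + 1) * \<kappa> j * dnormal j x)\<bar> \<le> c2 * (1 + (\<Sum>j=1..?p. \<bar>\<kappa> j\<bar>))"
    using edgeworth_bounded[of ?p] by blast
  have pk: "?p \<le> k" using pidx_props(1)[OF assms(2,3)] .
  define J where "J = (\<integral>x. cf_bound k \<alpha> x \<partial>lborel)"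
  have J0: "0 \<le> J" unfolding J_def by (intro Bochner_Integration.integral_nonneg cf_bound_nonneg)
  \<comment> \<open>If \<beta> + \<gamma> \<le> 1, each of the at most k coefficients has modulus at
    most 2, so K bounds the derivative of N_p.\<close>
  define K where "K = c1 * (1 + 2 * real k)"
  have K0: "K > 0" unfolding K_def using c1(1) by simp
  \<comment> \<open>The first summand is for \<beta> + \<gamma> \<le> 1 and the second for \<beta> +
    \<gamma> > 1.\<close>
  define c where "c = C * (J + K) + (1 + c2 * (1 + 2 * real k))"
  have c0: "c > 0" unfolding c_def using C J0 K0 c2(1)
    by (intro add_nonneg_pos add_pos_nonneg mult_nonneg_nonneg) auto
  have "\<bar>FS k n \<mu> l t x - Np k n \<mu> l t ?p x\<bar> \<le> c * (beta n \<mu> l + gamma \<alpha> k n \<mu> t)"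
    if h: "n \<ge> 1" "prob_space \<mu>" "sets \<mu> = sets borel" "l \<in> borel_measurable borel"
      "integrable \<mu> l" "(\<integral>x. l x \<partial>\<mu>) = 0" "integrable \<mu> (\<lambda>x. (l x)\<^sup>2)" "real n * (\<integral>x. (l x)\<^sup>2 \<partial>\<mu>) = 1"
      "\<forall>j\<in>{1..k}. t j \<in> borel_measurable (PiM {..<j} (\<lambda>_. borel)) \<and> symmetric_fun j (t j) \<and>
        integrable (joint j \<mu>) (t j) \<and> degenerate \<mu> j (t j)"
      "integrable \<mu> (\<lambda>x. \<bar>l x\<bar> ^ 3)"
      "\<forall>j\<in>{1..k}. j \<le> n \<longrightarrow> integrable (joint j \<mu>) (\<lambda>x. \<bar>t j x\<bar> powr \<alpha>)"
    for n :: nat and \<mu> :: "real measure" and l :: "real \<Rightarrow> real" and t :: "nat \<Rightarrow> (nat \<Rightarrow> real) \<Rightarrow> real" and x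
  proof -
    interpret prob_space \<mu> by (rule h)
    interpret ustat \<mu> n k l t \<alpha>
      by unfold_locales (use h assms in auto)
    let ?\<epsilon> = "beta n \<mu> l + gamma \<alpha> k n \<mu> t"
    let ?F = "distr (iid {..<n}) borel (SS k n l t)"
    interpret F: real_distribution ?F
      by (rule P.real_distribution_distr) measurable
    have \<epsilon>0: "0 < ?\<epsilon>" using \<beta>_pos \<gamma>_nonneg by linarith
    have c_ge: "C * (J + K) \<le> c" "1 + c2 * (1 + 2 * real k) \<le> c"
      unfolding c_def using C J0 K0 c2(1) by auto
    show ?thesis
    proof (cases "?\<epsilon> \<le> 1")
      case True
      define \<kappa>' where "\<kappa>' = kappa k n \<mu> l t"
      define G where "G = (\<lambda>x. Phi x + (\<Sum>j=1..?p. (-1) ^ (j + 1) * \<kappa>' j * dnormal j x))"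
      have \<kappa>sum: "(\<Sum>j=1..?p. \<bar>\<kappa>' j\<bar>) \<le> 2 * real k"
      proof -
        have "(\<Sum>j=1..?p. \<bar>\<kappa>' j\<bar>) \<le> (\<Sum>j=1..?p. 2)"
        proof (rule sum_mono)
          fix j assume "j \<in> {1..?p}"
          hence "\<bar>\<kappa>' j\<bar> \<le> gamma \<alpha> k n \<mu> t + max 1 (beta n \<mu> l)"
            unfolding \<kappa>'_def by (intro abs_kappa_le) auto
          thus "\<bar>\<kappa>' j\<bar> \<le> 2" using True \<beta>_pos \<gamma>_nonneg by linarith
        qed
        thus ?thesis using pk by simp
      qed
      have Gd: "(G has_real_derivative edgeworth_density \<kappa>' ?p x) (at x)" for x
        unfolding G_def edgeworth_density_def
        by (auto intro!: derivative_eq_intros Phi_has_real_derivative dnormal_has_derivative sum.cong simp: dnormal_0)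
      have cD: "continuous_on UNIV (edgeworth_density \<kappa>' ?p)"
        unfolding edgeworth_density_def[abs_def] by (intro continuous_intros continuous_dnormal)
      have iD: "integrable lborel (edgeworth_density \<kappa>' ?p)"
        unfolding edgeworth_density_def[abs_def]
        by (intro Bochner_Integration.integrable_add Bochner_Integration.integrable_sum integrable_mult_right dnormal_integrable)
      have G0: "(G \<longlongrightarrow> 0) at_bot"
      proof -
        have d: "(dnormal j \<longlongrightarrow> 0) at_bot" for j
          by (rule filterlim_mono[OF dnormal_tendsto_0 order_refl at_bot_le_at_infinity])
        have "(G \<longlongrightarrow> 0 + (\<Sum>j=1..?p. (-1) ^ (j + 1) * \<kappa>' j * 0)) at_bot"
          unfolding G_def by (intro tendsto_intros Phi_at_bot d)
        thus ?thesis by simp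
      qed
      have Gb: "\<exists>b. \<forall>x. \<bar>G x\<bar> \<le> b" unfolding G_def using c2(2) by blast
      have DK: "\<bar>edgeworth_density \<kappa>' ?p x\<bar> \<le> K" for x
        using c1(2)[of \<kappa>' x] mult_left_mono[of "1 + (\<Sum>j=1..?p. \<bar>\<kappa>' j\<bar>)" "1 + 2 * real k" c1] \<kappa>sum c1(1)
        unfolding K_def by linarith
      \<comment> \<open>The cutoff 1/\<beta> makes the Lipschitz term of the smoothing inequality
        equal to K \<beta>, which is of the required order.\<close>
      have "\<bar>cdf ?F x - G x\<bar> \<le> C * ((\<integral>x. ?\<epsilon> * cf_bound k \<alpha> x \<partial>lborel) + K / (1 / beta n \<mu> l))"
      proof (rule smoothing[OF F.real_distribution_axioms Gd cD iD G0 Gb K0 DK])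
        show "0 < 1 / beta n \<mu> l" using \<beta>_pos by simp
        show "integrable lborel (\<lambda>x. ?\<epsilon> * cf_bound k \<alpha> x)" using integrable_cf_bound[OF assms(3)] by simp
        show "0 \<le> ?\<epsilon> * cf_bound k \<alpha> \<tau>" for \<tau> using \<epsilon>0 cf_bound_nonneg by simp
        fix \<tau> assume "0 < \<tau>" "\<tau> \<le> 1 / beta n \<mu> l"
        from fS_minus_edgeworth_le[OF this True]
        show "cmod (char ?F \<tau> - (\<integral>x. edgeworth_density \<kappa>' ?p x *\<^sub>R iexp (\<tau> * x) \<partial>lborel)) \<le> \<tau> * (?\<epsilon> * cf_bound k \<alpha> \<tau>)"
          unfolding char_SS edgeworth_density_fourier \<kappa>'_def by simp
      qed
      also have "\<dots> = C * (?\<epsilon> * J + K * beta n \<mu> l)" by (simp add: J_def)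
      also have "\<dots> \<le> C * (?\<epsilon> * J + K * ?\<epsilon>)"
        using C K0 \<gamma>_nonneg by (intro mult_left_mono add_left_mono) auto
      also have "\<dots> = C * (J + K) * ?\<epsilon>" by (simp add: algebra_simps)
      also have "\<dots> \<le> c * ?\<epsilon>" using c_ge(1) \<epsilon>0 by (intro mult_right_mono) auto
      finally show ?thesis unfolding FS_eq_cdf Np_eq G_def \<kappa>'_def .
    next
      case False
      \<comment> \<open>Here 1 < \<beta> + \<gamma>, so the distribution function is trivially below
        the bound and only the size of N_p has to be estimated, again through
        \<open>abs_kappa_le\<close>.\<close>
      have "\<bar>Np k n \<mu> l t ?p x\<bar> \<le> c2 * (1 + (\<Sum>j=1..?p. \<bar>kappa k n \<mu> l t j\<bar>))"
        unfolding Np_eq by (rule c2(2))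
      also have "\<dots> \<le> c2 * (?\<epsilon> + (\<Sum>j=1..?p. 2 * ?\<epsilon>))"
      proof (intro mult_left_mono add_mono sum_mono)
        fix j assume "j \<in> {1..?p}"
        hence "\<bar>kappa k n \<mu> l t j\<bar> \<le> gamma \<alpha> k n \<mu> t + max 1 (beta n \<mu> l)"
          by (intro abs_kappa_le) auto
        thus "\<bar>kappa k n \<mu> l t j\<bar> \<le> 2 * ?\<epsilon>" using False \<beta>_pos \<gamma>_nonneg by (simp add: max_def split: if_splits)
      qed (use False c2(1) in auto)
      also have "\<dots> \<le> c2 * (?\<epsilon> + real k * (2 * ?\<epsilon>))"
        using c2(1) pk \<epsilon>0 by (intro mult_left_mono add_left_mono) (auto intro!: mult_right_mono)
      also have "\<dots> = c2 * (1 + 2 * real k) * ?\<epsilon>" by (simp add: algebra_simps)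
      finally have N: "\<bar>Np k n \<mu> l t ?p x\<bar> \<le> c2 * (1 + 2 * real k) * ?\<epsilon>" .
      have "\<bar>FS k n \<mu> l t x\<bar> \<le> ?\<epsilon>"
        using F.cdf_bounded_prob[of x] F.cdf_nonneg[of x] False unfolding FS_eq_cdf by linarith
      with N have "\<bar>FS k n \<mu> l t x - Np k n \<mu> l t ?p x\<bar> \<le> (1 + c2 * (1 + 2 * real k)) * ?\<epsilon>"
        by (simp only: distrib_right mult_1_left)
      also have "\<dots> \<le> c * ?\<epsilon>" using c_ge(2) \<epsilon>0 by (intro mult_right_mono) auto
      finally show ?thesis .
    qed
  qed
  thus ?thesis using c0 by (intro exI[of _ c]) blast
qed

end
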